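(* Consider the real scalar fast fading channel $Y_i=H_iX_i+Z_i$ described in the context with i.i.d. fading of a regular fading distribution. Let $\epsilon>0$ be fixed and let $\delta^*(n,\epsilon)$ be the supremum of the NLDs of $n$-dimensional lattices with average (maximal) error probability at most $\epsilon$. Then, as $n\to\infty$, $$\delta^*(n,\epsilon)=\delta^*-\sqrt{\frac{V}{n}}Q^{-1}(\epsilon)+O\!\left(\frac{\ln n}{n}\right),$$ where $\delta^*=E\left\{\tfrac12\ln\!\left(\tfrac{H^2}{2\pi e\sigma^2}\right)\right\}$ and $V=\tfrac12+\mathrm{Var}\!\left(\tfrac12\ln(H^2)\right)$.
   Context: Channel: $Y_i=H_iX_i+Z_i$, $\{H_i\}$ i.i.d. nonnegative with $E H_i^2=1$, $\{Z_i\}$ i.i.d. $N(0,\sigma^2)$, all independent; receiver knows $\mathbf H=\mathrm{diag}(H_1,\dots,H_n)$. Regular fading distribution: PDF $f$ with $f(h)\propto h^{\alpha-1}$ for all small $h>0$, some $\alpha>0$. A lattice $\Lambda\subset\mathbb R^n$ (full rank, generator matrix $G_\Lambda$) has density $\gamma=1/|\det G_\Lambda|$ and NLD $\delta=\frac1n\ln\gamma$. Given $\mathbf H$, the received lattice is $\mathbf H\Lambda$; the error probability of a point $\mathbf H\lambda$ is $\Pr\{\mathbf H\lambda+\mathbf z\notin W(\mathbf H\lambda)\mid\mathbf H\}$ with $W$ the Voronoi cell in $\mathbf H\Lambda$ (ML decoding); the average error probability is the expectation over $\mathbf H$ of the limsup over growing cubes $\mathbf H\cdot\{|x_i|<a/2\}$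 of the average of these over the received lattice points in the cube (for lattices this equals the error probability of any single point). $Q$ is the standard Gaussian complementary CDF. *)

theory Defs
  imports "HOL-Probability.Probability" "HOL-Library.Landau_Symbols"
begin

(* Vectors in R^n are represented as functions nat => real that are extensional on {..<n}
   (i.e. elements of PiE {..<n} (\<lambda>_. UNIV)); this is also the carrier of the product
   measures used below. Matrices are functions nat => nat => real, only entries i,j < n matter. *)

definition vadd :: "nat \<Rightarrow> (nat \<Rightarrow> real) \<Rightarrow> (nat \<Rightarrow> real) \<Rightarrow> (nat \<Rightarrow> real)" where
  "vadd n x y = (\<lambda>i\<in>{..<n}. x i + y i)"

definition hmul :: "nat \<Rightarrow> (nat \<Rightarrow> real) \<Rightarrow> (nat \<Rightarrow> real) \<Rightarrow> (nat \<Rightarrow> real)" where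
  "hmul n h x = (\<lambda>i\<in>{..<n}. h i * x i)"

definition sqdist :: "nat \<Rightarrow> (nat \<Rightarrow> real) \<Rightarrow> (nat \<Rightarrow> real) \<Rightarrow> real" where
  "sqdist n x y = (\<Sum>i<n. (x i - y i)\<^sup>2)"

definition gen_det :: "nat \<Rightarrow> (nat \<Rightarrow> nat \<Rightarrow> real) \<Rightarrow> real" where
  "gen_det n G = (\<Sum>p | p permutes {..<n}. of_int (sign p) * (\<Prod>i<n. G i (p i)))"

definition lattice_pts :: "nat \<Rightarrow> (nat \<Rightarrow> nat \<Rightarrow> real) \<Rightarrow> (nat \<Rightarrow> real) set" where
  "lattice_pts n G = {(\<lambda>i\<in>{..<n}. \<Sum>j<n. G i j * real_of_int (k j)) | k :: nat \<Rightarrow> int. True}"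

(* normalized log density: delta = (1/n) ln gamma, gamma = 1/|det G| *)
definition nld :: "nat \<Rightarrow> (nat \<Rightarrow> nat \<Rightarrow> real) \<Rightarrow> real" where
  "nld n G = ln (1 / \<bar>gen_det n G\<bar>) / real n"

definition regular_fading_pdf :: "(real \<Rightarrow> real) \<Rightarrow> bool" where
  "regular_fading_pdf f \<longleftrightarrow>
     f \<in> borel_measurable borel \<and> (\<forall>x. 0 \<le> f x) \<and> (\<forall>x<0. f x = 0) \<and>
     (\<integral>\<^sup>+ x. ennreal (f x) \<partial>lborel) = 1 \<and>
     (\<integral>\<^sup>+ x. ennreal (x\<^sup>2 * f x) \<partial>lborel) = 1 \<and>
     (\<exists>\<alpha>>0. \<exists>c>0. \<exists>h0>0. \<forall>x. 0 < x \<and> x < h0 \<longrightarrow> f x = c * x powr (\<alpha> - 1))"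

definition fading_dist :: "(real \<Rightarrow> real) \<Rightarrow> real measure" where
  "fading_dist f = density lborel (\<lambda>x. ennreal (f x))"

definition fading_vec :: "(real \<Rightarrow> real) \<Rightarrow> nat \<Rightarrow> (nat \<Rightarrow> real) measure" where
  "fading_vec f n = PiM {..<n} (\<lambda>_. fading_dist f)"

definition noise_vec :: "real \<Rightarrow> nat \<Rightarrow> (nat \<Rightarrow> real) measure" where
  "noise_vec \<sigma> n = PiM {..<n} (\<lambda>_. density lborel (\<lambda>x. ennreal (normal_density 0 \<sigma> x)))"

definition voronoi :: "nat \<Rightarrow> (nat \<Rightarrow> real) set \<Rightarrow> (nat \<Rightarrow> real) \<Rightarrow> (nat \<Rightarrow> real) set" where
  "voronoi n L y = {w. \<forall>\<mu>\<in>L. sqdist n w y \<le> sqdist n w \<mu>}"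

definition recv_lattice :: "nat \<Rightarrow> (nat \<Rightarrow> nat \<Rightarrow> real) \<Rightarrow> (nat \<Rightarrow> real) \<Rightarrow> (nat \<Rightarrow> real) set" where
  "recv_lattice n G h = hmul n h ` lattice_pts n G"

(* ML error probability of the received point y given H = h *)
definition pt_err :: "real \<Rightarrow> nat \<Rightarrow> (nat \<Rightarrow> nat \<Rightarrow> real) \<Rightarrow> (nat \<Rightarrow> real) \<Rightarrow> (nat \<Rightarrow> real) \<Rightarrow> real" where
  "pt_err \<sigma> n G h y =
     measure (noise_vec \<sigma> n)
       {z \<in> space (noise_vec \<sigma> n). vadd n y z \<notin> voronoi n (recv_lattice n G h) y}"

definition recv_cube :: "nat \<Rightarrow> (nat \<Rightarrow> real) \<Rightarrow> real \<Rightarrow> (nat \<Rightarrow> real) set" where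
  "recv_cube n h a = hmul n h ` {x \<in> PiE {..<n} (\<lambda>_. UNIV). \<forall>i<n. \<bar>x i\<bar> < a / 2}"

definition cube_avg_err :: "real \<Rightarrow> nat \<Rightarrow> (nat \<Rightarrow> nat \<Rightarrow> real) \<Rightarrow> (nat \<Rightarrow> real) \<Rightarrow> real \<Rightarrow> real" where
  "cube_avg_err \<sigma> n G h a =
     (let S = recv_lattice n G h \<inter> recv_cube n h a
      in (\<Sum>y\<in>S. pt_err \<sigma> n G h y) / real (card S))"

definition lattice_avg_err :: "(real \<Rightarrow> real) \<Rightarrow> real \<Rightarrow> nat \<Rightarrow> (nat \<Rightarrow> nat \<Rightarrow> real) \<Rightarrow> real" where
  "lattice_avg_err f \<sigma> n G =
     (\<integral>h. real_of_ereal (Limsup at_top (\<lambda>a::real. ereal (cube_avg_err \<sigma> n G h a))) \<partial>fading_vec f n)"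

definition lattice_max_err :: "(real \<Rightarrow> real) \<Rightarrow> real \<Rightarrow> nat \<Rightarrow> (nat \<Rightarrow> nat \<Rightarrow> real) \<Rightarrow> real" where
  "lattice_max_err f \<sigma> n G =
     (\<integral>h. (SUP y\<in>recv_lattice n G h. pt_err \<sigma> n G h y) \<partial>fading_vec f n)"

definition delta_star_avg :: "(real \<Rightarrow> real) \<Rightarrow> real \<Rightarrow> nat \<Rightarrow> real \<Rightarrow> real" where
  "delta_star_avg f \<sigma> n \<epsilon> = Sup {nld n G | G. gen_det n G \<noteq> 0 \<and> lattice_avg_err f \<sigma> n G \<le> \<epsilon>}"

definition delta_star_max :: "(real \<Rightarrow> real) \<Rightarrow> real \<Rightarrow> nat \<Rightarrow> real \<Rightarrow> real" where
  "delta_star_max f \<sigma> n \<epsilon> = Sup {nld n G | G. gen_det n G \<noteq> 0 \<and> lattice_max_err f \<sigma> n G \<le> \<epsilon>}"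

definition delta_star :: "(real \<Rightarrow> real) \<Rightarrow> real \<Rightarrow> real" where
  "delta_star f \<sigma> = (\<integral>x. ln (x\<^sup>2 / (2 * pi * exp 1 * \<sigma>\<^sup>2)) / 2 \<partial>fading_dist f)"

definition fading_V :: "(real \<Rightarrow> real) \<Rightarrow> real" where
  "fading_V f =
     (let m = (\<integral>x. ln (x\<^sup>2) / 2 \<partial>fading_dist f)
      in 1 / 2 + (\<integral>x. (ln (x\<^sup>2) / 2 - m)\<^sup>2 \<partial>fading_dist f))"

definition Qfun :: "real \<Rightarrow> real" where
  "Qfun x = measure (density lborel (\<lambda>t. ennreal (std_normal_density t))) {x<..}"

definition Qinv :: "real \<Rightarrow> real" where
  "Qinv e = (THE x. Qfun x = e)"

end

theory Submission
  imports Defs "Jordan_Normal_Form.Determinant"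
begin

text \<open>
  Both directions reduce to one sum of i.i.d. terms. Let \<open>p\<close> be the density of the noise, \<open>\<gamma> = exp (n \<delta>)\<close>
  the density of the lattice and \<open>S = - \<Sum>i<n. ln (p (Z i) * H i)\<close>, which has mean \<open>- n \<delta>*\<close> and
  variance \<open>n V\<close>.

  Converse: the Voronoi cell of the received lattice has volume \<open>(\<Prod>i<n. H i) / \<gamma>\<close>, and the part of it
  where the noise density is at most \<open>\<tau>\<close> has Gaussian mass at most \<open>\<tau>\<close> times that volume. With \<open>\<tau>\<close> chosen
  to make this product \<open>1 / sqrt n\<close>, correct decoding has probability at most
  \<open>P (S \<le> - n \<delta> + ln n / 2) + 1 / sqrt n\<close>.

  Achievability: the ball \<open>{w. \<bar>w\<bar> \<le> \<bar>z\<bar>}\<close> has volume at most \<open>1 / p z\<close>, because the noise density is at least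
  \<open>p z\<close> on it. Averaging the union bound over random lattices, as in the Minkowski-Hlawka theorem but
  with a constant factor lost, gives a lattice with error probability at most
  \<open>P (S > - n \<delta> - ln n / 2) + 5 / sqrt n\<close>.

  A term \<open>O (ln n / sqrt n)\<close> in these probabilities moves \<open>\<delta>\<close> by \<open>O (ln n / n)\<close> only, so a Berry-Esseen
  bound with a logarithmic loss suffices; it follows from Levy's inversion formula after convolution
  with a Gaussian.
\<close>

section \<open>Affine changes of variables\<close>

text \<open>The lattice must be fixed before the fades are drawn, so the averaging argument cannot
  be run separately for each fade. It is applied to the probability, over fades and noise together,
  that a given transmitted vector beats the origin; Tonelli reduces its integral to one volume per
  channel realisation. That volume is taken on the transmitter side, whence the factor
  \<open>H i\<close> next to \<open>p (Z i)\<close> in \<open>S\<close>. Fades near 0 would make the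
  set of competitors unbounded, so the channel is truncated, by an amount for which no rate is
  required. The same fades threaten the moments of \<open>ln H\<close>; the power law of the density
  near 0 and the finite second moment make the third absolute moment finite. Errors in probability
  are cheap because \<open>\<Phi>\<close> has positive slope at the target quantile: an error
  \<open>\<eta>\<close> moves the normalised threshold by O(\<open>\<eta>\<close>), hence
  \<open>n \<delta>\<close> by O(\<open>sqrt n * \<eta>\<close>). Average and maximal error agree by
  translation invariance, so a single supremum is estimated.\<close>

abbreviation LB :: "nat \<Rightarrow> (nat \<Rightarrow> real) measure" where
  "LB n \<equiv> PiM {..<n} (\<lambda>_. lborel)"

interpretation lborel_fam: product_sigma_finite "\<lambda>_::nat. lborel :: real measure" ..

section \<open>Determinants under elimination and exchange of columns\<close>

lemma gen_det_mat: "gen_det n G = Determinant.det (Matrix.mat n n (\<lambda>(i, j). G i j))"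
proof -
  have "(\<Prod>i<n. G i (p i)) = (\<Prod>i = 0..<n. Matrix.mat n n (\<lambda>(i, j). G i j) $$ (i, p i))"
    if "p permutes {0..<n}" for p
    using that permutes_in_image[OF that] by (auto simp: atLeast0LessThan intro!: prod.cong)
  then show ?thesis
    unfolding gen_det_def Determinant.det_def
    by (auto simp: atLeast0LessThan intro!: sum.cong)
qed

lemma gen_det_row_scale: "gen_det n (\<lambda>i j. h i * G i j) = (\<Prod>i<n. h i) * gen_det n G"
  unfolding gen_det_def by (simp add: prod.distrib sum_distrib_left ac_simps)

lemma gen_det_upper_triangular:
  assumes "\<And>i j. i < n \<Longrightarrow> j < i \<Longrightarrow> G i j = 0"
  shows "gen_det n G = (\<Prod>i<n. G i i)"
proof -
  have "upper_triangular (Matrix.mat n n (\<lambda>(i, j). G i j))"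
    using assms by (auto simp: upper_triangular_def)
  then have "gen_det n G = prod_list (diag_mat (Matrix.mat n n (\<lambda>(i, j). G i j)))"
    unfolding gen_det_mat by (rule det_upper_triangular[of _ n]) simp
  also have "\<dots> = (\<Prod>i<n. G i i)"
    by (auto simp: prod_list_diag_prod atLeast0LessThan intro!: prod.cong)
  finally show ?thesis .
qed

lemma gen_det_swap_cols:
  assumes "k < n" "l < n" "k \<noteq> l"
  shows "gen_det n (\<lambda>i j. G i (Transposition.transpose k l j)) = - gen_det n G"
proof -
  have "swapcols k l (Matrix.mat n n (\<lambda>(i, j). G i j)) = Matrix.mat n n (\<lambda>(i, j). G i (Transposition.transpose k l j))"
    using assms by (intro eq_matI) (auto simp: mat_swapcols_def Transposition.transpose_def)
  then show ?thesis
    unfolding gen_det_mat using det_swapcols[OF assms, of "Matrix.mat n n (\<lambda>(i, j). G i j)"] by simp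
qed

text \<open>The matrix factors into a unit upper block-triangular matrix and a lower
  block-triangular one whose large block is the Schur complement of the last entry. The entries of
  that complement are exactly the coefficients that remain when the last variable is eliminated from
  an integral.\<close>

lemma gen_det_schur:
  assumes d: "G n n \<noteq> 0"
  shows "gen_det (Suc n) G = gen_det n (\<lambda>i j. G i j - G i n * G n j / G n n) * G n n"
proof -
  let ?A = "Matrix.mat n n (\<lambda>(i, j). G i j - G i n * G n j / G n n)"
  let ?b = "Matrix.mat n 1 (\<lambda>(i, j). G i n / G n n)"
  let ?c = "Matrix.mat 1 n (\<lambda>(i, j). G n j)"
  let ?d = "Matrix.mat 1 1 (\<lambda>(i, j). G n n)"
  let ?U = "four_block_mat (1\<^sub>m n) ?b (0\<^sub>m 1 n) (1\<^sub>m 1)"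
  let ?L = "four_block_mat ?A (0\<^sub>m n 1) ?c ?d"
  have "?U * ?L = four_block_mat (1\<^sub>m n * ?A + ?b * ?c) (1\<^sub>m n * 0\<^sub>m n 1 + ?b * ?d)
      (0\<^sub>m 1 n * ?A + 1\<^sub>m 1 * ?c) (0\<^sub>m 1 n * 0\<^sub>m n 1 + 1\<^sub>m 1 * ?d)"
    by (rule mult_four_block_mat) auto
  also have "\<dots> = Matrix.mat (Suc n) (Suc n) (\<lambda>(i, j). G i j)"
    using d by (intro eq_matI) (auto simp: scalar_prod_def less_Suc_eq)
  finally have "gen_det (Suc n) G = Determinant.det (?U * ?L)"
    unfolding gen_det_mat by simp
  also have "\<dots> = Determinant.det ?U * Determinant.det ?L"
    by (rule Determinant.det_mult[of _ "Suc n"]) auto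
  also have "Determinant.det ?U = Determinant.det (1\<^sub>m n :: real mat) * Determinant.det (1\<^sub>m 1 :: real mat)"
    by (rule det_four_block_mat_lower_left_zero) auto
  also have "Determinant.det ?L = Determinant.det ?A * Determinant.det ?d"
    by (rule det_four_block_mat_upper_right_zero) auto
  also have "Determinant.det ?d = G n n"
    by (simp add: det_single)
  finally show ?thesis
    by (simp add: gen_det_mat)
qed

lemma gen_det_zero_row: "k < n \<Longrightarrow> (\<And>j. j < n \<Longrightarrow> G k j = 0) \<Longrightarrow> gen_det n G = 0"
  unfolding gen_det_def
  by (intro sum.neutral ballI) (auto simp: permutes_in_image[of _ "{..<n}", unfolded lessThan_iff] intro!: prod_zero bexI[of _ k])

text \<open>Exchanging columns of a linear map is a relabelling of its variables; invariance of
  Lebesgue measure under it lets a nonzero entry of the last row be moved onto the diagonal.\<close>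

lemma distr_LB_permute:
  assumes p: "p permutes {..<n}"
  shows "distr (LB n) (LB n) (\<lambda>x. \<lambda>i\<in>{..<n}. x (p i)) = LB n"
proof (rule lborel_fam.PiM_eqI)
  fix A :: "nat \<Rightarrow> real set" assume A: "\<And>i. i \<in> {..<n} \<Longrightarrow> A i \<in> sets lborel"
  have pl: "p i < n \<longleftrightarrow> i < n" for i using permutes_in_image[OF p, of i] by simp
  have ip: "Hilbert_Choice.inv p permutes {..<n}" using p by (rule permutes_inv)
  have ipl: "Hilbert_Choice.inv p i < n \<longleftrightarrow> i < n" for i using permutes_in_image[OF ip, of i] by simp
  have inv: "p (Hilbert_Choice.inv p i) = i" "Hilbert_Choice.inv p (p i) = i" for i using permutes_inverses[OF p] by auto
  have [measurable]: "(\<lambda>x. \<lambda>i\<in>{..<n}. x (p i)) \<in> measurable (LB n) (LB n)"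
    by (intro measurable_restrict measurable_component_singleton) (simp add: pl)
  have "emeasure (distr (LB n) (LB n) (\<lambda>x. \<lambda>i\<in>{..<n}. x (p i))) (Pi\<^sub>E {..<n} A)
      = emeasure (LB n) ((\<lambda>x. \<lambda>i\<in>{..<n}. x (p i)) -` (Pi\<^sub>E {..<n} A) \<inter> space (LB n))"
    using A by (intro emeasure_distr) (auto intro!: sets_PiM_I_finite)
  also have "(\<lambda>x. \<lambda>i\<in>{..<n}. x (p i)) -` (Pi\<^sub>E {..<n} A) \<inter> space (LB n) = Pi\<^sub>E {..<n} (\<lambda>i. A (Hilbert_Choice.inv p i))"
  proof -
    have "(\<forall>i\<in>{..<n}. x (p i) \<in> A i) \<longleftrightarrow> (\<forall>i\<in>{..<n}. x i \<in> A (Hilbert_Choice.inv p i))" for x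
      using inv pl ipl unfolding Ball_def lessThan_iff by metis
    then show ?thesis
      by (auto simp: space_PiM PiE_iff)
  qed
  also have "emeasure (LB n) \<dots> = (\<Prod>i<n. emeasure lborel (A (Hilbert_Choice.inv p i)))"
    using A by (intro lborel_fam.emeasure_PiM) (auto simp: ipl)
  also have "\<dots> = (\<Prod>i<n. emeasure lborel (A i))"
    using ip by (rule prod.permute[symmetric, unfolded comp_def])
  finally show "emeasure (distr (LB n) (LB n) (\<lambda>x. \<lambda>i\<in>{..<n}. x (p i))) (Pi\<^sub>E {..<n} A) = (\<Prod>i\<in>{..<n}. emeasure lborel (A i))" .
qed simp_all

text \<open>Induction step with the last diagonal entry as pivot. The last output coordinate
  replaces the last variable at the cost \<open>1 / \<bar>d\<bar>\<close>; with it held fixed, the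
  other outputs are an affine map of the remaining variables whose linear part is the Schur
  complement. The fixed coordinate enters their constant terms, which is why the induction runs over
  affine rather than linear maps.\<close>

lemma nn_integral_LB_affine_pivot:
  fixes G :: "nat \<Rightarrow> nat \<Rightarrow> real"
  assumes IH: "\<And>G c u. gen_det n G \<noteq> 0 \<Longrightarrow> u \<in> borel_measurable (LB n) \<Longrightarrow>
      (\<integral>\<^sup>+x. u (\<lambda>i\<in>{..<n}. (\<Sum>j<n. G i j * x j) + c i) \<partial>LB n) = ennreal (1 / \<bar>gen_det n G\<bar>) * (\<integral>\<^sup>+x. u x \<partial>LB n)"
  assumes det: "gen_det (Suc n) G \<noteq> 0" and d: "G n n \<noteq> 0"
    and u[measurable]: "u \<in> borel_measurable (LB (Suc n))"
  shows "(\<integral>\<^sup>+x. u (\<lambda>i\<in>{..<Suc n}. (\<Sum>j<Suc n. G i j * x j) + c i) \<partial>LB (Suc n))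
      = ennreal (1 / \<bar>gen_det (Suc n) G\<bar>) * (\<integral>\<^sup>+x. u x \<partial>LB (Suc n))"
proof -
  define d where "d = G n n"
  define G' where "G' = (\<lambda>i j. G i j - G i n * G n j / G n n)"
  \<comment> \<open>The integrand in the new variables: position \<open>n\<close> now holds the last
    output coordinate itself, and the other outputs are rewritten in terms of it.\<close>
  define W where "W = (\<lambda>y. u (\<lambda>i\<in>{..<Suc n}. if i = n then y n
      else (\<Sum>j<n. G' i j * y j) + (c i + G i n * (y n - c n) / d)))"
  have detG: "gen_det (Suc n) G = gen_det n G' * d"
    unfolding G'_def d_def using d by (rule gen_det_schur)
  with det have det': "gen_det n G' \<noteq> 0" and d0: "d \<noteq> 0" by auto
  have ins: "insert n {..<n} = {..<Suc n}" by auto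
  note rec = lborel_fam.product_nn_integral_insert[of "{..<n}" n, unfolded ins]
  note rec' = lborel_fam.product_nn_integral_insert_rev[of "{..<n}" n, unfolded ins]
  have mW[measurable]: "W \<in> borel_measurable (LB (Suc n))"
    unfolding W_def by measurable
  have upd: "(\<lambda>(x, s). x(n := s)) \<in> measurable (LB n \<Otimes>\<^sub>M lborel) (LB (Suc n))"
    using measurable_add_dim[of n "{..<n}" "\<lambda>_. lborel"] unfolding ins .
  have upd1: "(\<lambda>s. x(n := s)) \<in> measurable lborel (LB (Suc n))" if "x \<in> space (LB n)" for x
    using measurable_compose[OF measurable_Pair1'[OF that, of lborel] upd] by simp
  have upd2: "(\<lambda>x. x(n := s)) \<in> measurable (LB n) (LB (Suc n))" for s
    using measurable_compose[OF measurable_Pair2'[of s lborel "LB n"] upd] by simp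
  have "(\<integral>\<^sup>+x. u (\<lambda>i\<in>{..<Suc n}. (\<Sum>j<Suc n. G i j * x j) + c i) \<partial>LB (Suc n))
      = (\<integral>\<^sup>+x. \<integral>\<^sup>+t. u (\<lambda>i\<in>{..<Suc n}. (\<Sum>j<Suc n. G i j * (x(n:=t)) j) + c i) \<partial>lborel \<partial>LB n)"
    by (subst rec) simp_all
  also have "\<dots> = (\<integral>\<^sup>+x. ennreal (1 / \<bar>d\<bar>) * (\<integral>\<^sup>+s. W (x(n := s)) \<partial>lborel) \<partial>LB n)"
  proof (rule nn_integral_cong)
    fix x assume x: "x \<in> space (LB n)"
    let ?F = "\<lambda>t. u (\<lambda>i\<in>{..<Suc n}. (\<Sum>j<Suc n. G i j * (x(n:=t)) j) + c i)"
    let ?r = "\<Sum>j<n. G n j * x j"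
    have "(\<lambda>x. u (\<lambda>i\<in>{..<Suc n}. (\<Sum>j<Suc n. G i j * x j) + c i)) \<in> borel_measurable (LB (Suc n))"
      by measurable
    from measurable_compose[OF upd1[OF x] this] have mF: "?F \<in> borel_measurable borel"
      by simp
    have "(\<integral>\<^sup>+t. ?F t \<partial>lborel) = ennreal \<bar>1/d\<bar> * (\<integral>\<^sup>+s. ?F (- (c n + ?r)/d + (1/d) * s) \<partial>lborel)"
      using d0 mF by (intro nn_integral_real_affine) auto
    also have "(\<lambda>s. ?F (- (c n + ?r)/d + (1/d) * s)) = (\<lambda>s. W (x(n := s)))"
    proof
      fix s
      have "(\<Sum>j<Suc n. G i j * (x(n:=- (c n + ?r)/d + (1/d) * s)) j) + c i =
         (if i = n then s else (\<Sum>j<n. G' i j * x j) + (c i + G i n * (s - c n) / d))" for i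
      proof -
        have "(\<Sum>j<Suc n. G i j * (x(n:=- (c n + ?r)/d + (1/d) * s)) j) + c i
          = (\<Sum>j<n. G i j * x j) + G i n * (- (c n + ?r)/d + (1/d) * s) + c i" by simp
        also have "\<dots> = (if i = n then s else (\<Sum>j<n. G i j * x j) - G i n / d * ?r + (c i + G i n * (s - c n) / d))"
        proof (cases "i = n")
          case True
          have "d * (- (c n + ?r)/d + (1/d) * s) = s - c n - ?r" using d0 by (simp add: field_simps)
          with True show ?thesis by (simp add: d_def[symmetric])
        next
          case False
          have "G i n * (- (c n + ?r)/d + (1/d) * s) = G i n * (s - c n) / d - G i n / d * ?r"
            by (simp add: diff_divide_distrib add_divide_distrib algebra_simps)
          with False show ?thesis by simp
        qed
        also have "(\<Sum>j<n. G i j * x j) - G i n / d * ?r = (\<Sum>j<n. G' i j * x j)"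
          unfolding G'_def d_def
          by (simp add: sum_distrib_left sum_subtractf left_diff_distrib mult.assoc)
        finally show ?thesis .
      qed
      then show "?F (- (c n + ?r)/d + (1/d) * s) = W (x(n := s))"
        unfolding W_def by (intro arg_cong[where f=u] ext) (simp add: restrict_def)
    qed
    finally show "(\<integral>\<^sup>+t. ?F t \<partial>lborel) = ennreal (1 / \<bar>d\<bar>) * (\<integral>\<^sup>+s. W (x(n := s)) \<partial>lborel)"
      unfolding abs_divide abs_one .
  qed
  also have "\<dots> = ennreal (1 / \<bar>d\<bar>) * (\<integral>\<^sup>+x. \<integral>\<^sup>+s. W (x(n := s)) \<partial>lborel \<partial>LB n)"
    using measurable_compose[OF upd mW]
    by (intro nn_integral_cmult lborel.borel_measurable_nn_integral) (simp add: split_beta')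
  also have "(\<integral>\<^sup>+x. \<integral>\<^sup>+s. W (x(n := s)) \<partial>lborel \<partial>LB n) = (\<integral>\<^sup>+x. W x \<partial>LB (Suc n))"
    by (rule rec[symmetric]) auto
  also have "\<dots> = (\<integral>\<^sup>+s. \<integral>\<^sup>+x. W (x(n := s)) \<partial>LB n \<partial>lborel)"
    by (rule rec') auto
  also have "\<dots> = (\<integral>\<^sup>+s. ennreal (1 / \<bar>gen_det n G'\<bar>) * \<integral>\<^sup>+x. u (x(n := s)) \<partial>LB n \<partial>lborel)"
  proof (rule nn_integral_cong)
    fix s :: real
    have "(\<integral>\<^sup>+x. W (x(n := s)) \<partial>LB n) = (\<integral>\<^sup>+x. u ((\<lambda>i\<in>{..<n}. (\<Sum>j<n. G' i j * x j) + (c i + G i n * (s - c n) / d))(n := s)) \<partial>LB n)"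
      unfolding W_def by (intro nn_integral_cong arg_cong[where f=u]) (auto simp: fun_eq_iff)
    also have "\<dots> = ennreal (1 / \<bar>gen_det n G'\<bar>) * \<integral>\<^sup>+x. u (x(n := s)) \<partial>LB n"
      using upd2 det' by (intro IH[of G' "\<lambda>x. u (x(n := s))"]) (auto intro: measurable_compose)
    finally show "(\<integral>\<^sup>+x. W (x(n := s)) \<partial>LB n) = ennreal (1 / \<bar>gen_det n G'\<bar>) * \<integral>\<^sup>+x. u (x(n := s)) \<partial>LB n" .
  qed
  also have "\<dots> = ennreal (1 / \<bar>gen_det n G'\<bar>) * (\<integral>\<^sup>+s. \<integral>\<^sup>+x. u (x(n := s)) \<partial>LB n \<partial>lborel)"
  proof (rule nn_integral_cmult)
    have "(\<lambda>p. u ((snd p)(n := fst p))) \<in> borel_measurable (lborel \<Otimes>\<^sub>M LB n)"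
      using measurable_compose[OF measurable_compose[OF measurable_pair_swap' upd] u] by (simp add: split_beta')
    then show "(\<lambda>s. \<integral>\<^sup>+x. u (x(n := s)) \<partial>LB n) \<in> borel_measurable lborel"
      by (intro sigma_finite_measure.borel_measurable_nn_integral[OF lborel_fam.sigma_finite]) (simp_all add: split_beta')
  qed
  also have "(\<integral>\<^sup>+s. \<integral>\<^sup>+x. u (x(n := s)) \<partial>LB n \<partial>lborel) = (\<integral>\<^sup>+x. u x \<partial>LB (Suc n))"
    by (rule rec'[symmetric]) auto
  also have "ennreal (1 / \<bar>d\<bar>) * (ennreal (1 / \<bar>gen_det n G'\<bar>) * (\<integral>\<^sup>+x. u x \<partial>LB (Suc n)))
      = ennreal (1 / \<bar>gen_det (Suc n) G\<bar>) * (\<integral>\<^sup>+x. u x \<partial>LB (Suc n))"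
    unfolding detG abs_mult mult.assoc[symmetric]
    by (simp add: ennreal_mult[symmetric] mult.commute[of "\<bar>d\<bar>"])
  finally show ?thesis .
qed

text \<open>A nonzero determinant forces a nonzero entry in the last row, and exchanging its column
  with the last one changes only the sign of the determinant, so the pivot case applies.\<close>

lemma nn_integral_LB_affine:
  fixes G :: "nat \<Rightarrow> nat \<Rightarrow> real"
  assumes "gen_det n G \<noteq> 0" and "u \<in> borel_measurable (LB n)"
  shows "(\<integral>\<^sup>+x. u (\<lambda>i\<in>{..<n}. (\<Sum>j<n. G i j * x j) + c i) \<partial>LB n)
      = ennreal (1 / \<bar>gen_det n G\<bar>) * (\<integral>\<^sup>+x. u x \<partial>LB n)"
  using assms
proof (induction n arbitrary: G c u)
  case 0
  have "gen_det 0 G = 1" by (simp add: gen_det_upper_triangular)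
  then show ?case by (simp add: PiM_empty nn_integral_count_space_finite restrict_def)
next
  case (Suc n)
  note u[measurable] = Suc.prems(2)
  obtain k where k: "k < Suc n" "G n k \<noteq> 0"
    using Suc.prems(1) gen_det_zero_row[of n "Suc n" G] by auto
  show ?case
  proof (cases "k = n")
    case True
    show ?thesis by (rule nn_integral_LB_affine_pivot[OF Suc.IH]) (use k True Suc.prems in \<open>simp_all\<close>)
  next
    case False
    let ?t = "Transposition.transpose k n"
    let ?G = "\<lambda>i j. G i (?t j)"
    have t: "?t permutes {..<Suc n}" using k by (intro permutes_swap_id) auto
    have det: "gen_det (Suc n) ?G = - gen_det (Suc n) G"
      using k False by (intro gen_det_swap_cols) auto
    have mt: "(\<lambda>x. \<lambda>i\<in>{..<Suc n}. x (?t i)) \<in> measurable (LB (Suc n)) (LB (Suc n))"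
      using permutes_in_image[OF t] by (intro measurable_restrict measurable_component_singleton) blast
    have "(\<integral>\<^sup>+x. u (\<lambda>i\<in>{..<Suc n}. (\<Sum>j<Suc n. G i j * x j) + c i) \<partial>LB (Suc n))
       = (\<integral>\<^sup>+x. u (\<lambda>i\<in>{..<Suc n}. (\<Sum>j<Suc n. ?G i j * (\<lambda>i\<in>{..<Suc n}. x (?t i)) j) + c i) \<partial>LB (Suc n))"
    proof (intro nn_integral_cong arg_cong[where f=u] restrict_ext arg_cong2[where f="(+)"] refl)
      fix x :: "nat \<Rightarrow> real" and i
      show "(\<Sum>j<Suc n. G i j * x j) = (\<Sum>j<Suc n. ?G i j * (\<lambda>i\<in>{..<Suc n}. x (?t i)) j)"
        by (subst sum.permute[OF t]) (auto intro!: sum.cong)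
    qed
    also have "\<dots> = (\<integral>\<^sup>+x. u (\<lambda>i\<in>{..<Suc n}. (\<Sum>j<Suc n. ?G i j * x j) + c i) \<partial>distr (LB (Suc n)) (LB (Suc n)) (\<lambda>x. \<lambda>i\<in>{..<Suc n}. x (?t i)))"
      using mt by (subst nn_integral_distr) simp_all
    also have "\<dots> = (\<integral>\<^sup>+x. u (\<lambda>i\<in>{..<Suc n}. (\<Sum>j<Suc n. ?G i j * x j) + c i) \<partial>LB (Suc n))"
      unfolding distr_LB_permute[OF t] ..
    also have "\<dots> = ennreal (1 / \<bar>gen_det (Suc n) ?G\<bar>) * (\<integral>\<^sup>+x. u x \<partial>LB (Suc n))"
      by (rule nn_integral_LB_affine_pivot[OF Suc.IH]) (use Suc.prems k det in \<open>simp_all\<close>)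
    finally show ?thesis unfolding det abs_minus .
  qed
qed

section \<open>Lattices: Voronoi cells and averaging\<close>

abbreviation ZN :: "nat \<Rightarrow> (nat \<Rightarrow> int) set" where
  "ZN n \<equiv> PiE {..<n} (\<lambda>_. UNIV)"

lemma countable_ZN: "countable (ZN n)"
  by (intro countable_PiE) auto

lemma borel_measurable_nn_integral_countable:
  assumes "countable I" and "\<And>i. i \<in> I \<Longrightarrow> f i \<in> borel_measurable M"
  shows "(\<lambda>x. \<integral>\<^sup>+i. f i x \<partial>count_space I) \<in> borel_measurable M"
proof -
  interpret sigma_finite_measure "count_space I"
    using assms(1) by (rule sigma_finite_measure_count_space_countable)
  have "(\<lambda>(x, i). f i x) \<in> borel_measurable (M \<Otimes>\<^sub>M count_space I)"
    unfolding split_beta'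
    using assms by (intro measurable_compose_countable'[where f="\<lambda>i p. f i (fst p)" and g=snd and I=I]) auto
  then show ?thesis by (rule borel_measurable_nn_integral)
qed

section \<open>Covering space by integer translates of a scaled cube\<close>

lemma nn_integral_LB_diag:
  assumes "a \<noteq> 0" and u: "u \<in> borel_measurable (LB n)"
  shows "(\<integral>\<^sup>+x. u (\<lambda>i\<in>{..<n}. a * x i + c i) \<partial>LB n) = ennreal (1 / \<bar>a\<bar> ^ n) * (\<integral>\<^sup>+x. u x \<partial>LB n)"
proof -
  let ?G = "\<lambda>i j. if i = j then a else 0 :: real"
  have det: "gen_det n ?G = a ^ n" by (subst gen_det_upper_triangular) auto
  have "(\<integral>\<^sup>+x. u (\<lambda>i\<in>{..<n}. a * x i + c i) \<partial>LB n) = (\<integral>\<^sup>+x. u (\<lambda>i\<in>{..<n}. (\<Sum>j<n. ?G i j * x j) + c i) \<partial>LB n)"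
    by (intro nn_integral_cong arg_cong[where f=u] restrict_ext)
       (simp add: if_distrib[of "\<lambda>y. y * _"] sum.delta cong: if_cong)
  also have "\<dots> = ennreal (1 / \<bar>gen_det n ?G\<bar>) * (\<integral>\<^sup>+x. u x \<partial>LB n)"
    using assms det by (intro nn_integral_LB_affine) auto
  finally show ?thesis unfolding det by (simp add: power_abs)
qed

text \<open>The admissible \<open>m\<close> fill a half-open interval of length
  \<open>\<bar>k\<bar>\<close>, which contains exactly \<open>\<bar>k\<bar>\<close> integers
  wherever it lies. For negative \<open>k\<close> the closed end is on the left instead of the
  right, hence the ceiling in place of the floor.\<close>

lemma card_int_quotient_unit:
  assumes k: "(k::int) \<noteq> 0"
  shows "finite {m::int. 0 \<le> (y - real_of_int m) / real_of_int k \<and> (y - real_of_int m) / real_of_int k < 1}"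
    and "card {m::int. 0 \<le> (y - real_of_int m) / real_of_int k \<and> (y - real_of_int m) / real_of_int k < 1} = nat \<bar>k\<bar>"
proof -
  have *: "{m::int. 0 \<le> (y - real_of_int m) / real_of_int k \<and> (y - real_of_int m) / real_of_int k < 1}
    = (if k > 0 then {\<lfloor>y\<rfloor> - k + 1..\<lfloor>y\<rfloor>} else {\<lceil>y\<rceil>..\<lceil>y\<rceil> + \<bar>k\<bar> - 1})" (is "?S = _")
  proof (cases "k > 0")
    case True
    have "m \<in> ?S \<longleftrightarrow> m \<le> y \<and> y - k < m" for m
      using True by (auto simp: field_simps)
    moreover have "m \<le> y \<and> y - k < m \<longleftrightarrow> m \<in> {\<lfloor>y\<rfloor> - k + 1..\<lfloor>y\<rfloor>}" for m
      unfolding atLeastAtMost_iff by linarith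
    ultimately show ?thesis using True by (auto simp only: if_True)
  next
    case False
    then have k: "k < 0" using k by simp
    have "m \<in> ?S \<longleftrightarrow> y \<le> m \<and> m < y - k" for m
      using k by (auto simp: field_simps)
    moreover have "y \<le> m \<and> m < y - k \<longleftrightarrow> m \<in> {\<lceil>y\<rceil>..\<lceil>y\<rceil> + \<bar>k\<bar> - 1}" for m
      unfolding atLeastAtMost_iff using k by linarith
    ultimately show ?thesis using False by (auto simp only: if_False)
  qed
  show "finite ?S" unfolding * by simp
  show "card ?S = nat \<bar>k\<bar>" unfolding * using k by auto
qed

lemma unit_cube_sets[measurable]: "PiE {..<n} (\<lambda>_. {0..<1}) \<in> sets (LB n)"
  by (intro sets_PiM_I_finite) auto

lemma emeasure_unit_cube: "emeasure (LB n) (PiE {..<n} (\<lambda>_. {0..<1})) = 1"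
  by (subst lborel_fam.emeasure_PiM) auto

text \<open>The maps \<open>u \<mapsto> k u + m\<close> on the unit cube cover every point exactly
  \<open>\<bar>k\<bar> ^ n\<close> times, and this multiplicity cancels the Jacobian
  \<open>1 / \<bar>k\<bar> ^ n\<close>. The case \<open>k = 1\<close> is the tiling used for Voronoi
  cells; general \<open>k\<close> is the averaging over shifts in the layer of height
  \<open>k\<close>.\<close>

lemma nn_integral_unit_cube_sum_translates:
  fixes k :: int
  assumes k: "k \<noteq> 0" and f[measurable]: "f \<in> borel_measurable (LB n)"
  shows "(\<integral>\<^sup>+u. (\<integral>\<^sup>+m. f (\<lambda>i\<in>{..<n}. real_of_int k * u i + real_of_int (m i)) \<partial>count_space (ZN n)) * indicator (PiE {..<n} (\<lambda>_. {0..<1})) u \<partial>LB n)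
    = (\<integral>\<^sup>+x. f x \<partial>LB n)"
proof -
  let ?Q = "PiE {..<n} (\<lambda>_. {0..<1::real})"
  let ?S = "\<lambda>y::real. {m::int. 0 \<le> (y - real_of_int m) / real_of_int k \<and> (y - real_of_int m) / real_of_int k < 1}"
  \<comment> \<open>The cube indicator is rewritten as a function of the image point, so that the
    affine substitution can be made for each \<open>m\<close> separately.\<close>
  define v where "v m y = f y * indicator ?Q (\<lambda>i\<in>{..<n}. (y i - real_of_int (m i)) / real_of_int k)" for m :: "nat \<Rightarrow> int" and y
  have [measurable]: "v m \<in> borel_measurable (LB n)" for m
    unfolding v_def by measurable
  have "(\<integral>\<^sup>+u. (\<integral>\<^sup>+m. f (\<lambda>i\<in>{..<n}. real_of_int k * u i + real_of_int (m i)) \<partial>count_space (ZN n)) * indicator ?Q u \<partial>LB n)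
     = (\<integral>\<^sup>+u. (\<integral>\<^sup>+m. v m (\<lambda>i\<in>{..<n}. real_of_int k * u i + real_of_int (m i)) \<partial>count_space (ZN n)) \<partial>LB n)"
  proof (rule nn_integral_cong)
    fix u :: "nat \<Rightarrow> real" assume u: "u \<in> space (LB n)"
    have "(\<lambda>i\<in>{..<n}. ((\<lambda>i\<in>{..<n}. real_of_int k * u i + real_of_int (m i)) i - real_of_int (m i)) / real_of_int k) = u" for m
      using u k by (auto simp: space_PiM PiE_iff extensional_def fun_eq_iff)
    then show "(\<integral>\<^sup>+m. f (\<lambda>i\<in>{..<n}. real_of_int k * u i + real_of_int (m i)) \<partial>count_space (ZN n)) * indicator ?Q u
      = (\<integral>\<^sup>+m. v m (\<lambda>i\<in>{..<n}. real_of_int k * u i + real_of_int (m i)) \<partial>count_space (ZN n))"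
      unfolding v_def by (simp add: nn_integral_multc)
  qed
  also have "\<dots> = (\<integral>\<^sup>+m. (\<integral>\<^sup>+u. v m (\<lambda>i\<in>{..<n}. real_of_int k * u i + real_of_int (m i)) \<partial>LB n) \<partial>count_space (ZN n))"
    by (intro nn_integral_count_space_nn_integral countable_ZN) measurable
  also have "\<dots> = (\<integral>\<^sup>+m. ennreal (1 / \<bar>real_of_int k\<bar> ^ n) * (\<integral>\<^sup>+y. v m y \<partial>LB n) \<partial>count_space (ZN n))"
    using k by (intro nn_integral_cong nn_integral_LB_diag) auto
  also have "\<dots> = ennreal (1 / \<bar>real_of_int k\<bar> ^ n) * (\<integral>\<^sup>+m. (\<integral>\<^sup>+y. v m y \<partial>LB n) \<partial>count_space (ZN n))"
    by (intro nn_integral_cmult) simp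
  also have "(\<integral>\<^sup>+m. (\<integral>\<^sup>+y. v m y \<partial>LB n) \<partial>count_space (ZN n)) = (\<integral>\<^sup>+y. (\<integral>\<^sup>+m. v m y \<partial>count_space (ZN n)) \<partial>LB n)"
    by (intro nn_integral_count_space_nn_integral[symmetric] countable_ZN) measurable
  also have "\<dots> = (\<integral>\<^sup>+y. f y * ennreal (\<bar>real_of_int k\<bar> ^ n) \<partial>LB n)"
  proof (rule nn_integral_cong)
    fix y :: "nat \<Rightarrow> real"
    have "(\<integral>\<^sup>+m. v m y \<partial>count_space (ZN n)) = f y * (\<integral>\<^sup>+m. indicator (PiE {..<n} (\<lambda>i. ?S (y i))) m \<partial>count_space (ZN n))"
      unfolding v_def
      by (subst nn_integral_cmult, simp, intro arg_cong2[where f="(*)"] refl nn_integral_cong)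
         (auto simp: indicator_def PiE_iff split: if_splits)
    also have "(\<integral>\<^sup>+m. indicator (PiE {..<n} (\<lambda>i. ?S (y i))) m \<partial>count_space (ZN n)) = emeasure (count_space (ZN n)) (PiE {..<n} (\<lambda>i. ?S (y i)))"
      by (intro nn_integral_indicator) (auto simp: PiE_iff)
    also have "\<dots> = of_nat (card (PiE {..<n} (\<lambda>i. ?S (y i))))"
      using card_int_quotient_unit(1)[OF k] by (intro emeasure_count_space_finite) (auto simp: PiE_iff intro!: finite_PiE)
    also have "card (PiE {..<n} (\<lambda>i. ?S (y i))) = nat \<bar>k\<bar> ^ n"
      by (subst card_PiE) (auto simp: card_int_quotient_unit(2)[OF k])
    also have "of_nat (nat \<bar>k\<bar> ^ n) = ennreal (\<bar>real_of_int k\<bar> ^ n)"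
      by (simp add: ennreal_of_nat_eq_real_of_nat)
    finally show "(\<integral>\<^sup>+m. v m y \<partial>count_space (ZN n)) = f y * ennreal (\<bar>real_of_int k\<bar> ^ n)" .
  qed
  also have "\<dots> = (\<integral>\<^sup>+y. f y \<partial>LB n) * ennreal (\<bar>real_of_int k\<bar> ^ n)"
    by (intro nn_integral_multc) measurable
  also have "ennreal (1 / \<bar>real_of_int k\<bar> ^ n) * \<dots> = (\<integral>\<^sup>+y. f y \<partial>LB n)"
  proof -
    have "ennreal (1 / \<bar>real_of_int k\<bar> ^ n) * ennreal (\<bar>real_of_int k\<bar> ^ n) = 1"
      using k by (subst ennreal_mult[symmetric]) auto
    then show ?thesis by (simp add: mult.left_commute)
  qed
  finally show ?thesis .
qed

section \<open>Full-rank lattices: local finiteness and the volume of the cell\<close>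

lemma gen_det_nonzero_inj:
  assumes det: "gen_det n B \<noteq> 0" and z: "\<And>i. i < n \<Longrightarrow> (\<Sum>j<n. B i j * x j) = 0" and j: "j < n"
  shows "x j = 0"
proof (rule ccontr)
  assume "x j \<noteq> 0"
  let ?A = "Matrix.mat n n (\<lambda>(i, j). B i j)" and ?v = "Matrix.vec n x"
  have "?v \<noteq> 0\<^sub>v n" using \<open>x j \<noteq> 0\<close> j by (auto simp: vec_eq_iff)
  moreover have "?A *\<^sub>v ?v = 0\<^sub>v n"
    using z by (intro eq_vecI) (auto simp: scalar_prod_def atLeast0LessThan)
  ultimately have "Determinant.det ?A = 0"
    by (subst det_0_iff_vec_prod_zero[of _ n]) (auto intro!: exI[of _ ?v])
  with det show False by (simp add: gen_det_mat)
qed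

text \<open>The inverse matrix bounds every integer coefficient of a point in the box. This local
  finiteness makes the averages of the error over cubes genuine finite averages.\<close>

lemma finite_int_preimage_box:
  assumes det: "gen_det n B \<noteq> 0"
  shows "finite {k \<in> ZN n. \<forall>i<n. \<bar>\<Sum>j<n. B i j * real_of_int (k j)\<bar> \<le> a}"
proof -
  let ?A = "Matrix.mat n n (\<lambda>(i, j). B i j)"
  have A: "?A \<in> carrier_mat n n" by simp
  have "Determinant.det ?A \<noteq> 0" using det by (simp add: gen_det_mat)
  from det_non_zero_imp_unit[OF A this, of "()"] obtain C where C: "C \<in> carrier_mat n n" "C * ?A = 1\<^sub>m n"
    unfolding Units_def ring_mat_def by auto
  define b where "b = (\<Sum>i<n. \<Sum>j<n. \<bar>C $$ (i, j)\<bar>) * \<bar>a\<bar>"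
  have bound: "\<bar>real_of_int (k i)\<bar> \<le> b" if k: "\<forall>i<n. \<bar>\<Sum>j<n. B i j * real_of_int (k j)\<bar> \<le> a" and i: "i < n" for k :: "nat \<Rightarrow> int" and i
  proof -
    let ?v = "Matrix.vec n (\<lambda>j. real_of_int (k j))"
    have "?v = C *\<^sub>v (?A *\<^sub>v ?v)" using C by (subst assoc_mult_mat_vec[symmetric, of _ n n _ n]) auto
    then have "real_of_int (k i) = (C *\<^sub>v (?A *\<^sub>v ?v)) $ i" using i by (metis index_vec)
    also have "\<dots> = (\<Sum>j<n. C $$ (i, j) * (\<Sum>l<n. B j l * real_of_int (k l)))"
      using i C by (auto simp: scalar_prod_def atLeast0LessThan intro!: sum.cong)
    also have "\<bar>\<dots>\<bar> \<le> (\<Sum>j<n. \<bar>C $$ (i, j)\<bar> * \<bar>a\<bar>)"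
      using k by (intro order_trans[OF sum_abs] sum_mono) (auto simp: abs_mult intro!: mult_left_mono)
    also have "\<dots> = (\<Sum>j<n. \<bar>C $$ (i, j)\<bar>) * \<bar>a\<bar>" by (simp add: sum_distrib_right)
    also have "\<dots> \<le> b" unfolding b_def using i
      by (intro mult_right_mono member_le_sum[of i "{..<n}" "\<lambda>i. \<Sum>j<n. \<bar>C $$ (i, j)\<bar>"]) (auto intro: sum_nonneg)
    finally show ?thesis .
  qed
  have "k i \<in> {-\<lceil>b\<rceil>..\<lceil>b\<rceil>}" if "\<forall>i<n. \<bar>\<Sum>j<n. B i j * real_of_int (k j)\<bar> \<le> a" "i < n" for k :: "nat \<Rightarrow> int" and i
    using bound[OF that] unfolding atLeastAtMost_iff by linarith
  then have "{k \<in> ZN n. \<forall>i<n. \<bar>\<Sum>j<n. B i j * real_of_int (k j)\<bar> \<le> a} \<subseteq> PiE {..<n} (\<lambda>_. {-\<lceil>b\<rceil>..\<lceil>b\<rceil>})"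
    by (intro subsetI PiE_I) (auto simp: PiE_iff extensional_def simp del: atLeastAtMost_iff)
  then show ?thesis by (rule finite_subset) (intro finite_PiE, auto)
qed

lemma sets_voronoi_zero:
  "{z \<in> space (LB n). \<forall>k\<in>ZN n. (\<Sum>i<n. (z i)\<^sup>2) \<le> (\<Sum>i<n. (z i - (\<Sum>j<n. B i j * real_of_int (k j)))\<^sup>2)} \<in> sets (LB n)"
  by (intro sets.sets_Collect_countable_All' countable_ZN) measurable

text \<open>Shrinking the cell by a factor below 1 makes its lattice translates disjoint, so the
  null sets of boundary points never enter.\<close>

lemma emeasure_voronoi_zero_le:
  assumes det: "gen_det n B \<noteq> 0"
  defines "W \<equiv> {z \<in> space (LB n). \<forall>k\<in>ZN n. (\<Sum>i<n. (z i)\<^sup>2) \<le> (\<Sum>i<n. (z i - (\<Sum>j<n. B i j * real_of_int (k j)))\<^sup>2)}"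
  shows "emeasure (LB n) W \<le> ennreal \<bar>gen_det n B\<bar>"
proof -
  have [measurable]: "W \<in> sets (LB n)" unfolding W_def by (rule sets_voronoi_zero)
  define lin where "lin = (\<lambda>x :: nat \<Rightarrow> real. \<lambda>i\<in>{..<n}. \<Sum>j<n. B i j * x j)"
  have main: "ennreal (s ^ n / \<bar>gen_det n B\<bar>) * emeasure (LB n) W \<le> 1" if s: "0 < s" "s < 1" for s :: real
  proof -
    \<comment> \<open>Indicator of the shrunken cell \<open>s W\<close> in coordinates of the
      lattice basis, where lattice translates become integer translates.\<close>
    define \<Phi> :: "(nat \<Rightarrow> real) \<Rightarrow> ennreal" where "\<Phi> x = indicator W (\<lambda>i\<in>{..<n}. (\<Sum>j<n. (1 / s) * B i j * x j) + 0)" for x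
    have [measurable]: "\<Phi> \<in> borel_measurable (LB n)" unfolding \<Phi>_def by measurable
    have det': "gen_det n (\<lambda>i j. (1 / s) * B i j) = gen_det n B / s ^ n"
      by (subst gen_det_row_scale) (simp add: power_divide)
    have "(\<integral>\<^sup>+x. \<Phi> x \<partial>LB n) = ennreal (1 / \<bar>gen_det n (\<lambda>i j. (1 / s) * B i j)\<bar>) * (\<integral>\<^sup>+x. indicator W x \<partial>LB n)"
      unfolding \<Phi>_def using det det' s by (intro nn_integral_LB_affine) auto
    also have "\<dots> = ennreal (s ^ n / \<bar>gen_det n B\<bar>) * emeasure (LB n) W"
      unfolding det' using s by simp
    finally have 1: "ennreal (s ^ n / \<bar>gen_det n B\<bar>) * emeasure (LB n) W = (\<integral>\<^sup>+x. \<Phi> x \<partial>LB n)" ..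
    also have "\<dots> = (\<integral>\<^sup>+u. (\<integral>\<^sup>+m. \<Phi> (\<lambda>i\<in>{..<n}. real_of_int 1 * u i + real_of_int (m i)) \<partial>count_space (ZN n)) * indicator (PiE {..<n} (\<lambda>_. {0..<1})) u \<partial>LB n)"
      by (rule nn_integral_unit_cube_sum_translates[symmetric]) auto
    also have "\<dots> \<le> (\<integral>\<^sup>+u. 1 * indicator (PiE {..<n} (\<lambda>_. {0..<1})) u \<partial>LB n)"
    proof (intro nn_integral_mono mult_right_mono)
      fix u :: "nat \<Rightarrow> real"
      define w where "w = (\<lambda>m :: nat \<Rightarrow> int. \<lambda>i. (1 / s) * (\<Sum>j<n. B i j * (u j + real_of_int (m j))))"
      let ?A = "{m \<in> ZN n. restrict (w m) {..<n} \<in> W}"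
      \<comment> \<open>Two points of \<open>W\<close> that come from lattice translates of the same
        point differ by \<open>l / s\<close> with \<open>l\<close> a lattice vector. Adding the cell
        inequalities for \<open>l\<close> at the one and \<open>- l\<close> at the other bounds the
        squared length of \<open>l\<close>, divided by \<open>s\<close>, by that squared length;
        since \<open>s < 1\<close>, \<open>l\<close> is zero.\<close>
      have uniq: "m = m'" if m: "m \<in> ?A" "m' \<in> ?A" for m m'
      proof -
        define l where "l = (\<lambda>i. \<Sum>j<n. B i j * real_of_int (m j - m' j))"
        have cell: "2 * (\<Sum>i<n. z i * (\<Sum>j<n. B i j * real_of_int (k j))) \<le> (\<Sum>i<n. (\<Sum>j<n. B i j * real_of_int (k j))\<^sup>2)"
          if "restrict z {..<n} \<in> W" "k \<in> ZN n" for z and k :: "nat \<Rightarrow> int"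
        proof -
          have "(\<Sum>i<n. (z i)\<^sup>2) \<le> (\<Sum>i<n. (z i - (\<Sum>j<n. B i j * real_of_int (k j)))\<^sup>2)"
            using that unfolding W_def by auto
          also have "\<dots> = (\<Sum>i<n. (z i)\<^sup>2) - 2 * (\<Sum>i<n. z i * (\<Sum>j<n. B i j * real_of_int (k j))) + (\<Sum>i<n. (\<Sum>j<n. B i j * real_of_int (k j))\<^sup>2)"
            by (simp add: power2_diff sum.distrib sum_subtractf sum_distrib_left algebra_simps)
          finally show ?thesis by simp
        qed
        have mm: "restrict (\<lambda>j. m j - m' j) {..<n} \<in> ZN n" "restrict (\<lambda>j. m' j - m j) {..<n} \<in> ZN n" by auto
        have l: "(\<Sum>j<n. B i j * real_of_int (restrict (\<lambda>j. m j - m' j) {..<n} j)) = l i"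
          "(\<Sum>j<n. B i j * real_of_int (restrict (\<lambda>j. m' j - m j) {..<n} j)) = - l i" for i
          by (simp_all add: l_def sum_negf[symmetric] algebra_simps)
        have 1: "2 * (\<Sum>i<n. w m i * l i) \<le> (\<Sum>i<n. (l i)\<^sup>2)"
          using cell[of "w m", OF _ mm(1)] m unfolding l by auto
        have 2: "2 * (\<Sum>i<n. w m' i * - l i) \<le> (\<Sum>i<n. (- l i)\<^sup>2)"
          using cell[of "w m'", OF _ mm(2)] m unfolding l by auto
        have d: "w m i - w m' i = (1 / s) * l i" for i
          unfolding w_def l_def right_diff_distrib[symmetric] sum_subtractf[symmetric]
          by (simp add: algebra_simps)
        have "2 * (\<Sum>i<n. (w m i - w m' i) * l i) \<le> 2 * (\<Sum>i<n. (l i)\<^sup>2)"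
          using 1 2 by (simp add: left_diff_distrib sum_subtractf sum_negf)
        then have "(1 / s) * (\<Sum>i<n. (l i)\<^sup>2) \<le> (\<Sum>i<n. (l i)\<^sup>2)"
        proof -
          have "(\<Sum>i<n. (w m i - w m' i) * l i) = (1 / s) * (\<Sum>i<n. (l i)\<^sup>2)"
            unfolding d sum_distrib_left by (simp add: power2_eq_square)
          with \<open>2 * (\<Sum>i<n. (w m i - w m' i) * l i) \<le> 2 * (\<Sum>i<n. (l i)\<^sup>2)\<close> show ?thesis by linarith
        qed
        then have "(1 / s - 1) * (\<Sum>i<n. (l i)\<^sup>2) \<le> 0" by (simp add: left_diff_distrib)
        moreover have "1 / s - 1 > 0" using s by simp
        ultimately have "(\<Sum>i<n. (l i)\<^sup>2) \<le> 0" by (simp add: mult_le_0_iff)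
        then have "(\<Sum>i<n. (l i)\<^sup>2) = 0" using sum_nonneg[of "{..<n}" "\<lambda>i. (l i)\<^sup>2"] by simp
        then have "l i = 0" if "i < n" for i using that by (simp add: sum_nonneg_eq_0_iff)
        then have l0: "(\<Sum>j<n. B i j * real_of_int (m j - m' j)) = 0" if "i < n" for i
          using that unfolding l_def by blast
        have "real_of_int (m j - m' j) = 0" if "j < n" for j
          using gen_det_nonzero_inj[OF det, of "\<lambda>j. real_of_int (m j - m' j)", OF l0 that] .
        then have "m j = m' j" if "j < n" for j using that by simp
        then show "m = m'" using m by (intro PiE_ext[of m "{..<n}" "\<lambda>_. UNIV" m']) simp_all
      qed
      have fin: "finite ?A \<and> card ?A \<le> 1"
      proof (cases "?A = {}")
        case False
        then obtain m where "m \<in> ?A" by blast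
        then have "?A = {m}" using uniq by blast
        then show ?thesis by simp
      next
        case True
        show ?thesis unfolding True by simp
      qed
      have "(\<integral>\<^sup>+m. \<Phi> (\<lambda>i\<in>{..<n}. real_of_int 1 * u i + real_of_int (m i)) \<partial>count_space (ZN n)) = (\<integral>\<^sup>+m. indicator ?A m \<partial>count_space (ZN n))"
      proof (rule nn_integral_cong)
        fix m assume "m \<in> space (count_space (ZN n))"
        moreover have "(\<lambda>i\<in>{..<n}. (\<Sum>j<n. (1 / s) * B i j * (\<lambda>i\<in>{..<n}. real_of_int 1 * u i + real_of_int (m i)) j) + 0) = restrict (w m) {..<n}"

          unfolding w_def sum_distrib_left add_0_right mult.assoc of_int_1 mult_1_left
          by (intro restrict_ext sum.cong refl) (simp only: lessThan_iff restrict_apply if_True)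
        ultimately show "\<Phi> (\<lambda>i\<in>{..<n}. real_of_int 1 * u i + real_of_int (m i)) = indicator ?A m"
          unfolding \<Phi>_def by (simp only: indicator_def) simp
      qed
      also have "\<dots> = of_nat (card ?A)"
        using fin by (subst nn_integral_indicator) (auto simp: emeasure_count_space_finite)
      also have "\<dots> \<le> of_nat 1" by (rule of_nat_mono) (rule conjunct2[OF fin])
      also have "\<dots> = (1 :: ennreal)" by (rule of_nat_1)
      finally show "(\<integral>\<^sup>+m. \<Phi> (\<lambda>i\<in>{..<n}. real_of_int 1 * u i + real_of_int (m i)) \<partial>count_space (ZN n)) \<le> 1" .
    qed simp
    also have "\<dots> = 1" by (simp add: emeasure_unit_cube)
    finally show ?thesis .
  qed
  have D: "\<bar>gen_det n B\<bar> > 0" using det by simp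
  \<comment> \<open>One fixed shrinking factor already gives finiteness, so the limit
    \<open>s \<rightarrow> 1\<close> can be taken among real numbers.\<close>
  have fin: "emeasure (LB n) W < \<top>"
  proof (rule ccontr)
    assume "\<not> emeasure (LB n) W < \<top>"
    then have "emeasure (LB n) W = \<top>" using less_top by blast
    with main[of "1/2"] D show False by (simp add: ennreal_mult_top top_unique)
  qed
  then obtain w where w: "emeasure (LB n) W = ennreal w" "w \<ge> 0" by (cases "emeasure (LB n) W") auto
  have "s ^ n * w \<le> \<bar>gen_det n B\<bar>" if "0 < s" "s < 1" for s :: real
    using main[OF that] that D w by (simp add: ennreal_mult[symmetric] field_simps)
  moreover have "((\<lambda>s::real. s ^ n * w) \<longlongrightarrow> 1 ^ n * w) (at_left 1)"
    by (intro tendsto_intros)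
  moreover have "\<forall>\<^sub>F s in at_left (1::real). 0 < s \<and> s < 1"
    using eventually_at_left_real[of 0 1] by (auto elim: eventually_mono)
  ultimately have "1 ^ n * w \<le> \<bar>gen_det n B\<bar>"
    by (intro tendsto_upperbound[of "\<lambda>s. s ^ n * w" _ "at_left 1"]) (auto elim: eventually_mono)
  then show ?thesis using w by (simp add: ennreal_leI)
qed

section \<open>Existence of lattices by averaging\<close>

lemma divide_one_ennreal: "x / 1 = (x :: ennreal)"
  using ennreal_divide_times[of x 1 1] ennreal_divide_self[of 1] by (simp add: mult.commute)

text \<open>The selection principle behind both choices in the lattice construction, the step
  \<open>\<beta>\<close> and the shift \<open>u\<close>: a function above its average everywhere on
  \<open>A\<close> would have too large an integral.\<close>

lemma ex_le_nn_integral_average: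
  fixes f :: "'a \<Rightarrow> ennreal"
  assumes [measurable]: "A \<in> sets M" "f \<in> borel_measurable M"
    and A: "emeasure M A \<noteq> 0" "emeasure M A \<noteq> \<top>"
  shows "\<exists>x\<in>A. f x \<le> (\<integral>\<^sup>+x. f x * indicator A x \<partial>M) / emeasure M A"
proof (rule ccontr)
  let ?I = "\<integral>\<^sup>+x. f x * indicator A x \<partial>M"
  let ?c = "?I / emeasure M A"
  assume "\<not> ?thesis"
  then have less: "?c < f x" if "x \<in> A" for x using that by (auto simp: not_le)
  obtain x0 where "x0 \<in> A" using A by (metis all_not_in_conv emeasure_empty)
  with less[of x0] have "?c \<noteq> \<top>" by auto
  then have fin: "?I \<noteq> \<top>" using A by (metis ennreal_top_divide)
  have c: "(\<integral>\<^sup>+x. ?c * indicator A x \<partial>M) = ?I"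
    using A by (subst nn_integral_cmult_indicator)
      (simp_all add: ennreal_divide_times ennreal_divide_self less_top)
  have "(\<integral>\<^sup>+x. ?c * indicator A x \<partial>M) < ?I"
  proof (rule nn_integral_less)
    show "(\<integral>\<^sup>+x. ?c * indicator A x \<partial>M) \<noteq> \<infinity>" unfolding c using fin by simp
    show "AE x in M. ?c * indicator A x \<le> f x * indicator A x"
      using less by (auto simp: indicator_def intro: less_imp_le)
    show "\<not> (AE x in M. f x * indicator A x \<le> ?c * indicator A x)"
    proof
      assume "AE x in M. f x * indicator A x \<le> ?c * indicator A x"
      then have "AE x in M. x \<notin> A"
        by (rule AE_mp) (use less in \<open>auto simp: indicator_def not_less[symmetric]\<close>)
      moreover have "{x \<in> space M. \<not> x \<notin> A} = A"
        using sets.sets_into_space[OF assms(1)] by auto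
      ultimately have "emeasure M A = 0"
        using AE_iff_measurable[OF assms(1), of "\<lambda>x. x \<notin> A"] by simp
      with A(1) show False by simp
    qed
  qed measurable
  with c show False by simp
qed

text \<open>Averaging over the step size \<open>\<beta> \<in> [b, 2b]\<close> replaces the convergence of Riemann sums
  at the price of a constant factor.\<close>

lemma sum_inverse_dyadic_le:
  fixes u b :: real
  assumes b: "b > 0"
  shows "(\<integral>\<^sup>+k. ennreal (1 / \<bar>real_of_int k\<bar>) * indicator {b..2*b} (u / real_of_int k) \<partial>count_space (UNIV - {0})) \<le> 2"
proof (cases "u = 0")
  case True
  then have "(\<integral>\<^sup>+k. ennreal (1 / \<bar>real_of_int k\<bar>) * indicator {b..2*b} (u / real_of_int k) \<partial>count_space (UNIV - {0})) = 0"
    using b by simp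
  then show ?thesis by simp
next
  case u: False
  define x where "x = \<bar>u\<bar> / b"
  have x: "x > 0" using u b by (simp add: x_def)
  define S :: "int set" where "S = (\<lambda>k. if u > 0 then k else - k) ` {1..\<lfloor>x\<rfloor>}"
  have S: "finite S" "card S = nat \<lfloor>x\<rfloor>"
    unfolding S_def by (auto intro!: card_image[THEN trans] simp: inj_on_def)
  have summand_le: "ennreal (1 / \<bar>real_of_int k\<bar>) * indicator {b..2*b} (u / real_of_int k) \<le> ennreal (2 / x) * indicator S k"
    if "k \<noteq> 0" for k :: int
  proof (cases "u / real_of_int k \<in> {b..2*b}")
    case True
    then have pos: "u / real_of_int k > 0" and le: "b \<le> u / real_of_int k" "u / real_of_int k \<le> 2 * b" using b by auto
    then have eq: "u / real_of_int k = \<bar>u\<bar> / \<bar>real_of_int k\<bar>" by (metis abs_divide abs_of_pos)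
    have k0: "\<bar>real_of_int k\<bar> > 0" using that by simp
    have "\<bar>real_of_int k\<bar> \<le> x" using le(1) b k0 unfolding eq x_def by (simp add: field_simps)
    then have kx: "\<bar>k\<bar> \<le> \<lfloor>x\<rfloor>" by (simp add: le_floor_iff)
    have "k \<in> S"
    proof (cases "u > 0")
      case True
      then have "k > 0" using pos by (simp add: zero_less_divide_iff)
      then show ?thesis using kx True by (auto simp: S_def)
    next
      case False
      then have "k < 0" using pos by (simp add: zero_less_divide_iff)
      then have "k = - (- k)" "- k \<in> {1..\<lfloor>x\<rfloor>}" using kx by auto
      then show ?thesis using False by (auto simp: S_def intro!: image_eqI[of _ _ "- k"])
    qed
    moreover have "1 / \<bar>real_of_int k\<bar> \<le> 2 / x"
      using le(2) b k0 u unfolding eq x_def by (simp add: field_simps)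
    ultimately show ?thesis using True by (simp add: ennreal_leI)
  qed simp
  have "(\<integral>\<^sup>+k. ennreal (1 / \<bar>real_of_int k\<bar>) * indicator {b..2*b} (u / real_of_int k) \<partial>count_space (UNIV - {0}))
    \<le> (\<integral>\<^sup>+k. ennreal (2 / x) * indicator S k \<partial>count_space (UNIV - {0}))"
    by (intro nn_integral_mono summand_le) simp
  also have "\<dots> = ennreal (2 / x) * emeasure (count_space (UNIV - {0})) S"
    by (intro nn_integral_cmult_indicator) (auto simp: S_def)
  also have "emeasure (count_space (UNIV - {0})) S = of_nat (card S)"
    using S by (intro emeasure_count_space_finite) (auto simp: S_def)
  also have "ennreal (2 / x) * of_nat (card S) = ennreal (2 / x * real (nat \<lfloor>x\<rfloor>))"
    unfolding S(2) ennreal_of_nat_eq_real_of_nat using x by (subst ennreal_mult[symmetric]) auto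
  also have "\<dots> \<le> ennreal 2"
  proof (rule ennreal_leI)
    have "2 / x * real (nat \<lfloor>x\<rfloor>) \<le> 2 / x * x" using x by (intro mult_left_mono) auto
    then show "2 / x * real (nat \<lfloor>x\<rfloor>) \<le> 2" using x by simp
  qed
  finally show ?thesis by simp
qed

text \<open>Integrating over the step and substituting \<open>u = k \<beta>\<close> in each term
  weights \<open>f u\<close> by the sum of \<open>1 / \<bar>k\<bar>\<close> over the
  \<open>k\<close> with \<open>u / k\<close> in the window, which is at most 2. The window has
  length \<open>b\<close>, so some step does no worse than the average. The term
  \<open>k = 0\<close> is left out because no integral controls the value of \<open>f\<close> at
  0.\<close>

lemma ex_step_Riemann_sum_le:
  fixes f :: "real \<Rightarrow> ennreal"
  assumes f[measurable]: "f \<in> borel_measurable borel" and b: "b > 0"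
  shows "\<exists>\<beta>\<in>{b..2*b}. ennreal b * (\<integral>\<^sup>+k. f (real_of_int k * \<beta>) \<partial>count_space (UNIV - {0})) \<le> 2 * (\<integral>\<^sup>+x. f x \<partial>lborel)"
proof -
  let ?J = "count_space (UNIV - {0::int})"
  define F where "F = (\<lambda>\<beta>. \<integral>\<^sup>+k. f (real_of_int k * \<beta>) \<partial>?J)"
  have cnt: "countable (UNIV - {0::int})" by auto
  have [measurable]: "F \<in> borel_measurable borel"
    unfolding F_def
    by (intro borel_measurable_nn_integral_countable cnt) measurable
  have "(\<integral>\<^sup>+\<beta>. F \<beta> * indicator {b..2*b} \<beta> \<partial>lborel) = (\<integral>\<^sup>+\<beta>. (\<integral>\<^sup>+k. f (real_of_int k * \<beta>) * indicator {b..2*b} \<beta> \<partial>?J) \<partial>lborel)"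
    unfolding F_def by (simp add: nn_integral_multc)
  also have "\<dots> = (\<integral>\<^sup>+k. (\<integral>\<^sup>+\<beta>. f (real_of_int k * \<beta>) * indicator {b..2*b} \<beta> \<partial>lborel) \<partial>?J)"
    by (intro nn_integral_count_space_nn_integral cnt) measurable
  also have "\<dots> = (\<integral>\<^sup>+k. (\<integral>\<^sup>+u. f u * (ennreal (1 / \<bar>real_of_int k\<bar>) * indicator {b..2*b} (u / real_of_int k)) \<partial>lborel) \<partial>?J)"
  proof (rule nn_integral_cong)
    fix k assume "k \<in> space ?J"
    then have k: "real_of_int k \<noteq> 0" by simp
    have "(\<integral>\<^sup>+\<beta>. f (real_of_int k * \<beta>) * indicator {b..2*b} \<beta> \<partial>lborel)
      = ennreal \<bar>1 / real_of_int k\<bar> * (\<integral>\<^sup>+u. f (real_of_int k * (0 + 1 / real_of_int k * u)) * indicator {b..2*b} (0 + 1 / real_of_int k * u) \<partial>lborel)"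
      using k by (intro nn_integral_real_affine) auto
    also have "\<dots> = (\<integral>\<^sup>+u. ennreal \<bar>1 / real_of_int k\<bar> * (f (real_of_int k * (0 + 1 / real_of_int k * u)) * indicator {b..2*b} (0 + 1 / real_of_int k * u)) \<partial>lborel)"
      by (intro nn_integral_cmult[symmetric]) measurable
    also have "\<dots> = (\<integral>\<^sup>+u. f u * (ennreal (1 / \<bar>real_of_int k\<bar>) * indicator {b..2*b} (u / real_of_int k)) \<partial>lborel)"
      using k by (intro nn_integral_cong) (simp add: mult_ac)
    finally show "(\<integral>\<^sup>+\<beta>. f (real_of_int k * \<beta>) * indicator {b..2*b} \<beta> \<partial>lborel) = \<dots>" .
  qed
  also have "\<dots> = (\<integral>\<^sup>+u. (\<integral>\<^sup>+k. f u * (ennreal (1 / \<bar>real_of_int k\<bar>) * indicator {b..2*b} (u / real_of_int k)) \<partial>?J) \<partial>lborel)"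
    by (intro nn_integral_count_space_nn_integral[symmetric] cnt) measurable
  also have "\<dots> = (\<integral>\<^sup>+u. f u * (\<integral>\<^sup>+k. ennreal (1 / \<bar>real_of_int k\<bar>) * indicator {b..2*b} (u / real_of_int k) \<partial>?J) \<partial>lborel)"
    by (intro nn_integral_cong nn_integral_cmult) simp
  also have "\<dots> \<le> (\<integral>\<^sup>+u. f u * 2 \<partial>lborel)"
    using sum_inverse_dyadic_le[OF b] by (intro nn_integral_mono mult_left_mono) auto
  also have "\<dots> = 2 * (\<integral>\<^sup>+x. f x \<partial>lborel)"
    by (subst nn_integral_multc) (auto simp: mult.commute)
  finally have le: "(\<integral>\<^sup>+\<beta>. F \<beta> * indicator {b..2*b} \<beta> \<partial>lborel) \<le> 2 * (\<integral>\<^sup>+x. f x \<partial>lborel)" .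
  have em: "emeasure lborel {b..2*b} = ennreal b" using b by simp
  have "\<exists>\<beta>\<in>{b..2*b}. F \<beta> \<le> (\<integral>\<^sup>+\<beta>. F \<beta> * indicator {b..2*b} \<beta> \<partial>lborel) / emeasure lborel {b..2*b}"
    using b by (intro ex_le_nn_integral_average) (auto simp: em)
  then obtain \<beta> where \<beta>: "\<beta> \<in> {b..2*b}" "F \<beta> \<le> (\<integral>\<^sup>+\<beta>. F \<beta> * indicator {b..2*b} \<beta> \<partial>lborel) / ennreal b"
    unfolding em by blast
  have "ennreal b * F \<beta> \<le> ennreal b * ((\<integral>\<^sup>+\<beta>. F \<beta> * indicator {b..2*b} \<beta> \<partial>lborel) / ennreal b)"
    using \<beta>(2) by (rule mult_left_mono) simp
  also have "\<dots> = (\<integral>\<^sup>+\<beta>. F \<beta> * indicator {b..2*b} \<beta> \<partial>lborel)"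
    using b by (subst mult.commute, subst ennreal_divide_times) (simp add: ennreal_divide_self)
  finally show ?thesis using \<beta>(1) le unfolding F_def by (blast intro: order_trans)
qed

lemma NO_MATCH_I: "NO_MATCH a b"
  by (simp add: NO_MATCH_def)

text \<open>The lattice is generated by \<open>\<alpha> e\<^sub>i\<close> for \<open>i < N\<close> and by \<open>(\<alpha> u, \<beta>)\<close>. Averaging over \<open>u\<close> in the unit
  cube is exact in every layer \<open>k \<noteq> 0\<close> of last coordinate \<open>k \<beta>\<close>, and \<open>\<alpha> \<ge> R\<close> empties the layer \<open>k = 0\<close>.\<close>

theorem Minkowski_Hlawka_up_to_constant:
  fixes g :: "(nat \<Rightarrow> real) \<Rightarrow> ennreal"
  assumes n: "n \<ge> 2" and g[measurable]: "g \<in> borel_measurable (LB n)"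
    and supp: "\<And>x i. x \<in> space (LB n) \<Longrightarrow> i < n \<Longrightarrow> R \<le> \<bar>x i\<bar> \<Longrightarrow> g x = 0"
    and D: "D > 0"
  shows "\<exists>G. gen_det n G = D \<and>
    (\<integral>\<^sup>+k. g (\<lambda>i\<in>{..<n}. \<Sum>j<n. G i j * real_of_int (k j)) \<partial>count_space (ZN n - {\<lambda>i\<in>{..<n}. 0})) \<le> ennreal (4 / D) * (\<integral>\<^sup>+x. g x \<partial>LB n)"
proof -
  define N where "N = n - 1"
  have nN: "n = Suc N" and N: "N > 0" using n by (auto simp: N_def)
  have ins: "insert N {..<N} = {..<n}" using nN by auto
  let ?J = "count_space (UNIV - {0::int})"
  have upd: "(\<lambda>(x, s). x(N := s)) \<in> measurable (LB N \<Otimes>\<^sub>M lborel) (LB n)"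
    using measurable_add_dim[of N "{..<N}" "\<lambda>_. lborel"] unfolding ins .
  have upd1: "(\<lambda>x. x(N := s)) \<in> measurable (LB N) (LB n)" for s
    using measurable_compose[OF measurable_Pair2'[of s lborel "LB N"] upd] by simp
  define Gs where "Gs = (\<lambda>s. \<integral>\<^sup>+x. g (x(N := s)) \<partial>LB N)"
  have Gs_meas[measurable]: "Gs \<in> borel_measurable borel"
  proof -
    have "(\<lambda>p. g ((snd p)(N := fst p))) \<in> borel_measurable (lborel \<Otimes>\<^sub>M LB N)"
      using measurable_compose[OF measurable_compose[OF measurable_pair_swap' upd] g] by (simp add: split_beta')
    then have "Gs \<in> borel_measurable lborel" unfolding Gs_def
      by (intro sigma_finite_measure.borel_measurable_nn_integral[OF lborel_fam.sigma_finite]) (simp_all add: split_beta')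
    then show ?thesis by simp
  qed
  have intGs: "(\<integral>\<^sup>+s. Gs s \<partial>lborel) = (\<integral>\<^sup>+x. g x \<partial>LB n)"
    unfolding Gs_def using lborel_fam.product_nn_integral_insert_rev[of "{..<N}" N g] by (simp add: ins)
  \<comment> \<open>Chosen so that even the largest step \<open>2 * b\<close> leaves a spacing with
    \<open>\<alpha> ^ N \<ge> (\<bar>R\<bar> + 1) ^ N\<close>, hence
    \<open>\<alpha> \<ge> R\<close>.\<close>
  define b where "b = D / (2 * (\<bar>R\<bar> + 1) ^ N)"
  have b: "b > 0" using D by (simp add: b_def)
  obtain \<beta> where \<beta>: "b \<le> \<beta>" "\<beta> \<le> 2 * b"
    and \<beta>le: "ennreal b * (\<integral>\<^sup>+k. Gs (real_of_int k * \<beta>) \<partial>?J) \<le> 2 * (\<integral>\<^sup>+x. g x \<partial>LB n)"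
    using ex_step_Riemann_sum_le[OF Gs_meas b] unfolding intGs by auto
  have \<beta>0: "\<beta> > 0" using b \<beta> by simp
  define \<alpha> where "\<alpha> = root N (D / \<beta>)"
  have \<alpha>N: "\<alpha> ^ N = D / \<beta>" unfolding \<alpha>_def using N D \<beta>0 by simp
  have \<alpha>0: "\<alpha> > 0" unfolding \<alpha>_def using N D \<beta>0 by simp
  have \<alpha>R: "R \<le> \<alpha>"
  proof -
    have "(\<bar>R\<bar> + 1) ^ N = D / (2 * b)" using D by (simp add: b_def)
    also have "\<dots> \<le> \<alpha> ^ N" unfolding \<alpha>N using \<beta> \<beta>0 D by (intro divide_left_mono) auto
    finally have "\<bar>R\<bar> + 1 \<le> \<alpha>" using \<alpha>0 N by (simp add: power_mono_iff)
    then show ?thesis by simp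
  qed
  define \<phi> where "\<phi> k y = g ((\<lambda>i\<in>{..<N}. \<alpha> * y i + 0)(N := real_of_int k * \<beta>))" for k :: int and y
  have mscale: "(\<lambda>y. \<lambda>i\<in>{..<N}. \<alpha> * y i + 0) \<in> measurable (LB N) (LB N)"
    by measurable
  have \<phi>_meas[measurable]: "\<phi> k \<in> borel_measurable (LB N)" for k
    unfolding \<phi>_def using measurable_compose[OF measurable_compose[OF mscale upd1] g] .
  have int\<phi>: "(\<integral>\<^sup>+y. \<phi> k y \<partial>LB N) = ennreal (1 / \<alpha> ^ N) * Gs (real_of_int k * \<beta>)" for k
  proof -
    have "(\<integral>\<^sup>+y. \<phi> k y \<partial>LB N) = ennreal (1 / \<bar>\<alpha>\<bar> ^ N) * Gs (real_of_int k * \<beta>)"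
      unfolding \<phi>_def Gs_def using \<alpha>0 measurable_compose[OF upd1 g]
      by (intro nn_integral_LB_diag[of \<alpha> "\<lambda>y. g (y(N := real_of_int k * \<beta>))"]) auto
    then show ?thesis using \<alpha>0 by simp
  qed
  \<comment> \<open>The sum of \<open>g\<close> over all lattice points off the layer of height 0,
    as a function of the shift. Its mean over the unit cube is a one-dimensional Riemann sum of the
    slice integrals \<open>Gs\<close>.\<close>
  define \<Psi> where "\<Psi> u = (\<integral>\<^sup>+k. (\<integral>\<^sup>+m. \<phi> k (\<lambda>i\<in>{..<N}. real_of_int k * u i + real_of_int (m i)) \<partial>count_space (ZN N)) \<partial>?J)" for u
  let ?Q = "PiE {..<N} (\<lambda>_. {0..<1::real})"
  have in_meas[measurable]: "(\<lambda>u. \<integral>\<^sup>+m. \<phi> k (\<lambda>i\<in>{..<N}. real_of_int k * u i + real_of_int (m i)) \<partial>count_space (ZN N)) \<in> borel_measurable (LB N)" for k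
    by (intro borel_measurable_nn_integral_countable countable_ZN) measurable
  have \<Psi>_meas[measurable]: "\<Psi> \<in> borel_measurable (LB N)"
    unfolding \<Psi>_def by (intro borel_measurable_nn_integral_countable[of "UNIV - {0}"] in_meas) simp
  have "\<exists>u\<in>?Q. \<Psi> u \<le> (\<integral>\<^sup>+u. \<Psi> u * indicator ?Q u \<partial>LB N) / emeasure (LB N) ?Q"
    by (intro ex_le_nn_integral_average) (auto simp: emeasure_unit_cube)
  then obtain u where u: "\<Psi> u \<le> (\<integral>\<^sup>+u. \<Psi> u * indicator ?Q u \<partial>LB N)"
    unfolding emeasure_unit_cube using divide_one_ennreal by force
  have "(\<integral>\<^sup>+u. \<Psi> u * indicator ?Q u \<partial>LB N) = (\<integral>\<^sup>+u. (\<integral>\<^sup>+k. (\<integral>\<^sup>+m. \<phi> k (\<lambda>i\<in>{..<N}. real_of_int k * u i + real_of_int (m i)) \<partial>count_space (ZN N)) * indicator ?Q u \<partial>?J) \<partial>LB N)"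
    unfolding \<Psi>_def by (simp add: nn_integral_multc)
  also have "\<dots> = (\<integral>\<^sup>+k. (\<integral>\<^sup>+u. (\<integral>\<^sup>+m. \<phi> k (\<lambda>i\<in>{..<N}. real_of_int k * u i + real_of_int (m i)) \<partial>count_space (ZN N)) * indicator ?Q u \<partial>LB N) \<partial>?J)"
    by (intro nn_integral_count_space_nn_integral) (auto intro: countable_ZN)
  also have "\<dots> = (\<integral>\<^sup>+k. ennreal (1 / \<alpha> ^ N) * Gs (real_of_int k * \<beta>) \<partial>?J)"
    unfolding int\<phi>[symmetric] by (intro nn_integral_cong nn_integral_unit_cube_sum_translates) auto
  also have "\<dots> = ennreal (\<beta> / D) * (\<integral>\<^sup>+k. Gs (real_of_int k * \<beta>) \<partial>?J)"
    by (subst nn_integral_cmult) (simp_all add: \<alpha>N)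
  \<comment> \<open>One factor 2 is lost here, from \<open>\<beta> \<le> 2 * b\<close>; the second
    comes from the Riemann sum. Together they give the constant 4.\<close>
  also have "\<dots> \<le> ennreal (2 / D) * (ennreal b * (\<integral>\<^sup>+k. Gs (real_of_int k * \<beta>) \<partial>?J))"
    using \<beta> b D unfolding mult.assoc[symmetric] ennreal_mult[symmetric, OF divide_nonneg_pos less_imp_le[OF b]]
    by (intro mult_right_mono) (auto simp: ennreal_mult[symmetric] divide_simps intro!: ennreal_leI)
  also have "\<dots> \<le> ennreal (2 / D) * (2 * (\<integral>\<^sup>+x. g x \<partial>LB n))"
    using \<beta>le by (rule mult_left_mono) simp
  also have "\<dots> = ennreal (4 / D) * (\<integral>\<^sup>+x. g x \<partial>LB n)"
  proof -
    have "ennreal (2 / D) * 2 = ennreal (4 / D)"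
      using D by (subst ennreal_numeral[symmetric], subst ennreal_mult[symmetric]) auto
    then show ?thesis by (simp add: mult.assoc[symmetric])
  qed
  finally have \<Psi>le: "\<Psi> u \<le> ennreal (4 / D) * (\<integral>\<^sup>+x. g x \<partial>LB n)" using u by (rule order_trans[rotated])
  define G where "G i j = (if i < N then (if j < N then (if i = j then \<alpha> else 0) else \<alpha> * u i) else (if j < N then 0 else \<beta>))" for i j
  have det: "gen_det n G = D"
  proof -
    have "gen_det n G = (\<Prod>i<n. G i i)"
      by (rule gen_det_upper_triangular) (auto simp: G_def nN)
    also have "\<dots> = \<alpha> ^ N * \<beta>" unfolding nN by (simp add: G_def)
    finally show ?thesis using \<alpha>N \<beta>0 by simp
  qed
  let ?pt = "\<lambda>k :: nat \<Rightarrow> int. \<lambda>i\<in>{..<n}. \<Sum>j<n. G i j * real_of_int (k j)"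
  have pt: "?pt (m(N := k)) = (\<lambda>i\<in>{..<N}. \<alpha> * (\<lambda>i\<in>{..<N}. real_of_int k * u i + real_of_int (m i)) i + 0)(N := real_of_int k * \<beta>)" for m k
  proof
    fix i
    show "?pt (m(N := k)) i = ((\<lambda>i\<in>{..<N}. \<alpha> * (\<lambda>i\<in>{..<N}. real_of_int k * u i + real_of_int (m i)) i + 0)(N := real_of_int k * \<beta>)) i"
    proof (cases "i < N")
      case True
      have "(\<Sum>j<N. G i j * real_of_int ((m(N := k)) j)) = (\<Sum>j<N. if j = i then \<alpha> * real_of_int (m j) else 0)"
        using True by (intro sum.cong) (auto simp: G_def)
      then show ?thesis using True nN by (simp add: G_def algebra_simps)
    next
      case False
      then show ?thesis using nN by (auto simp: G_def)
    qed
  qed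
  have "(\<integral>\<^sup>+k. g (?pt k) \<partial>count_space (ZN n - {\<lambda>i\<in>{..<n}. 0})) \<le> (\<integral>\<^sup>+k. g (?pt k) * indicator {k. k N \<noteq> 0} k \<partial>count_space (ZN n))"
  proof -
    \<comment> \<open>A nonzero point of the layer of height 0 has a coordinate of absolute value at
      least \<open>\<alpha> \<ge> R\<close>, where \<open>g\<close> vanishes.\<close>
    have "g (?pt k) = 0" if k: "k \<in> ZN n" "k \<noteq> (\<lambda>i\<in>{..<n}. 0)" "k N = 0" for k
    proof -
      have "\<exists>i<n. k i \<noteq> 0"
      proof (rule ccontr)
        assume "\<not> (\<exists>i<n. k i \<noteq> 0)"
        then have "k = (\<lambda>i\<in>{..<n}. 0)" using PiE_arb[OF k(1)] by (intro ext) (auto simp: restrict_def)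
        with k(2) show False ..
      qed
      then obtain i where i: "i < n" "k i \<noteq> 0" by blast
      have "i \<noteq> N" using i(2) k(3) by metis
      with i(1) nN have iN: "i < N" by simp
      have "k = k(N := 0)" using k(3) by (simp add: fun_upd_idem)
      then have "?pt k = ?pt (k(N := 0))" by (rule arg_cong)
      then have "?pt k i = \<alpha> * real_of_int (k i)" unfolding pt using iN by simp
      then have "\<bar>?pt k i\<bar> = \<alpha> * \<bar>real_of_int (k i)\<bar>" using \<alpha>0 by (simp only: abs_mult abs_of_pos)
      moreover have "\<alpha> * 1 \<le> \<alpha> * \<bar>real_of_int (k i)\<bar>" using \<alpha>0 i by (intro mult_left_mono) auto
      ultimately have "R \<le> \<bar>?pt k i\<bar>" using \<alpha>R by linarith
      then show ?thesis by (intro supp[of _ i] i) (auto simp: space_PiM)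
    qed
    note vanish = this
    show ?thesis
      unfolding nn_integral_count_space_indicator[of "ZN n", OF NO_MATCH_I] nn_integral_count_space_indicator[of "ZN n - {\<lambda>i\<in>{..<n}. 0}", OF NO_MATCH_I]
    proof (rule nn_integral_mono)
      fix k :: "nat \<Rightarrow> int"
      show "g (?pt k) * indicator (ZN n - {\<lambda>i\<in>{..<n}. 0}) k \<le> g (?pt k) * indicator {k. k N \<noteq> 0} k * indicator (ZN n) k"
      proof (cases "k \<in> ZN n \<and> k \<noteq> (\<lambda>i\<in>{..<n}. 0)")
        case True
        show ?thesis
        proof (cases "k N = 0")
          case kN: True
          show ?thesis unfolding vanish[OF conjunct1[OF True] conjunct2[OF True] kN] by simp
        next
          case False
          then have "k \<in> {k. k N \<noteq> 0}" "k \<in> ZN n - {\<lambda>i\<in>{..<n}. 0}" using True by blast+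
          with True show ?thesis by (simp only: indicator_simps mult_1_right order_refl)
        qed
      next
        case False
        then have "k \<notin> ZN n - {\<lambda>i\<in>{..<n}. 0}" by blast
        then have "indicator (ZN n - {\<lambda>i\<in>{..<n}. 0}) k = (0 :: ennreal)" by (rule indicator_simps(2))
        then show ?thesis by (simp only: mult_zero_right zero_le)
      qed
    qed
  qed
  also have "\<dots> = (\<integral>\<^sup>+p. g (?pt ((snd p)(N := fst p))) * indicator {k. k N \<noteq> 0} ((snd p)(N := fst p)) \<partial>count_space (UNIV \<times> ZN N))"
  proof (rule nn_integral_bij_count_space[symmetric])
    show "bij_betw (\<lambda>p. (snd p)(N := fst p)) (UNIV \<times> ZN N) (ZN n)"
      unfolding ins[symmetric]
    proof (rule bij_betwI[where g="\<lambda>k. (k N, restrict k {..<N})"])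
      show "(\<lambda>p. (snd p)(N := fst p)) \<in> UNIV \<times> ZN N \<rightarrow> PiE (insert N {..<N}) (\<lambda>_. UNIV)"
        by (intro Pi_I PiE_fun_upd UNIV_I) (simp only: mem_Times_iff)
      show "(\<lambda>k. (k N, restrict k {..<N})) \<in> PiE (insert N {..<N}) (\<lambda>_. UNIV) \<rightarrow> UNIV \<times> ZN N"
        by (intro Pi_I) (simp add: mem_Times_iff restrict_PiE_iff)
      fix p :: "int \<times> (nat \<Rightarrow> int)" assume p: "p \<in> UNIV \<times> ZN N"
      have "restrict ((snd p)(N := fst p)) {..<N} = snd p"
        using PiE_arb[of "snd p" "{..<N}" "\<lambda>_. UNIV"] p by (intro ext) (auto simp: restrict_def mem_Times_iff)
      then show "(((snd p)(N := fst p)) N, restrict ((snd p)(N := fst p)) {..<N}) = p" by simp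
    next
      fix k :: "nat \<Rightarrow> int" assume k: "k \<in> PiE (insert N {..<N}) (\<lambda>_. UNIV)"
      then have "(restrict k {..<N})(N := k N) = k"
        using PiE_arb[OF k] by (intro ext) (auto simp: restrict_def)
      then show "(snd (k N, restrict k {..<N}))(N := fst (k N, restrict k {..<N})) = k" by simp
    qed
  qed
  also have "\<dots> = (\<integral>\<^sup>+p. \<phi> (fst p) (\<lambda>i\<in>{..<N}. real_of_int (fst p) * u i + real_of_int (snd p i)) * indicator {k. k \<noteq> 0} (fst p) \<partial>count_space (UNIV \<times> ZN N))"
  proof (rule nn_integral_cong)
    fix p :: "int \<times> (nat \<Rightarrow> int)"
    have "g (?pt ((snd p)(N := fst p))) = \<phi> (fst p) (\<lambda>i\<in>{..<N}. real_of_int (fst p) * u i + real_of_int (snd p i))"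
      unfolding pt \<phi>_def ..
    moreover have "indicator {k. k N \<noteq> 0} ((snd p)(N := fst p)) = (indicator {k. k \<noteq> 0} (fst p) :: ennreal)"
      by (simp only: indicator_def mem_Collect_eq fun_upd_same)
    ultimately show "g (?pt ((snd p)(N := fst p))) * indicator {k. k N \<noteq> 0} ((snd p)(N := fst p))
      = \<phi> (fst p) (\<lambda>i\<in>{..<N}. real_of_int (fst p) * u i + real_of_int (snd p i)) * indicator {k. k \<noteq> 0} (fst p)"
      by (simp only:)
  qed
  also have "\<dots> = (\<integral>\<^sup>+p. (\<phi> (fst p) (\<lambda>i\<in>{..<N}. real_of_int (fst p) * u i + real_of_int (snd p i)) * indicator (ZN N) (snd p)) * indicator (UNIV - {0}) (fst p) \<partial>count_space UNIV)"
    unfolding nn_integral_count_space_indicator[of "UNIV \<times> ZN N", OF NO_MATCH_I]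
  proof (rule nn_integral_cong)
    fix p :: "int \<times> (nat \<Rightarrow> int)"
    show "\<phi> (fst p) (\<lambda>i\<in>{..<N}. real_of_int (fst p) * u i + real_of_int (snd p i)) * indicator {k. k \<noteq> 0} (fst p) * indicator (UNIV \<times> ZN N) p
      = \<phi> (fst p) (\<lambda>i\<in>{..<N}. real_of_int (fst p) * u i + real_of_int (snd p i)) * indicator (ZN N) (snd p) * indicator (UNIV - {0}) (fst p)"
      by (cases "fst p = 0"; cases "snd p \<in> ZN N") (simp_all add: mem_Times_iff)
  qed
  also have "\<dots> = (\<integral>\<^sup>+k. \<integral>\<^sup>+m. (\<phi> k (\<lambda>i\<in>{..<N}. real_of_int k * u i + real_of_int (m i)) * indicator (ZN N) m) * indicator (UNIV - {0}) k \<partial>count_space UNIV \<partial>count_space UNIV)"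
    by (rule trans[OF nn_integral_fst_count_space[symmetric]]) (simp only: fst_conv snd_conv)
  also have "\<dots> = \<Psi> u"
    unfolding \<Psi>_def nn_integral_count_space_indicator[of "ZN N", OF NO_MATCH_I] nn_integral_count_space_indicator[of "UNIV - {0}", OF NO_MATCH_I]
    by (intro nn_integral_cong nn_integral_multc) simp
  finally show ?thesis using \<Psi>le det by (intro exI[of _ G] conjI order_trans[OF _ \<Psi>le])
qed

section \<open>A Berry-Esseen bound with logarithmic loss\<close>

lemma gauss_integral:
  assumes b: "(\<beta>::real) > 0"
  shows "has_bochner_integral lborel (\<lambda>x. exp (- \<beta> * x\<^sup>2)) (sqrt (pi / \<beta>))"
    and "has_bochner_integral lborel (\<lambda>x. x\<^sup>2 * exp (- \<beta> * x\<^sup>2)) (sqrt (pi / \<beta>) / (2 * \<beta>))"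
proof -
  define s where "s = 1 / sqrt (2 * \<beta>)"
  have s: "s > 0" and s2: "s\<^sup>2 = 1 / (2 * \<beta>)" using b by (auto simp: s_def power_divide)
  have nd: "exp (- \<beta> * x\<^sup>2) = normal_density 0 s x * sqrt (pi / \<beta>)" for x
    using b by (simp add: normal_density_def s2 field_simps real_sqrt_divide)
  have e1: "(\<lambda>x. exp (- \<beta> * x\<^sup>2)) = (\<lambda>x. normal_density 0 s x * sqrt (pi / \<beta>))"
    using nd by auto
  have e2: "(\<lambda>x. x\<^sup>2 * exp (- \<beta> * x\<^sup>2)) = (\<lambda>x. (normal_density 0 s x * (x - 0) ^ (2 * 1)) * sqrt (pi / \<beta>))"
    unfolding nd by (auto simp: fun_eq_iff)
  have "has_bochner_integral lborel (normal_density 0 s) 1"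
    using integrable_normal_density[of s 0] integral_normal_density[of s 0] s
    by (simp add: has_bochner_integral_iff)
  from has_bochner_integral_mult_left[OF this, of "sqrt (pi / \<beta>)"]
  show "has_bochner_integral lborel (\<lambda>x. exp (- \<beta> * x\<^sup>2)) (sqrt (pi / \<beta>))"
    unfolding e1 by simp
  have m: "fact (2 * 1) / ((2 / s\<^sup>2) ^ 1 * fact 1) * sqrt (pi / \<beta>) = sqrt (pi / \<beta>) / (2 * \<beta>)"
    using b by (simp add: s2)
  show "has_bochner_integral lborel (\<lambda>x. x\<^sup>2 * exp (- \<beta> * x\<^sup>2)) (sqrt (pi / \<beta>) / (2 * \<beta>))"
    unfolding e2 m[symmetric] by (intro has_bochner_integral_mult_left normal_moment_even s)
qed

text \<open>Telescoping. The factor \<open>r ^ (n - 1)\<close> must be kept: with \<open>r\<close> a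
  Gaussian in \<open>t\<close>, it supplies the decay that makes the frequency integral of order
  \<open>1 / sqrt n\<close>.\<close>

lemma norm_power_diff_le:
  fixes a b :: "'a::{real_normed_algebra_1, comm_ring_1}"
  assumes "norm a \<le> r" "norm b \<le> r"
  shows "norm (a ^ n - b ^ n) \<le> real n * r ^ (n - 1) * norm (a - b)"
proof -
  have r: "r \<ge> 0" using assms norm_ge_zero order_trans by blast
  show ?thesis
  proof (induction n)
    case (Suc n)
    have "a ^ Suc n - b ^ Suc n = a * (a ^ n - b ^ n) + (a - b) * b ^ n"
      by (simp add: algebra_simps)
    also have "norm \<dots> \<le> norm a * norm (a ^ n - b ^ n) + norm (a - b) * norm (b ^ n)"
      by (intro norm_triangle_mono norm_mult_ineq)
    also have "\<dots> \<le> r * (real n * r ^ (n - 1) * norm (a - b)) + norm (a - b) * r ^ n"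
      using assms r Suc.IH
      by (intro add_mono mult_mono order_refl norm_ge_zero)
         (auto intro: order_trans[OF norm_power_ineq power_mono])
    also have "\<dots> = real (Suc n) * r ^ (Suc n - 1) * norm (a - b)"
      by (cases n) (simp_all add: algebra_simps)
    finally show ?case .
  qed simp
qed

text \<open>The kernel in Levy's inversion formula is at most \<open>2 / \<bar>t\<bar>\<close>, so a
  difference of size \<open>\<bar>t\<bar> * g t\<close> contributes at most \<open>2 * g t\<close>,
  and the prefactor \<open>1 / (2 * pi)\<close> leaves \<open>1 / pi\<close>. The bound does not
  depend on the left endpoint of the interval, which may therefore tend to minus infinity.\<close>

lemma cdf_diff_le_integral_char:
  assumes "real_distribution M1" "real_distribution M2"
    and atom: "\<And>x. measure M1 {x} = 0" "\<And>x. measure M2 {x} = 0"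
    and g: "integrable lborel g"
    and le: "\<And>t. cmod (char M1 t - char M2 t) \<le> \<bar>t\<bar> * g t"
  shows "cdf M1 x - cdf M2 x \<le> (1 / pi) * (\<integral>t. g t \<partial>lborel)"
proof -
  interpret M1: real_distribution M1 by fact
  interpret M2: real_distribution M2 by fact
  have main: "\<bar>measure M1 {a<..x} - measure M2 {a<..x}\<bar> \<le> (1 / pi) * (\<integral>t. g t \<partial>lborel)" if ax: "a < x" for a
  proof -
    let ?F = "\<lambda>t::real. (iexp (-(t * a)) - iexp (-(t * x))) / (\<i> * t)"
    let ?I = "\<lambda>M T. CLBINT t=ereal (-real T)..ereal (real T). ?F t * char M t"
    have lim: "(\<lambda>T. cmod (1 / (2 * pi) * ?I M1 T - 1 / (2 * pi) * ?I M2 T)) \<longlonglongrightarrow>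
      cmod (complex_of_real (measure M1 {a<..x}) - complex_of_real (measure M2 {a<..x}))"
      using ax atom
      by (intro tendsto_norm tendsto_diff M1.Levy_Inversion[unfolded of_int_minus of_int_of_nat_eq]
           M2.Levy_Inversion[unfolded of_int_minus of_int_of_nat_eq] order.strict_implies_order) assumption+
    have g0: "2 * g t \<ge> 0" if "t \<noteq> 0" for t
      using order_trans[OF norm_ge_zero le[of t]] that by (simp add: zero_le_mult_iff)
    \<comment> \<open>This serves integrability on finite windows only. It depends on
      \<open>a\<close>, unlike the bound \<open>2 / \<bar>t\<bar>\<close> on which the estimate
      rests.\<close>
    have F: "cmod (?F t) \<le> x - a" for t
    proof (cases "t = 0")
      case False
      have "?F t = (iexp (- t * x) - iexp (- t * a)) / (\<i> * complex_of_real (- t))"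
        using False by (simp add: field_simps)
      with Levy_Inversion_aux2[of a x "- t"] ax False show ?thesis
        by (simp only: mult_minus_left)
    qed (use ax in simp)
    have Fm[measurable]: "?F \<in> borel_measurable borel" by measurable
    have int: "interval_lebesgue_integrable lborel (ereal (-real T)) (ereal (real T)) (\<lambda>t. ?F t * char M t)"
      if M: "real_distribution M" for M T
    proof -
      have [measurable]: "char M \<in> borel_measurable borel"
        using M by (rule real_distribution.char_measurable)
      have "set_integrable lborel {-real T<..<real T} (\<lambda>t. ?F t * char M t)"
        unfolding set_integrable_def
      proof (rule Bochner_Integration.integrable_bound)
        show "integrable lborel (\<lambda>t. indicator {-real T<..<real T} t *\<^sub>R (x - a))"
          by (intro integrable_scaleR_left integrable_real_indicator) auto
        show "AE t in lborel. norm (indicator {-real T<..<real T} t *\<^sub>R (?F t * char M t)) \<le> norm (indicator {-real T<..<real T} t *\<^sub>R (x - a))"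
        proof (rule AE_I2)
          fix t
          have "cmod (?F t * char M t) \<le> norm (x - a)"
            using mult_mono[OF F real_distribution.cmod_char_le_1[OF M], of t t] ax unfolding norm_mult by simp
          then show "norm (indicator {-real T<..<real T} t *\<^sub>R (?F t * char M t)) \<le> norm (indicator {-real T<..<real T} t *\<^sub>R (x - a))"
            unfolding norm_scaleR by (rule mult_left_mono) simp
        qed
      qed measurable
      then show ?thesis by (simp add: interval_lebesgue_integrable_def)
    qed
    have bound: "cmod (1 / (2 * pi) * ?I M1 T - 1 / (2 * pi) * ?I M2 T) \<le> (1 / pi) * (\<integral>t. g t \<partial>lborel)" for T :: nat
    proof -
      have "?I M1 T - ?I M2 T = (CLBINT t=ereal (-real T)..ereal (real T). ?F t * char M1 t - ?F t * char M2 t)"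
        by (rule interval_lebesgue_integral_diff(2)[symmetric]; rule int; fact)
      also have "\<dots> = (CLBINT t:{-real T<..<real T}. ?F t * char M1 t - ?F t * char M2 t)"
        by (simp add: interval_lebesgue_integral_def)
      finally have eq: "?I M1 T - ?I M2 T = (CLBINT t:{-real T<..<real T}. ?F t * char M1 t - ?F t * char M2 t)" .
      have iint: "set_integrable lborel {-real T<..<real T} (\<lambda>t. ?F t * char M1 t - ?F t * char M2 t)"
        using int[OF assms(1), of T] int[OF assms(2), of T]
        by (intro set_integral_diff) (simp_all add: interval_lebesgue_integrable_def)
      have "cmod (?I M1 T - ?I M2 T) \<le> (\<integral>t. 2 * g t \<partial>lborel)"
        unfolding eq set_lebesgue_integral_def
      proof (rule order_trans[OF integral_norm_bound integral_mono_AE])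
        show "integrable lborel (\<lambda>t. norm (indicator {-real T<..<real T} t *\<^sub>R (?F t * char M1 t - ?F t * char M2 t)))"
          using iint unfolding set_integrable_def by (rule integrable_norm)
        show "integrable lborel (\<lambda>t. 2 * g t)" using g by simp
        have le2: "cmod (?F t * char M1 t - ?F t * char M2 t) \<le> 2 * g t" if "t \<noteq> 0" for t
        proof -
          have "cmod (?F t) = cmod (iexp (-(t * a)) - iexp (-(t * x))) / \<bar>t\<bar>"
            by (simp add: norm_divide norm_mult)
          also have "\<dots> \<le> 2 / \<bar>t\<bar>"
            using norm_triangle_ineq4[of "iexp (-(t * a))" "iexp (-(t * x))"]
            by (intro divide_right_mono) (simp_all del: of_real_minus of_real_mult)
          finally have "cmod (?F t * char M1 t - ?F t * char M2 t) \<le> 2 / \<bar>t\<bar> * (\<bar>t\<bar> * g t)"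
            unfolding right_diff_distrib[symmetric] norm_mult using le[of t]
            by (intro mult_mono) auto
          then show ?thesis using that by simp
        qed
        have "AE t in lborel. t \<noteq> (0::real)" by (rule AE_lborel_singleton)
        then show "AE t in lborel. norm (indicator {-real T<..<real T} t *\<^sub>R (?F t * char M1 t - ?F t * char M2 t)) \<le> 2 * g t"
          by eventually_elim (use le2 g0 in \<open>auto simp: indicator_def\<close>)
      qed
      moreover have "cmod (1 / (2 * pi) * ?I M1 T - 1 / (2 * pi) * ?I M2 T) = 1 / (2 * pi) * cmod (?I M1 T - ?I M2 T)"
        unfolding right_diff_distrib[symmetric] norm_mult by (simp add: norm_divide norm_mult)
      ultimately show ?thesis by (simp add: field_simps)
    qed
    have "cmod (complex_of_real (measure M1 {a<..x}) - complex_of_real (measure M2 {a<..x})) \<le> (1 / pi) * (\<integral>t. g t \<partial>lborel)"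
      by (rule tendsto_upperbound[OF lim]) (use bound in auto)
    then show ?thesis by (simp add: of_real_diff[symmetric] del: of_real_diff)
  qed
  have "((\<lambda>a. (cdf M1 x - cdf M1 a) - (cdf M2 x - cdf M2 a)) \<longlongrightarrow> (cdf M1 x - 0) - (cdf M2 x - 0)) at_bot"
    by (intro tendsto_intros M1.cdf_lim_at_bot M2.cdf_lim_at_bot)
  moreover have "\<forall>\<^sub>F a in at_bot. (cdf M1 x - cdf M1 a) - (cdf M2 x - cdf M2 a) \<le> (1 / pi) * (\<integral>t. g t \<partial>lborel)"
    using eventually_gt_at_bot[of x]
  proof eventually_elim
    case (elim a)
    from main[OF elim] show ?case
      using M1.cdf_diff_eq[OF elim] M2.cdf_diff_eq[OF elim] by simp
  qed
  ultimately show ?thesis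
    by (intro tendsto_upperbound[of "\<lambda>a. (cdf M1 x - cdf M1 a) - (cdf M2 x - cdf M2 a)" _ at_bot]) auto
qed

section \<open>Gaussian measures and smoothing by convolution\<close>

definition gauss :: "real \<Rightarrow> real measure" where
  "gauss s = density lborel (normal_density 0 s)"

lemma real_distribution_gauss: "s > 0 \<Longrightarrow> real_distribution (gauss s)"
  unfolding gauss_def real_distribution_def real_distribution_axioms_def
  by (auto intro: prob_space_normal_density)

lemma gauss_eq_distr: "s > 0 \<Longrightarrow> gauss s = distr std_normal_distribution borel (\<lambda>x. s * x)"
proof -
  assume s: "s > 0"
  interpret S: prob_space std_normal_distribution by (rule prob_space_normal_density) simp
  have "distributed std_normal_distribution lborel (\<lambda>x. x) std_normal_density"
    by (auto simp: distributed_def distr_id2)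
  from S.normal_density_affine[OF this, of s 0] s
  have "distributed std_normal_distribution lborel (\<lambda>x. s * x) (normal_density 0 s)" by simp
  then have "distr std_normal_distribution lborel (\<lambda>x. s * x) = gauss s"
    by (simp add: distributed_def gauss_def)
  then show ?thesis by (metis distr_cong sets_lborel)
qed

lemma char_gauss: "s > 0 \<Longrightarrow> char (gauss s) t = of_real (exp (- (s * t)\<^sup>2 / 2))"
proof -
  assume s: "s > 0"
  have "char (gauss s) t = char std_normal_distribution (s * t)"
    unfolding gauss_eq_distr[OF s] char_def by (subst integral_distr) (auto simp: ac_simps)
  then show ?thesis by (simp add: char_std_normal_distribution)
qed

lemma measure_gauss_singleton: "s > 0 \<Longrightarrow> measure (gauss s) {x} = 0"
proof -
  have "emeasure (gauss s) {x} = (\<integral>\<^sup>+y. ennreal (normal_density 0 s y) * indicator {x} y \<partial>lborel)"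
    unfolding gauss_def by (subst emeasure_density) auto
  also have "\<dots> = (\<integral>\<^sup>+y. 0 \<partial>(lborel :: real measure))"
  proof (rule nn_integral_cong_AE)
    show "AE y in lborel. ennreal (normal_density 0 s y) * indicator {x} y = 0"
      using AE_lborel_singleton[of x] by eventually_elim auto
  qed
  finally show ?thesis by (simp add: measure_def)
qed

lemma cdf_gauss:
  assumes "s > 0"
  shows "cdf (gauss s) x = cdf std_normal_distribution (x / s)"
proof -
  have "(\<lambda>y. s * y) -` {..x} = {..x / s}" using assms by (auto simp: field_simps)
  then show ?thesis
    unfolding gauss_eq_distr[OF assms] cdf_def by (subst measure_distr) auto
qed

text \<open>For \<open>\<bar>y\<bar> > a\<close>, one half of the exponent is bounded by its value
  at \<open>a\<close> and taken outside; the other half integrates to a Gaussian of twice the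
  variance, whence \<open>sqrt 2\<close>.\<close>

lemma gauss_tail:
  assumes s: "s > 0" and a: "a \<ge> 0"
  shows "measure (gauss s) {y. a < \<bar>y\<bar>} \<le> sqrt 2 * exp (- a\<^sup>2 / (4 * s\<^sup>2))"
proof -
  let ?c = "1 / sqrt (2 * pi * s\<^sup>2) * exp (- a\<^sup>2 / (4 * s\<^sup>2))"
  have b: "1 / (4 * s\<^sup>2) > 0" using s by simp
  note gi = gauss_integral(1)[OF b]
  have i: "integrable lborel (\<lambda>y. ?c * exp (- (1 / (4 * s\<^sup>2)) * y\<^sup>2))"
    using gi by (intro integrable_mult_right) (simp add: has_bochner_integral_iff)
  have "measure (gauss s) {y. a < \<bar>y\<bar>} = (\<integral>y. indicator {y. a < \<bar>y\<bar>} y * normal_density 0 s y \<partial>lborel)"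
  proof -
    interpret real_distribution "gauss s" using s by (rule real_distribution_gauss)
    have "measure (gauss s) {y. a < \<bar>y\<bar>} = (\<integral>y. indicator {y. a < \<bar>y\<bar>} y \<partial>gauss s)"
      by simp
    also have "\<dots> = (\<integral>y. indicator {y. a < \<bar>y\<bar>} y * normal_density 0 s y \<partial>lborel)"
      unfolding gauss_def by (subst integral_density) (auto simp: mult.commute)
    finally show ?thesis .
  qed
  also have "\<dots> \<le> (\<integral>y. ?c * exp (- (1 / (4 * s\<^sup>2)) * y\<^sup>2) \<partial>lborel)"
  proof (rule integral_mono')
    fix y :: real
    show "0 \<le> ?c * exp (- (1 / (4 * s\<^sup>2)) * y\<^sup>2)" by simp
    show "indicator {y. a < \<bar>y\<bar>} y * normal_density 0 s y \<le> ?c * exp (- (1 / (4 * s\<^sup>2)) * y\<^sup>2)"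
    proof (cases "a < \<bar>y\<bar>")
      case True
      then have "a\<^sup>2 \<le> y\<^sup>2" using a by (metis abs_le_square_iff abs_of_nonneg less_imp_le)
      then have "- y\<^sup>2 / (2 * s\<^sup>2) \<le> - a\<^sup>2 / (4 * s\<^sup>2) + - (1 / (4 * s\<^sup>2)) * y\<^sup>2"
        using s by (simp add: field_simps)
      then have "exp (- y\<^sup>2 / (2 * s\<^sup>2)) \<le> exp (- a\<^sup>2 / (4 * s\<^sup>2)) * exp (- (1 / (4 * s\<^sup>2)) * y\<^sup>2)"
        by (simp add: exp_add[symmetric])
      then show ?thesis using True s
        by (simp add: normal_density_def divide_right_mono)
    qed simp
  qed (fact i)
  also have "\<dots> = ?c * sqrt (pi / (1 / (4 * s\<^sup>2)))"
    using gi by (simp add: has_bochner_integral_iff)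
  also have "\<dots> = sqrt 2 * exp (- a\<^sup>2 / (4 * s\<^sup>2))"
  proof -
    have "sqrt (pi / (1 / (4 * s\<^sup>2))) = sqrt 2 * sqrt (2 * pi * s\<^sup>2)"
      by (simp add: real_sqrt_mult[symmetric] mult.commute)
    then show ?thesis using s by simp
  qed
  finally show ?thesis .
qed

lemma char_distr_pair_add:
  assumes M: "prob_space M" and N: "prob_space N"
    and [measurable]: "F \<in> borel_measurable M" "G \<in> borel_measurable N"
  shows "char (distr (M \<Otimes>\<^sub>M N) borel (\<lambda>p. F (fst p) + G (snd p))) t = char (distr M borel F) t * char (distr N borel G) t"
proof -
  interpret M: prob_space M by fact
  interpret N: prob_space N by fact
  interpret P: pair_prob_space M N ..
  have "char (distr (M \<Otimes>\<^sub>M N) borel (\<lambda>p. F (fst p) + G (snd p))) t = (CLINT p|M \<Otimes>\<^sub>M N. iexp (t * (F (fst p) + G (snd p))))"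
    unfolding char_def by (subst integral_distr) auto
  also have "\<dots> = (CLINT x|M. CLINT y|N. iexp (t * (F x + G y)))"
    by (subst P.integral_fst'[symmetric])
       (auto intro!: P.integrable_const_bound[of _ 1] simp: split_beta')
  also have "\<dots> = (CLINT x|M. iexp (t * F x) * (CLINT y|N. iexp (t * G y)))"
    by (intro Bochner_Integration.integral_cong refl)
      (simp add: integral_mult_right_zero[symmetric] ring_distribs exp_add del: integral_mult_right_zero)
  also have "\<dots> = (CLINT x|M. iexp (t * F x)) * (CLINT y|N. iexp (t * G y))"
    by simp
  also have "\<dots> = char (distr M borel F) t * char (distr N borel G) t"
    unfolding char_def by (subst (1 2) integral_distr) auto
  finally show ?thesis .
qed

definition conv_gauss :: "real measure \<Rightarrow> real \<Rightarrow> real measure" where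
  "conv_gauss M s = distr (M \<Otimes>\<^sub>M gauss s) borel (\<lambda>(x, y). x + y)"

context
  fixes M :: "real measure" and s :: real
  assumes M: "real_distribution M" and s: "s > 0"
begin

interpretation M: real_distribution M by (rule M)
interpretation N: real_distribution "gauss s" using s by (rule real_distribution_gauss)
interpretation P: pair_prob_space M "gauss s" ..

lemma real_distribution_conv_gauss: "real_distribution (conv_gauss M s)"
  unfolding conv_gauss_def by (rule P.real_distribution_distr) simp

lemma char_conv_gauss: "char (conv_gauss M s) t = char M t * of_real (exp (- (s * t)\<^sup>2 / 2))"
proof -
  have "char (conv_gauss M s) t = char (distr M borel (\<lambda>x. x)) t * char (distr (gauss s) borel (\<lambda>x. x)) t"
    unfolding conv_gauss_def split_beta'
    by (rule char_distr_pair_add[OF M.prob_space_axioms N.prob_space_axioms]) measurable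
  also have "distr M borel (\<lambda>x. x) = M" by (rule distr_id2) simp
  also have "distr (gauss s) borel (\<lambda>x. x) = gauss s" by (rule distr_id2) simp
  finally show ?thesis unfolding char_gauss[OF s] .
qed

text \<open>Smoothing removes all atoms, so the inversion formula holds at every pair of
  endpoints.\<close>

lemma measure_conv_gauss_singleton: "measure (conv_gauss M s) {z} = 0"
proof -
  have "emeasure (conv_gauss M s) {z} = emeasure (M \<Otimes>\<^sub>M gauss s) ((\<lambda>(x, y). x + y) -` {z} \<inter> space (M \<Otimes>\<^sub>M gauss s))"
    unfolding conv_gauss_def by (subst emeasure_distr) auto
  also have "\<dots> = (\<integral>\<^sup>+x. emeasure (gauss s) (Pair x -` ((\<lambda>(x, y). x + y) -` {z} \<inter> space (M \<Otimes>\<^sub>M gauss s))) \<partial>M)"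
    by (rule N.emeasure_pair_measure_alt) measurable
  also have "\<dots> = (\<integral>\<^sup>+x. emeasure (gauss s) {z - x} \<partial>M)"
    by (intro nn_integral_cong arg_cong2[where f=emeasure] refl) (auto simp: space_pair_measure)
  also have "\<dots> = 0"
    using s measure_gauss_singleton[of s] by (simp add: N.emeasure_eq_measure)
  finally show ?thesis by (simp add: measure_def)
qed

text \<open>A coupling: on the product space the original variable and its smoothed version differ
  by more than \<open>a\<close> only on the tail event of the Gaussian.\<close>

lemma cdf_le_cdf_conv_gauss:
  assumes "a \<ge> 0"
  shows "cdf M x \<le> cdf (conv_gauss M s) (x + a) + sqrt 2 * exp (- a\<^sup>2 / (4 * s\<^sup>2))"
    and "cdf (conv_gauss M s) x \<le> cdf M (x + a) + sqrt 2 * exp (- a\<^sup>2 / (4 * s\<^sup>2))"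
proof -
  have cdf: "cdf M x = P.prob {p \<in> space (M \<Otimes>\<^sub>M gauss s). fst p \<le> x}" for x
  proof -
    have "{p \<in> space (M \<Otimes>\<^sub>M gauss s). fst p \<le> x} = {..x} \<times> space (gauss s)"
      by (auto simp: space_pair_measure)
    then show ?thesis
      by (simp add: cdf_def measure_def N.emeasure_pair_measure_Times N.emeasure_space_1[simplified])
  qed
  have cdfc: "cdf (conv_gauss M s) x = P.prob {p \<in> space (M \<Otimes>\<^sub>M gauss s). fst p + snd p \<le> x}" for x
    unfolding cdf_def conv_gauss_def
    by (subst measure_distr) (auto intro!: arg_cong[where f=P.prob] simp: space_pair_measure)
  have tail: "P.prob {p \<in> space (M \<Otimes>\<^sub>M gauss s). a < \<bar>snd p\<bar>} \<le> sqrt 2 * exp (- a\<^sup>2 / (4 * s\<^sup>2))"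
  proof -
    have "{p \<in> space (M \<Otimes>\<^sub>M gauss s). a < \<bar>snd p\<bar>} = space M \<times> {y. a < \<bar>y\<bar>}"
      by (auto simp: space_pair_measure)
    then have "P.prob {p \<in> space (M \<Otimes>\<^sub>M gauss s). a < \<bar>snd p\<bar>} = measure (gauss s) {y. a < \<bar>y\<bar>}"
      by (simp add: measure_def N.emeasure_pair_measure_Times M.emeasure_space_1[simplified])
    with gauss_tail[OF s assms] show ?thesis by simp
  qed
  have [measurable]: "{p \<in> space (M \<Otimes>\<^sub>M gauss s). fst p + snd p \<le> c} \<in> P.events"
      "{p \<in> space (M \<Otimes>\<^sub>M gauss s). fst p \<le> c} \<in> P.events"
      "{p \<in> space (M \<Otimes>\<^sub>M gauss s). a < \<bar>snd p\<bar>} \<in> P.events" for c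
    by measurable
  have "cdf M x \<le> P.prob ({p \<in> space (M \<Otimes>\<^sub>M gauss s). fst p + snd p \<le> x + a} \<union> {p \<in> space (M \<Otimes>\<^sub>M gauss s). a < \<bar>snd p\<bar>})"
    unfolding cdf by (rule P.finite_measure_mono) (force, measurable)
  also have "\<dots> \<le> cdf (conv_gauss M s) (x + a) + sqrt 2 * exp (- a\<^sup>2 / (4 * s\<^sup>2))"
    unfolding cdfc by (rule order_trans[OF measure_Un_le add_mono[OF order_refl tail]]) measurable
  finally show "cdf M x \<le> cdf (conv_gauss M s) (x + a) + sqrt 2 * exp (- a\<^sup>2 / (4 * s\<^sup>2))" .
  have "cdf (conv_gauss M s) x \<le> P.prob ({p \<in> space (M \<Otimes>\<^sub>M gauss s). fst p \<le> x + a} \<union> {p \<in> space (M \<Otimes>\<^sub>M gauss s). a < \<bar>snd p\<bar>})"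
    unfolding cdfc by (rule P.finite_measure_mono) (force, measurable)
  also have "\<dots> \<le> cdf M (x + a) + sqrt 2 * exp (- a\<^sup>2 / (4 * s\<^sup>2))"
    unfolding cdf by (rule order_trans[OF measure_Un_le add_mono[OF order_refl tail]]) measurable
  finally show "cdf (conv_gauss M s) x \<le> cdf M (x + a) + sqrt 2 * exp (- a\<^sup>2 / (4 * s\<^sup>2))" .
qed

end

text \<open>One shift by \<open>a\<close> and one tail are paid to smooth \<open>M1\<close>, and the
  same again to return from the smoothed \<open>M2\<close>; the smoothed laws are compared by
  inversion.\<close>

lemma cdf_le_smoothing:
  assumes "real_distribution M1" "real_distribution M2" and s: "s > 0" and a: "a \<ge> 0"
    and g: "integrable lborel g"
    and le: "\<And>t. cmod (char M1 t - char M2 t) * exp (- (s * t)\<^sup>2 / 2) \<le> \<bar>t\<bar> * g t"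
  shows "cdf M1 x \<le> cdf M2 (x + 2 * a) + 2 * sqrt 2 * exp (- a\<^sup>2 / (4 * s\<^sup>2)) + (1 / pi) * (\<integral>t. g t \<partial>lborel)"
proof -
  have "cdf (conv_gauss M1 s) (x + a) - cdf (conv_gauss M2 s) (x + a) \<le> (1 / pi) * (\<integral>t. g t \<partial>lborel)"
  proof (rule cdf_diff_le_integral_char)
    fix t
    have "char (conv_gauss M1 s) t - char (conv_gauss M2 s) t
        = (char M1 t - char M2 t) * of_real (exp (- (s * t)\<^sup>2 / 2))"
      using assms(1,2) s by (simp add: char_conv_gauss left_diff_distrib)
    then show "cmod (char (conv_gauss M1 s) t - char (conv_gauss M2 s) t) \<le> \<bar>t\<bar> * g t"
      using le[of t] by (simp add: norm_mult)
  qed (use assms in \<open>auto intro: real_distribution_conv_gauss measure_conv_gauss_singleton\<close>)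
  with cdf_le_cdf_conv_gauss(1)[OF assms(1) s a, of x] cdf_le_cdf_conv_gauss(2)[OF assms(2) s a, of "x + a"]
  show ?thesis by (simp add: add.assoc)
qed

lemma exp_minus_quadratic:
  assumes "(y::real) \<ge> 0"
  shows "\<bar>exp (- y) - (1 - y)\<bar> \<le> y\<^sup>2"
proof -
  have "1 - y \<le> exp (- y)" using exp_ge_add_one_self[of "- y"] by simp
  moreover have "exp (- y) \<le> 1 - y + y\<^sup>2"
  proof (cases "y \<le> 1")
    case True
    then have "(1 - y + y\<^sup>2) * exp y \<ge> (1 - y + y\<^sup>2) * (1 + y)"
      using assms by (intro mult_left_mono) (auto intro: add_nonneg_nonneg)
    moreover have "(1 - y + y\<^sup>2) * (1 + y) = 1 + y ^ 3" by (simp add: power2_eq_square power3_eq_cube algebra_simps)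
    ultimately have "1 \<le> (1 - y + y\<^sup>2) * exp y" using assms by (smt (verit) zero_le_power)
    then show ?thesis by (simp add: exp_minus field_simps)
  next
    case False
    then have "y \<le> y\<^sup>2" by (simp add: power2_eq_square)
    moreover have "exp (- y) \<le> 1" using assms by simp
    ultimately show ?thesis by linarith
  qed
  ultimately show ?thesis using assms by simp
qed

abbreviation \<Phi> :: "real \<Rightarrow> real" where
  "\<Phi> \<equiv> cdf std_normal_distribution"

text \<open>The variance \<open>s\<^sup>2\<close> of the smoothing Gaussian is of order \<open>ln n\<close>: its characteristic function is
  then \<open>O (1 / sqrt n)\<close> on the frequencies \<open>\<bar>t\<bar> > c\<close>, where nothing better than \<open>cmod (\<phi> t) \<le> 1\<close> is known.\<close>

lemma berry_esseen_log:
  fixes \<phi> :: "real \<Rightarrow> complex"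
  assumes V: "V > 0" and K: "K \<ge> 0"
    and appr: "\<And>t. cmod (\<phi> t - of_real (1 - t\<^sup>2 * V / 2)) \<le> K * \<bar>t\<bar> ^ 3"
    and le1: "\<And>t. cmod (\<phi> t) \<le> 1"
  obtains C where "C \<ge> 0"
    "\<And>n N x. n \<ge> 2 \<Longrightarrow> real_distribution N \<Longrightarrow> (\<And>t. char N t = \<phi> t ^ n) \<Longrightarrow>
        cdf N x \<le> \<Phi> ((x + C * ln (real n)) / sqrt (real n * V)) + C / sqrt (real n)"
    "\<And>n N x. n \<ge> 2 \<Longrightarrow> real_distribution N \<Longrightarrow> (\<And>t. char N t = \<phi> t ^ n) \<Longrightarrow>
        \<Phi> ((x - C * ln (real n)) / sqrt (real n * V)) - C / sqrt (real n) \<le> cdf N x"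
proof -
  \<comment> \<open>The first bound gives \<open>V * t\<^sup>2 \<le> 1\<close> for
    \<open>\<bar>t\<bar> \<le> c\<close>; the second lets the cubic error consume at most half of
    the quadratic decay, so that \<open>\<phi>\<close> stays below a Gaussian there.\<close>
  define c where "c = min (1 / sqrt V) (V / (4 * (K + 1)))"
  have c: "c > 0" using V K by (simp add: c_def)
  have c1: "c \<le> 1 / sqrt V" and c2: "c \<le> V / (4 * (K + 1))" by (auto simp: c_def)
  have Kc: "K * c \<le> V / 4"
  proof -
    have "K * c \<le> (K + 1) * (V / (4 * (K + 1)))" using c c2 K by (intro mult_mono) auto
    also have "\<dots> = V / 4" using K by (simp add: divide_simps)
    finally show ?thesis .
  qed
  have V2: "V * t\<^sup>2 \<le> 1" if "\<bar>t\<bar> \<le> c" for t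
  proof -
    have "\<bar>t\<bar> \<le> 1 / sqrt V" using that c1 by simp
    then have "t\<^sup>2 \<le> (1 / sqrt V)\<^sup>2" by (metis abs_ge_zero power2_abs power_mono)
    then show ?thesis using V by (simp add: power_divide field_simps)
  qed
  define K' where "K' = K + V\<^sup>2 * c"
  have K': "K' \<ge> 0" using K c by (simp add: K'_def)
  define \<psi> where "\<psi> = (\<lambda>t::real. exp (- (V * t\<^sup>2 / 2)))"
  have phib: "cmod (\<phi> t) \<le> exp (- (V * t\<^sup>2 / 4))" if t: "\<bar>t\<bar> \<le> c" for t
  proof -
    have "cmod (\<phi> t) \<le> cmod (of_real (1 - t\<^sup>2 * V / 2)) + K * \<bar>t\<bar> ^ 3"
      using appr[of t] norm_triangle_ineq2[of "\<phi> t" "of_real (1 - t\<^sup>2 * V / 2)"] by linarith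
    also have "cmod (of_real (1 - t\<^sup>2 * V / 2)) = 1 - t\<^sup>2 * V / 2"
      using V2[OF t] by (subst norm_of_real) (simp add: mult.commute)
    also have "K * \<bar>t\<bar> ^ 3 = (K * \<bar>t\<bar>) * t\<^sup>2" by (simp add: power3_eq_cube power2_eq_square)
    also have "\<dots> \<le> (V / 4) * t\<^sup>2"
      using Kc mult_left_mono[OF t K] by (intro mult_right_mono) auto
    also have "1 - t\<^sup>2 * V / 2 + V / 4 * t\<^sup>2 \<le> exp (- (V * t\<^sup>2 / 4))"
      using exp_ge_add_one_self[of "- (V * t\<^sup>2 / 4)"] by (simp add: algebra_simps)
    finally show ?thesis by simp
  qed
  have psib: "\<psi> t \<le> exp (- (V * t\<^sup>2 / 4))" for t using V by (simp add: \<psi>_def)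
  have diff: "cmod (\<phi> t - of_real (\<psi> t)) \<le> K' * \<bar>t\<bar> ^ 3" if t: "\<bar>t\<bar> \<le> c" for t
  proof -
    have "\<bar>(1 - t\<^sup>2 * V / 2) - \<psi> t\<bar> \<le> (V * t\<^sup>2 / 2)\<^sup>2"
      using exp_minus_quadratic[of "V * t\<^sup>2 / 2"] V by (simp add: \<psi>_def abs_minus_commute mult.commute)
    also have "\<dots> = V\<^sup>2 * \<bar>t\<bar> ^ 3 * \<bar>t\<bar> / 4"
      by (simp add: power2_eq_square power3_eq_cube)
    also have "\<dots> \<le> V\<^sup>2 * \<bar>t\<bar> ^ 3 * \<bar>t\<bar>" by simp
    also have "\<dots> \<le> V\<^sup>2 * \<bar>t\<bar> ^ 3 * c" using t by (intro mult_left_mono) auto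
    finally have "cmod (of_real (1 - t\<^sup>2 * V / 2) - of_real (\<psi> t)) \<le> V\<^sup>2 * \<bar>t\<bar> ^ 3 * c"
      unfolding of_real_diff[symmetric] norm_of_real .
    with appr[of t] have "cmod (\<phi> t - of_real (\<psi> t)) \<le> K * \<bar>t\<bar> ^ 3 + V\<^sup>2 * \<bar>t\<bar> ^ 3 * c"
      using norm_diff_triangle_le[of "\<phi> t" "of_real (1 - t\<^sup>2 * V / 2)" "K * \<bar>t\<bar> ^ 3" "of_real (\<psi> t)"] by blast
    then show ?thesis by (simp add: K'_def algebra_simps)
  qed
  \<comment> \<open>\<open>A1\<close> and \<open>A2\<close> are \<open>sqrt n\<close> times bounds
    for the integrals of the two parts of \<open>g\<close> below; \<open>ln 2\<close> in
    \<open>A2\<close> is the smallest value of \<open>ln n\<close> that occurs.\<close>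
  define A1 where "A1 = K' * (sqrt (8 * pi / V) * (4 / V))"
  define A2 where "A2 = (2 / c) * sqrt (4 * pi * c\<^sup>2 / (2 * ln 2))"
  define C where "C = 4 / c + 2 * sqrt 2 + (A1 + A2) / pi"
  have A: "A1 \<ge> 0" "A2 \<ge> 0" using K' c V by (auto simp: A1_def A2_def)
  have C0: "C \<ge> 0" using A c by (simp add: C_def)
  have key: "\<exists>s g. s > 0 \<and> integrable lborel g \<and> (\<integral>t. g t \<partial>lborel) \<le> (A1 + A2) / sqrt n \<and>
      exp (- ((2 / c) * ln n)\<^sup>2 / (4 * s\<^sup>2)) = 1 / sqrt n \<and>
      (\<forall>t. cmod (\<phi> t ^ n - of_real (\<psi> t) ^ n) * exp (- (s * t)\<^sup>2 / 2) \<le> \<bar>t\<bar> * g t)"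
    if n: "n \<ge> 2" for n :: nat
  proof -
    have ln: "ln (real n) > 0" "ln (real n) \<ge> ln 2" using n by auto
    have n0: "real n > 0" using n by simp
    \<comment> \<open>Half of the smoothing exponent at frequency \<open>c\<close> is then
      \<open>ln n / 2\<close>, so it yields exactly the factor \<open>1 / sqrt n\<close>.\<close>
    define s where "s = sqrt (2 * ln n) / c"
    have s: "s > 0" and s2: "s\<^sup>2 = 2 * ln n / c\<^sup>2" using c ln by (auto simp: s_def power_divide)
    have esq: "exp (- ln n / 2) = 1 / sqrt n"
    proof -
      have "exp (- ln n / 2) = exp (- (1/2) * ln n)" by simp
      also have "\<dots> = n powr (- (1/2))" using n by (simp add: powr_def)
      also have "\<dots> = 1 / sqrt n" using n by (simp add: powr_minus_divide powr_half_sqrt)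
      finally show ?thesis .
    qed
    \<comment> \<open>\<open>b1\<close> is the exponent \<open>(n - 1) * V / 4\<close> after
      \<open>n - 1 \<ge> n / 2\<close>; \<open>b2\<close> is the half of the smoothing exponent kept
      for integrability.\<close>
    define b1 where "b1 = real n * V / 8"
    define b2 where "b2 = s\<^sup>2 / 4"
    have b: "b1 > 0" "b2 > 0" using n V s by (auto simp: b1_def b2_def)
    define g where "g = (\<lambda>t. real n * K' * (t\<^sup>2 * exp (- b1 * t\<^sup>2)) + (2 / c) * (1 / sqrt n) * exp (- b2 * t\<^sup>2))"
    note G1 = gauss_integral(2)[OF b(1)] and G2 = gauss_integral(1)[OF b(2)]
    have ig: "integrable lborel g"
      unfolding g_def using G1 G2
      by (intro Bochner_Integration.integrable_add integrable_mult_right) (simp_all add: has_bochner_integral_iff)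
    have "(\<integral>t. g t \<partial>lborel) = real n * K' * (sqrt (pi / b1) / (2 * b1)) + (2 / c) * (1 / sqrt n) * sqrt (pi / b2)"
      unfolding g_def using G1 G2
      by (subst Bochner_Integration.integral_add) (simp_all add: has_bochner_integral_iff)
    also have "real n * K' * (sqrt (pi / b1) / (2 * b1)) = A1 / sqrt n"
    proof -
      have "sqrt (pi / b1) = sqrt (8 * pi / V) / sqrt n"
        unfolding b1_def by (simp add: real_sqrt_divide real_sqrt_mult mult.commute)
      then show ?thesis using n0 V by (simp add: A1_def b1_def)
    qed
    also have "(2 / c) * (1 / sqrt n) * sqrt (pi / b2) \<le> (2 / c) * (1 / sqrt n) * sqrt (4 * pi * c\<^sup>2 / (2 * ln 2))"
    proof -
      have "pi / b2 = 4 * pi * c\<^sup>2 / (2 * ln n)" unfolding b2_def s2 by simp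
      also have "\<dots> \<le> 4 * pi * c\<^sup>2 / (2 * ln 2)" using ln c by (intro divide_left_mono) auto
      finally show ?thesis using c by (intro mult_left_mono) auto
    qed
    also have "A1 / sqrt n + (2 / c) * (1 / sqrt n) * sqrt (4 * pi * c\<^sup>2 / (2 * ln 2)) = (A1 + A2) / sqrt n"
      by (simp add: A2_def add_divide_distrib)
    finally have i: "(\<integral>t. g t \<partial>lborel) \<le> (A1 + A2) / sqrt n" by simp
    \<comment> \<open>The smoothing has standard deviation of order \<open>sqrt (ln n)\<close>, and
      \<open>sqrt (ln n)\<close> deviations are needed for a tail of \<open>1 / sqrt n\<close>;
      hence a shift of order \<open>ln n\<close>.\<close>
    have e: "exp (- ((2 / c) * ln n)\<^sup>2 / (4 * s\<^sup>2)) = 1 / sqrt n"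
    proof -
      have "- ((2 / c) * ln n)\<^sup>2 / (4 * s\<^sup>2) = - ln n / 2"
        unfolding s2 using c ln by (simp add: power2_eq_square field_simps)
      then show ?thesis unfolding esq[symmetric] by (rule arg_cong)
    qed
    have p: "cmod (\<phi> t ^ n - of_real (\<psi> t) ^ n) * exp (- (s * t)\<^sup>2 / 2) \<le> \<bar>t\<bar> * g t" for t
    proof (cases "\<bar>t\<bar> \<le> c")
      case True
      have "cmod (\<phi> t ^ n - of_real (\<psi> t) ^ n) \<le> real n * exp (- (V * t\<^sup>2 / 4)) ^ (n - 1) * cmod (\<phi> t - of_real (\<psi> t))"
        using phib[OF True] psib[of t] by (intro norm_power_diff_le) (auto simp: \<psi>_def)
      also have "exp (- (V * t\<^sup>2 / 4)) ^ (n - 1) \<le> exp (- b1 * t\<^sup>2)"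
      proof -
        have "real n / 2 \<le> real (n - 1)" using n by (simp add: of_nat_diff)
        then have "real n / 2 * (V * t\<^sup>2 / 4) \<le> real (n - 1) * (V * t\<^sup>2 / 4)" using V by (intro mult_right_mono) auto
        then show ?thesis unfolding exp_of_nat_mult[symmetric] b1_def by simp
      qed
      also have "real n * exp (- b1 * t\<^sup>2) * cmod (\<phi> t - of_real (\<psi> t)) \<le> real n * exp (- b1 * t\<^sup>2) * (K' * \<bar>t\<bar> ^ 3)"
        using diff[OF True] by (intro mult_left_mono) auto
      also have "\<dots> = \<bar>t\<bar> * (real n * K' * (t\<^sup>2 * exp (- b1 * t\<^sup>2)))"
        by (simp add: power3_eq_cube power2_eq_square)
      also have "\<dots> \<le> \<bar>t\<bar> * g t" using c by (intro mult_left_mono) (auto simp: g_def)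
      finally have 1: "cmod (\<phi> t ^ n - of_real (\<psi> t) ^ n) \<le> \<bar>t\<bar> * g t"
        by (simp add: mult_left_mono mult_right_mono)
      have "cmod (\<phi> t ^ n - of_real (\<psi> t) ^ n) * exp (- (s * t)\<^sup>2 / 2) \<le> cmod (\<phi> t ^ n - of_real (\<psi> t) ^ n) * 1"
        by (intro mult_left_mono) auto
      with 1 show ?thesis by simp
    next
      case False
      have "cmod (\<phi> t ^ n - of_real (\<psi> t) ^ n) \<le> cmod (\<phi> t) ^ n + \<psi> t ^ n"
        using norm_triangle_ineq4[of "\<phi> t ^ n" "of_real (\<psi> t) ^ n"] by (simp add: norm_power \<psi>_def)
      also have "\<dots> \<le> 1 + 1"
        using le1[of t] V by (intro add_mono power_le_one) (auto simp: \<psi>_def)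
      finally have 2: "cmod (\<phi> t ^ n - of_real (\<psi> t) ^ n) \<le> 2" by simp
      have "c\<^sup>2 \<le> t\<^sup>2" using False c by (metis abs_le_square_iff abs_of_pos less_eq_real_def not_le)
      then have "s\<^sup>2 * c\<^sup>2 / 4 \<le> s\<^sup>2 * t\<^sup>2 / 4" by (intro divide_right_mono mult_left_mono) auto
      then have "- (s * t)\<^sup>2 / 2 \<le> - ln n / 2 + - b2 * t\<^sup>2"
        using c by (simp add: b2_def power_mult_distrib s2)
      then have "exp (- (s * t)\<^sup>2 / 2) \<le> (1 / sqrt n) * exp (- b2 * t\<^sup>2)"
        unfolding esq[symmetric] exp_add[symmetric] by simp
      with 2 have "cmod (\<phi> t ^ n - of_real (\<psi> t) ^ n) * exp (- (s * t)\<^sup>2 / 2) \<le> 2 * ((1 / sqrt n) * exp (- b2 * t\<^sup>2))"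
        by (intro mult_mono) auto
      \<comment> \<open>At these frequencies \<open>\<bar>t\<bar> / c > 1\<close>, which supplies
        the factor \<open>\<bar>t\<bar>\<close> required to offset the singular kernel.\<close>
      also have "\<dots> \<le> (2 * \<bar>t\<bar> / c) * ((1 / sqrt n) * exp (- b2 * t\<^sup>2))"
        using False c by (intro mult_right_mono) (auto simp: field_simps)
      also have "\<dots> = \<bar>t\<bar> * ((2 / c) * (1 / sqrt n) * exp (- b2 * t\<^sup>2))" by simp
      also have "\<dots> \<le> \<bar>t\<bar> * g t" using K' by (intro mult_left_mono) (auto simp: g_def)
      finally show ?thesis .
    qed
    show ?thesis using s ig i e p by blast
  qed
  have rdG: "real_distribution (gauss (sqrt (real n * V)))" if "n \<ge> 2" for n :: nat
    using that V by (intro real_distribution_gauss) auto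
  have chG: "char (gauss (sqrt (real n * V))) t = of_real (\<psi> t) ^ n" if "n \<ge> 2" for n :: nat and t
  proof -
    have "char (gauss (sqrt (real n * V))) t = of_real (exp (real n * (- (V * t\<^sup>2 / 2))))"
      using that V by (subst char_gauss) (auto simp: power_mult_distrib)
    then show ?thesis unfolding exp_of_nat_mult \<psi>_def by simp
  qed
  have bnd: "cdf N1 x \<le> cdf N2 (x + C * ln n) + C / sqrt n"
    if n: "n \<ge> 2" and N: "real_distribution N1" "real_distribution N2"
      and ch: "\<And>t. cmod (char N1 t - char N2 t) = cmod (\<phi> t ^ n - of_real (\<psi> t) ^ n)" for N1 N2 x n
  proof -
    have ln: "ln (real n) > 0" using n by auto
    obtain s g where sg: "s > 0" "integrable lborel g" "(\<integral>t. g t \<partial>lborel) \<le> (A1 + A2) / sqrt n"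
      "exp (- ((2 / c) * ln n)\<^sup>2 / (4 * s\<^sup>2)) = 1 / sqrt n"
      "\<And>t. cmod (\<phi> t ^ n - of_real (\<psi> t) ^ n) * exp (- (s * t)\<^sup>2 / 2) \<le> \<bar>t\<bar> * g t"
      using key[OF n] by blast
    have "cdf N1 x \<le> cdf N2 (x + 2 * ((2 / c) * ln n)) + 2 * sqrt 2 * (1 / sqrt n) + (1 / pi) * (\<integral>t. g t \<partial>lborel)"
      unfolding sg(4)[symmetric] using sg c ln by (intro cdf_le_smoothing N) (auto simp: ch)
    also have "\<dots> \<le> cdf N2 (x + C * ln n) + 2 * sqrt 2 * (1 / sqrt n) + (1 / pi) * ((A1 + A2) / sqrt n)"
    proof (intro add_mono mult_left_mono sg order_refl)
      have "4 / c * ln n \<le> C * ln n" using ln A by (intro mult_right_mono) (auto simp: C_def)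
      then have "x + 2 * ((2 / c) * ln n) \<le> x + C * ln n" by simp
      then show "cdf N2 (x + 2 * ((2 / c) * ln n)) \<le> cdf N2 (x + C * ln n)"
        using N(2) by (intro finite_borel_measure.cdf_nondecreasing real_distribution.finite_borel_measure_M)
    qed (auto intro!: divide_nonneg_pos pi_gt_zero)
    also have "\<dots> \<le> cdf N2 (x + C * ln n) + C / sqrt n"
    proof -
      have "2 * sqrt 2 * (1 / sqrt n) + (1 / pi) * ((A1 + A2) / sqrt n) = (2 * sqrt 2 + (A1 + A2) / pi) / sqrt n"
        by (simp add: add_divide_distrib mult.commute)
      also have "\<dots> \<le> C / sqrt n" using c by (intro divide_right_mono) (auto simp: C_def)
      finally show ?thesis by simp
    qed
    finally show ?thesis .
  qed
  show ?thesis
  proof (rule that[OF C0])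
    fix n N x assume H: "n \<ge> (2::nat)" "real_distribution N" "\<And>t. char N t = \<phi> t ^ n"
    have s: "sqrt (real n * V) > 0" using H V by simp
    show "cdf N x \<le> \<Phi> ((x + C * ln (real n)) / sqrt (real n * V)) + C / sqrt (real n)"
      using bnd[OF H(1,2) rdG[OF H(1)], of x] s by (simp add: H(3) chG[OF H(1)] cdf_gauss)
    show "\<Phi> ((x - C * ln (real n)) / sqrt (real n * V)) - C / sqrt (real n) \<le> cdf N x"
      using bnd[OF H(1) rdG[OF H(1)] H(2), of "x - C * ln n"] s by (simp add: H(3) chG[OF H(1)] cdf_gauss norm_minus_commute)
  qed
qed

section \<open>The error probability of a lattice\<close>

lemma prob_space_fading_dist:
  assumes "regular_fading_pdf f"
  shows "prob_space (fading_dist f)"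
  using assms by (intro prob_spaceI) (simp add: regular_fading_pdf_def fading_dist_def emeasure_density)

lemma sets_fading_dist[simp, measurable_cong]: "sets (fading_dist f) = sets borel"
  by (simp add: fading_dist_def)

lemma space_fading_dist[simp]: "space (fading_dist f) = UNIV"
  by (simp add: fading_dist_def)

lemma sets_gauss[simp, measurable_cong]: "sets (gauss s) = sets borel"
  by (simp add: gauss_def)

lemma space_gauss[simp]: "space (gauss s) = UNIV"
  by (simp add: gauss_def)

lemma noise_vec_eq: "noise_vec \<sigma> n = PiM {..<n} (\<lambda>_. gauss \<sigma>)"
  by (simp add: noise_vec_def gauss_def)

lemma prob_space_gauss: "s > 0 \<Longrightarrow> prob_space (gauss s)"
  unfolding gauss_def by (rule prob_space_normal_density)

lemma sets_fading_vec[measurable_cong]: "sets (fading_vec f n) = sets (LB n)"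
  unfolding fading_vec_def by (intro sets_PiM_cong) auto

lemma sets_noise_vec[measurable_cong]: "sets (noise_vec \<sigma> n) = sets (LB n)"
  unfolding noise_vec_eq by (intro sets_PiM_cong) auto

lemma space_noise_vec: "space (noise_vec f n) = space (LB n)"
  by (rule sets_eq_imp_space_eq[OF sets_noise_vec])

lemma prob_space_fading_vec: "regular_fading_pdf f \<Longrightarrow> prob_space (fading_vec f n)"
  unfolding fading_vec_def by (intro prob_space_PiM prob_space_fading_dist)

lemma prob_space_noise_vec: "\<sigma> > 0 \<Longrightarrow> prob_space (noise_vec \<sigma> n)"
  unfolding noise_vec_eq by (intro prob_space_PiM prob_space_gauss)

lemma AE_fading_vec_pos:
  assumes f: "regular_fading_pdf f"
  shows "AE h in fading_vec f n. \<forall>i<n. 0 < h i"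
proof -
  have [measurable]: "f \<in> borel_measurable borel" using f by (simp add: regular_fading_pdf_def)
  have "AE x in lborel. 0 < f x \<longrightarrow> 0 < x"
    using AE_lborel_singleton[of 0]
  proof eventually_elim
    case (elim x)
    have "f x = 0" if "x < 0" using f that by (simp add: regular_fading_pdf_def)
    with elim show ?case by (cases "x < 0") auto
  qed
  then have "AE x in fading_dist f. 0 < x"
    unfolding fading_dist_def by (subst AE_density) auto
  then have "AE h in fading_vec f n. 0 < h i" if "i < n" for i
    unfolding fading_vec_def using that prob_space_fading_dist[OF f]
    by (intro AE_PiM_component) auto
  then have "AE h in fading_vec f n. \<forall>i\<in>{..<n}. 0 < h i"
    by (intro AE_finite_allI) auto
  then show ?thesis by eventually_elim simp
qed

text \<open>Coefficients range over all functions and the value is not cut off beyond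
  \<open>n\<close>, so differences of lattice points correspond to differences of coefficients
  without extensionality conditions.\<close>

definition lat_pt :: "nat \<Rightarrow> (nat \<Rightarrow> nat \<Rightarrow> real) \<Rightarrow> (nat \<Rightarrow> int) \<Rightarrow> nat \<Rightarrow> real" where
  "lat_pt n G k i = (\<Sum>j<n. G i j * real_of_int (k j))"

lemma lat_pt_restrict: "lat_pt n G (restrict k {..<n}) = lat_pt n G k"
  by (auto simp: lat_pt_def fun_eq_iff)

lemma lat_pt_diff: "lat_pt n G (\<lambda>j. k j - l j) i = lat_pt n G k i - lat_pt n G l i"
  by (simp add: lat_pt_def sum_subtractf right_diff_distrib)

lemma recv_lattice_eq: "recv_lattice n G h = range (\<lambda>k. \<lambda>i\<in>{..<n}. h i * lat_pt n G k i)"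
proof -
  have "lattice_pts n G = range (\<lambda>k. restrict (lat_pt n G k) {..<n})"
    unfolding lattice_pts_def lat_pt_def by auto
  moreover have "hmul n h (restrict x {..<n}) = (\<lambda>i\<in>{..<n}. h i * x i)" for x
    by (simp add: hmul_def fun_eq_iff)
  ultimately show ?thesis by (simp add: recv_lattice_def image_image)
qed

text \<open>Extensional coefficient vectors are countable in number, which is what makes the error
  event measurable.\<close>

lemma bex_ZN: "(\<exists>k\<in>ZN n. P (lat_pt n G k)) \<longleftrightarrow> (\<exists>k. P (lat_pt n G k))"
proof
  assume "\<exists>k. P (lat_pt n G k)"
  then obtain k where "P (lat_pt n G (restrict k {..<n}))" by (auto simp: lat_pt_restrict)
  moreover have "restrict k {..<n} \<in> ZN n" by simp
  ultimately show "\<exists>k\<in>ZN n. P (lat_pt n G k)" by blast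
qed blast

text \<open>The error event moved to the origin. The inequality is strict because ties belong to the
  closed Voronoi cell and count as correct; the coefficient vector 0 therefore never triggers
  it.\<close>

definition err_event :: "nat \<Rightarrow> (nat \<Rightarrow> nat \<Rightarrow> real) \<Rightarrow> (nat \<Rightarrow> real) \<Rightarrow> (nat \<Rightarrow> real) \<Rightarrow> bool" where
  "err_event n G h z \<longleftrightarrow> (\<exists>k\<in>ZN n. (\<Sum>i<n. (z i - h i * lat_pt n G k i)\<^sup>2) < (\<Sum>i<n. (z i)\<^sup>2))"

text \<open>Translation by the transmitted point permutes the lattice, so all received points have
  the same error probability. This is why the average and the maximal criterion agree.\<close>

lemma pt_err_eq:
  assumes y: "y \<in> recv_lattice n G h"
  shows "pt_err \<sigma> n G h y = measure (noise_vec \<sigma> n) {z \<in> space (noise_vec \<sigma> n). err_event n G h z}"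
proof -
  obtain l where l: "y = (\<lambda>i\<in>{..<n}. h i * lat_pt n G l i)"
    using y by (auto simp: recv_lattice_eq)
  have "vadd n y z \<notin> voronoi n (recv_lattice n G h) y \<longleftrightarrow> err_event n G h z" for z
  proof -
    have 1: "sqdist n (vadd n y z) y = (\<Sum>i<n. (z i)\<^sup>2)"
      unfolding sqdist_def vadd_def by (intro sum.cong) auto
    have 2: "sqdist n (vadd n y z) (\<lambda>i\<in>{..<n}. h i * lat_pt n G k i) = (\<Sum>i<n. (z i - h i * lat_pt n G (\<lambda>j. k j - l j) i)\<^sup>2)" for k
      unfolding sqdist_def vadd_def l lat_pt_diff
      by (intro sum.cong) (auto simp: algebra_simps)
    have "vadd n y z \<notin> voronoi n (recv_lattice n G h) y \<longleftrightarrow>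
      (\<exists>k. (\<Sum>i<n. (z i - h i * lat_pt n G (\<lambda>j. k j - l j) i)\<^sup>2) < (\<Sum>i<n. (z i)\<^sup>2))"
      unfolding voronoi_def recv_lattice_eq by (auto simp: 1 2 not_le)
    also have "\<dots> \<longleftrightarrow> (\<exists>k. (\<Sum>i<n. (z i - h i * lat_pt n G k i)\<^sup>2) < (\<Sum>i<n. (z i)\<^sup>2))"
    proof (safe)
      fix k assume *: "(\<Sum>i<n. (z i - h i * lat_pt n G k i)\<^sup>2) < (\<Sum>i<n. (z i)\<^sup>2)"
      show "\<exists>k. (\<Sum>i<n. (z i - h i * lat_pt n G (\<lambda>j. k j - l j) i)\<^sup>2) < (\<Sum>i<n. (z i)\<^sup>2)"
        by (rule exI[of _ "\<lambda>j. k j + l j"]) (use * in simp)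
    qed blast
    also have "\<dots> \<longleftrightarrow> err_event n G h z"
      unfolding err_event_def by (rule bex_ZN[symmetric])
    finally show ?thesis .
  qed
  then show ?thesis unfolding pt_err_def by simp
qed

lemma zero_in_recv_lattice: "(\<lambda>i\<in>{..<n}. 0) \<in> recv_lattice n G h"
  unfolding recv_lattice_eq by (rule image_eqI[of _ _ "\<lambda>_. 0"]) (auto simp: lat_pt_def)

lemma sets_err_event:
  assumes M: "sets M = sets (LB n)" and N: "sets N = sets (LB n)"
  shows "{p \<in> space (M \<Otimes>\<^sub>M N). err_event n G (fst p) (snd p)} \<in> sets (M \<Otimes>\<^sub>M N)"
proof -
  note [measurable_cong] = M N
  show ?thesis
    unfolding err_event_def
    by (intro sets.sets_Collect_countable_Ex' countable_ZN) measurable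
qed

definition chan :: "(real \<Rightarrow> real) \<Rightarrow> real \<Rightarrow> nat \<Rightarrow> ((nat \<Rightarrow> real) \<times> (nat \<Rightarrow> real)) measure" where
  "chan f \<sigma> n = fading_vec f n \<Otimes>\<^sub>M noise_vec \<sigma> n"

definition perr :: "(real \<Rightarrow> real) \<Rightarrow> real \<Rightarrow> nat \<Rightarrow> (nat \<Rightarrow> nat \<Rightarrow> real) \<Rightarrow> real" where
  "perr f \<sigma> n G = measure (chan f \<sigma> n) {p \<in> space (chan f \<sigma> n). err_event n G (fst p) (snd p)}"

lemma prob_space_chan:
  assumes "regular_fading_pdf f" "\<sigma> > 0"
  shows "prob_space (chan f \<sigma> n)"
proof -
  interpret F: prob_space "fading_vec f n" using assms(1) by (rule prob_space_fading_vec)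
  interpret N: prob_space "noise_vec \<sigma> n" using assms(2) by (rule prob_space_noise_vec)
  interpret P: pair_prob_space "fading_vec f n" "noise_vec \<sigma> n" ..
  show ?thesis unfolding chan_def by (rule P.prob_space_axioms)
qed

definition perr_cond :: "real \<Rightarrow> nat \<Rightarrow> (nat \<Rightarrow> nat \<Rightarrow> real) \<Rightarrow> (nat \<Rightarrow> real) \<Rightarrow> real" where
  "perr_cond \<sigma> n G h = measure (noise_vec \<sigma> n) {z \<in> space (noise_vec \<sigma> n). err_event n G h z}"

lemma perr_cond_measurable:
  assumes "\<sigma> > 0"
  shows "perr_cond \<sigma> n G \<in> borel_measurable (fading_vec f n)"
    and "regular_fading_pdf f \<Longrightarrow> (\<integral>h. perr_cond \<sigma> n G h \<partial>fading_vec f n) = perr f \<sigma> n G"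
proof -
  interpret N: prob_space "noise_vec \<sigma> n" using assms by (rule prob_space_noise_vec)
  let ?E = "{p \<in> space (fading_vec f n \<Otimes>\<^sub>M noise_vec \<sigma> n). err_event n G (fst p) (snd p)}"
  have E: "?E \<in> sets (fading_vec f n \<Otimes>\<^sub>M noise_vec \<sigma> n)"
    by (rule sets_err_event[OF sets_fading_vec sets_noise_vec])
  have sec: "Pair h -` ?E = {z \<in> space (noise_vec \<sigma> n). err_event n G h z}" if "h \<in> space (fading_vec f n)" for h
    using that by (auto simp: space_pair_measure)
  have em: "(\<lambda>h. emeasure (noise_vec \<sigma> n) (Pair h -` ?E)) \<in> borel_measurable (fading_vec f n)"
    by (rule N.measurable_emeasure_Pair[OF E])
  have "(\<lambda>h. enn2real (emeasure (noise_vec \<sigma> n) (Pair h -` ?E))) \<in> borel_measurable (fading_vec f n)"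
    using em by measurable
  then show meas: "perr_cond \<sigma> n G \<in> borel_measurable (fading_vec f n)"
  proof (rule measurable_cong[THEN iffD1, rotated])
    show "enn2real (emeasure (noise_vec \<sigma> n) (Pair h -` ?E)) = perr_cond \<sigma> n G h" if "h \<in> space (fading_vec f n)" for h
      unfolding perr_cond_def measure_def sec[OF that] ..
  qed
  have bnd: "0 \<le> perr_cond \<sigma> n G h" "perr_cond \<sigma> n G h \<le> 1" for h
    by (simp_all add: perr_cond_def)
  assume f: "regular_fading_pdf f"
  interpret F: prob_space "fading_vec f n" using f by (rule prob_space_fading_vec)
  have "emeasure (fading_vec f n \<Otimes>\<^sub>M noise_vec \<sigma> n) ?E = (\<integral>\<^sup>+h. emeasure (noise_vec \<sigma> n) (Pair h -` ?E) \<partial>fading_vec f n)"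
    by (rule N.emeasure_pair_measure_alt[OF E])
  also have "\<dots> = (\<integral>\<^sup>+h. ennreal (perr_cond \<sigma> n G h) \<partial>fading_vec f n)"
    by (intro nn_integral_cong) (simp only: sec perr_cond_def N.emeasure_eq_measure)
  also have "\<dots> = ennreal (\<integral>h. perr_cond \<sigma> n G h \<partial>fading_vec f n)"
    by (intro nn_integral_eq_integral F.integrable_const_bound[of _ 1])
       (simp_all add: meas bnd)
  finally show "(\<integral>h. perr_cond \<sigma> n G h \<partial>fading_vec f n) = perr f \<sigma> n G"
    unfolding perr_def chan_def measure_def
    by (simp add: integral_nonneg_AE bnd)
qed

lemma lattice_max_err_eq:
  assumes "regular_fading_pdf f" "\<sigma> > 0"
  shows "lattice_max_err f \<sigma> n G = perr f \<sigma> n G"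
proof -
  have "(SUP y\<in>recv_lattice n G h. pt_err \<sigma> n G h y) = perr_cond \<sigma> n G h" for h
  proof -
    have "(\<lambda>y. pt_err \<sigma> n G h y) ` recv_lattice n G h = {perr_cond \<sigma> n G h}"
      using zero_in_recv_lattice[of n G h] by (auto simp: pt_err_eq perr_cond_def)
    then show ?thesis by simp
  qed
  then show ?thesis
    unfolding lattice_max_err_def using perr_cond_measurable(2)[OF assms(2,1)] by simp
qed

text \<open>The zero pattern of \<open>h\<close> alone decides whether the received points in a cube are finite
  in number; this makes the integrand of the average error measurable also where some fading
  coefficient vanishes (there \<open>card\<close> of an infinite set is 0).\<close>

definition proj_pts :: "nat \<Rightarrow> (nat \<Rightarrow> nat \<Rightarrow> real) \<Rightarrow> nat set \<Rightarrow> real \<Rightarrow> (nat \<Rightarrow> real) set" where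
  "proj_pts n G I a = {restrict (lat_pt n G k) I | k. \<forall>i\<in>I. \<bar>lat_pt n G k i\<bar> < a / 2}"

lemma proj_pts_mono: "a \<le> b \<Longrightarrow> proj_pts n G I a \<subseteq> proj_pts n G I b"
  unfolding proj_pts_def by force

text \<open>A coordinate with \<open>h i = 0\<close> is erased both in the lattice and in the cube.
  The received points in the cube are thus in bijection with the projections of lattice points to
  the other coordinates, with the cube condition imposed only there; \<open>a > 0\<close> allows 0
  as the erased coordinate.\<close>

lemma finite_recv_cube_iff:
  assumes a: "a > 0"
  shows "finite (recv_lattice n G h \<inter> recv_cube n h a) \<longleftrightarrow> finite (proj_pts n G {i. i < n \<and> h i \<noteq> 0} a)"
proof -
  let ?I = "{i. i < n \<and> h i \<noteq> 0}"
  let ?m = "\<lambda>x. \<lambda>i\<in>{..<n}. if h i = 0 then 0 else h i * x i"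
  have "recv_lattice n G h \<inter> recv_cube n h a = ?m ` proj_pts n G ?I a"
  proof (intro Set.set_eqI iffI)
    fix y assume "y \<in> recv_lattice n G h \<inter> recv_cube n h a"
    then have "y \<in> recv_lattice n G h" "y \<in> recv_cube n h a" by blast+
    from this(1) obtain k where y1: "y = (\<lambda>i\<in>{..<n}. h i * lat_pt n G k i)"
      unfolding recv_lattice_eq by blast
    from \<open>y \<in> recv_cube n h a\<close> obtain x where y2: "y = hmul n h x" and x: "\<forall>i<n. \<bar>x i\<bar> < a / 2"
      unfolding recv_cube_def by blast
    note y = y1 y2
    have "lat_pt n G k i = x i" if "i \<in> ?I" for i
      using fun_cong[OF y(1), of i] fun_cong[OF y(2), of i] that by (simp add: hmul_def)
    then have "restrict (lat_pt n G k) ?I \<in> proj_pts n G ?I a"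
      using x by (auto simp: proj_pts_def)
    moreover have "y = ?m (restrict (lat_pt n G k) ?I)"
      unfolding y(1) by (auto simp: fun_eq_iff)
    ultimately show "y \<in> ?m ` proj_pts n G ?I a" by blast
  next
    fix y assume "y \<in> ?m ` proj_pts n G ?I a"
    then obtain k where y: "y = ?m (restrict (lat_pt n G k) ?I)" and k: "\<forall>i\<in>?I. \<bar>lat_pt n G k i\<bar> < a / 2"
      by (auto simp: proj_pts_def)
    have "y = (\<lambda>i\<in>{..<n}. h i * lat_pt n G k i)"
      unfolding y by (auto simp: fun_eq_iff)
    then have 1: "y \<in> recv_lattice n G h" by (auto simp: recv_lattice_eq)
    let ?x = "\<lambda>i\<in>{..<n}. if h i = 0 then 0 else lat_pt n G k i"
    have "y = hmul n h ?x" unfolding y hmul_def by (auto simp: fun_eq_iff)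
    moreover have "?x \<in> {x \<in> PiE {..<n} (\<lambda>_. UNIV). \<forall>i<n. \<bar>x i\<bar> < a / 2}"
      using k a by auto
    ultimately have "y \<in> recv_cube n h a" unfolding recv_cube_def by blast
    with 1 show "y \<in> recv_lattice n G h \<inter> recv_cube n h a" by blast
  qed
  moreover have "inj_on ?m (proj_pts n G ?I a)"
  proof (rule inj_onI)
    fix x x' assume "x \<in> proj_pts n G ?I a" "x' \<in> proj_pts n G ?I a" and eq: "?m x = ?m x'"
    then have ext: "x \<in> extensional ?I" "x' \<in> extensional ?I" by (auto simp: proj_pts_def)
    have "x i = x' i" if "i \<in> ?I" for i
      using fun_cong[OF eq, of i] that by simp
    then show "x = x'" using ext by (intro extensionalityI[of x ?I x'])
  qed
  ultimately show ?thesis by (simp add: finite_image_iff)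
qed

lemma cube_avg_err_eq:
  assumes a: "a > 0"
  shows "cube_avg_err \<sigma> n G h a = (if finite (proj_pts n G {i. i < n \<and> h i \<noteq> 0} a) then perr_cond \<sigma> n G h else 0)"
proof -
  let ?S = "recv_lattice n G h \<inter> recv_cube n h a"
  have "(\<lambda>i\<in>{..<n}. 0) \<in> recv_cube n h a"
    unfolding recv_cube_def hmul_def using a
    by (intro image_eqI[of _ _ "\<lambda>i\<in>{..<n}. 0"]) (simp_all add: fun_eq_iff restrict_PiE_iff)
  then have ne: "?S \<noteq> {}" using zero_in_recv_lattice by blast
  have "(\<Sum>y\<in>?S. pt_err \<sigma> n G h y) = real (card ?S) * perr_cond \<sigma> n G h"
    by (simp add: pt_err_eq perr_cond_def)
  then show ?thesis
    unfolding cube_avg_err_def Let_def finite_recv_cube_iff[OF a, symmetric] using ne by auto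
qed

text \<open>The cube average is eventually constant in \<open>a\<close>: either every cube contains
  finitely many received points, all with the same error probability, or some cube contains
  infinitely many and so does every larger one, where the quotient is 0.\<close>

lemma Limsup_cube_avg_err:
  "real_of_ereal (Limsup at_top (\<lambda>a::real. ereal (cube_avg_err \<sigma> n G h a)))
    = (if \<forall>a. finite (proj_pts n G {i. i < n \<and> h i \<noteq> 0} a) then perr_cond \<sigma> n G h else 0)" (is "_ = ?r")
proof -
  have "\<forall>\<^sub>F a in at_top. ereal (cube_avg_err \<sigma> n G h a) = ereal ?r"
  proof (cases "\<forall>a. finite (proj_pts n G {i. i < n \<and> h i \<noteq> 0} a)")
    case True
    show ?thesis
      using eventually_gt_at_top[of 0] by eventually_elim (simp add: cube_avg_err_eq True)
  next
    case False
    then obtain a0 where a0: "infinite (proj_pts n G {i. i < n \<and> h i \<noteq> 0} a0)" by blast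
    show ?thesis
      using eventually_gt_at_top[of "max 0 a0"]
    proof eventually_elim
      case (elim a)
      then have "infinite (proj_pts n G {i. i < n \<and> h i \<noteq> 0} a)"
        using a0 finite_subset[OF proj_pts_mono[of a0 a]] by auto
      with elim False show ?case by (auto simp: cube_avg_err_eq)
    qed
  qed
  then have "((\<lambda>a. ereal (cube_avg_err \<sigma> n G h a)) \<longlongrightarrow> ereal ?r) at_top"
    by (rule tendsto_eventually)
  then have "Limsup at_top (\<lambda>a::real. ereal (cube_avg_err \<sigma> n G h a)) = ereal ?r"
    by (intro lim_imp_Limsup) auto
  then show ?thesis by simp
qed

text \<open>Almost surely no fading coefficient vanishes, and then local finiteness of the lattice
  makes the integrand equal to \<open>perr_cond\<close>.\<close>

lemma lattice_avg_err_eq: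
  assumes f: "regular_fading_pdf f" and \<sigma>: "\<sigma> > 0" and det: "gen_det n G \<noteq> 0"
  shows "lattice_avg_err f \<sigma> n G = perr f \<sigma> n G"
proof -
  define fin where "fin I \<longleftrightarrow> (\<forall>a. finite (proj_pts n G I a))" for I
  have full: "fin {..<n}"
    unfolding fin_def
  proof
    fix a
    have "proj_pts n G {..<n} a \<subseteq> (\<lambda>k. restrict (lat_pt n G k) {..<n}) ` {k \<in> ZN n. \<forall>i<n. \<bar>\<Sum>j<n. G i j * real_of_int (k j)\<bar> \<le> a / 2}"
    proof
      fix x assume "x \<in> proj_pts n G {..<n} a"
      then obtain k where k: "x = restrict (lat_pt n G (restrict k {..<n})) {..<n}" "\<forall>i<n. \<bar>lat_pt n G (restrict k {..<n}) i\<bar> < a / 2"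
        unfolding lat_pt_restrict by (auto simp: proj_pts_def)
      then have "restrict k {..<n} \<in> {k \<in> ZN n. \<forall>i<n. \<bar>\<Sum>j<n. G i j * real_of_int (k j)\<bar> \<le> a / 2}"
        unfolding lat_pt_def by (auto intro: less_imp_le)
      with k(1) show "x \<in> (\<lambda>k. restrict (lat_pt n G k) {..<n}) ` {k \<in> ZN n. \<forall>i<n. \<bar>\<Sum>j<n. G i j * real_of_int (k j)\<bar> \<le> a / 2}" by blast
    qed
    then show "finite (proj_pts n G {..<n} a)"
      by (rule finite_subset) (intro finite_imageI finite_int_preimage_box det)
  qed
  \<comment> \<open>Only finitely many zero patterns \<open>I\<close> occur, and fixing one is a
    measurable condition on \<open>h\<close>. The integrand is thus measurable before it is changed
    on a null set.\<close>
  have meas: "{h \<in> space (fading_vec f n). fin {i. i < n \<and> h i \<noteq> 0}} \<in> sets (fading_vec f n)"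
  proof -
    have "{h \<in> space (fading_vec f n). fin {i. i < n \<and> h i \<noteq> 0}}
      = (\<Union>I\<in>{I \<in> Pow {..<n}. fin I}. {h \<in> space (fading_vec f n). \<forall>i\<in>{..<n}. (h i \<noteq> 0) = (i \<in> I)})"
    proof (intro Set.set_eqI iffI)
      fix h assume h: "h \<in> {h \<in> space (fading_vec f n). fin {i. i < n \<and> h i \<noteq> 0}}"
      then show "h \<in> (\<Union>I\<in>{I \<in> Pow {..<n}. fin I}. {h \<in> space (fading_vec f n). \<forall>i\<in>{..<n}. (h i \<noteq> 0) = (i \<in> I)})"
        by (intro UN_I[of "{i. i < n \<and> h i \<noteq> 0}"]) auto
    next
      fix h assume "h \<in> (\<Union>I\<in>{I \<in> Pow {..<n}. fin I}. {h \<in> space (fading_vec f n). \<forall>i\<in>{..<n}. (h i \<noteq> 0) = (i \<in> I)})"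
      then obtain I where I: "I \<subseteq> {..<n}" "fin I" "h \<in> space (fading_vec f n)" "\<forall>i\<in>{..<n}. (h i \<noteq> 0) = (i \<in> I)" by blast
      then have "{i. i < n \<and> h i \<noteq> 0} = I" by auto
      with I show "h \<in> {h \<in> space (fading_vec f n). fin {i. i < n \<and> h i \<noteq> 0}}" by simp
    qed
    also have "\<dots> \<in> sets (fading_vec f n)"
    proof (rule sets.finite_UN)
      show "{h \<in> space (fading_vec f n). \<forall>i\<in>{..<n}. (h i \<noteq> 0) = (i \<in> I)} \<in> sets (fading_vec f n)" for I
        by measurable
    qed simp
    finally show ?thesis .
  qed
  have "lattice_avg_err f \<sigma> n G = (\<integral>h. (if fin {i. i < n \<and> h i \<noteq> 0} then perr_cond \<sigma> n G h else 0) \<partial>fading_vec f n)"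
    unfolding lattice_avg_err_def Limsup_cube_avg_err fin_def ..
  also have "\<dots> = (\<integral>h. perr_cond \<sigma> n G h \<partial>fading_vec f n)"
  proof (rule integral_cong_AE)
    show "(\<lambda>h. if fin {i. i < n \<and> h i \<noteq> 0} then perr_cond \<sigma> n G h else 0) \<in> borel_measurable (fading_vec f n)"
      using perr_cond_measurable(1)[OF \<sigma>] meas by (intro measurable_If) auto
    show "perr_cond \<sigma> n G \<in> borel_measurable (fading_vec f n)"
      by (rule perr_cond_measurable(1)[OF \<sigma>])
    show "AE h in fading_vec f n. (if fin {i. i < n \<and> h i \<noteq> 0} then perr_cond \<sigma> n G h else 0) = perr_cond \<sigma> n G h"
      using AE_fading_vec_pos[OF f, of n]
    proof eventually_elim
      case (elim h)
      then have "{i. i < n \<and> h i \<noteq> 0} = {..<n}" by auto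
      with full show ?case by simp
    qed
  qed
  also have "\<dots> = perr f \<sigma> n G" by (rule perr_cond_measurable(2)[OF \<sigma> f])
  finally show ?thesis .
qed

section \<open>The information density\<close>

lemma (in prob_space) char_approx_cubic:
  fixes X :: "'a \<Rightarrow> real"
  assumes [measurable]: "random_variable borel X"
    and int3: "integrable M (\<lambda>x. \<bar>X x\<bar> ^ 3)" and mean: "expectation X = 0"
  shows "cmod (char (distr M borel X) t - of_real (1 - t\<^sup>2 * expectation (\<lambda>x. (X x)\<^sup>2) / 2))
    \<le> expectation (\<lambda>x. \<bar>X x\<bar> ^ 3) * \<bar>t\<bar> ^ 3"
proof -
  have le3: "y ^ k \<le> 1 + y ^ 3" if "y \<ge> 0" "k \<le> 3" for y :: real and k
  proof (cases "y \<le> 1")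
    case True
    then have "y ^ k \<le> 1" using that by (simp add: power_le_one)
    moreover have "0 \<le> y ^ 3" using that by simp
    ultimately show ?thesis by linarith
  next
    case False
    then have "y ^ k \<le> y ^ 3" using that by (intro power_increasing) auto
    then show ?thesis by simp
  qed
  have i1: "integrable M X"
    by (rule Bochner_Integration.integrable_bound[of M "\<lambda>x. 1 + \<bar>X x\<bar> ^ 3"])
       (use int3 le3[of "\<bar>X _\<bar>" 1] in \<open>auto intro!: AE_I2\<close>)
  have i2: "integrable M (\<lambda>x. (X x)\<^sup>2)"
    by (rule Bochner_Integration.integrable_bound[of M "\<lambda>x. 1 + \<bar>X x\<bar> ^ 3"])
       (use int3 le3[of "\<bar>X _\<bar>" 2] in \<open>auto intro!: AE_I2\<close>)
  have "cmod (char (distr M borel X) t - (1 - t\<^sup>2 * expectation (\<lambda>x. (X x)\<^sup>2) / 2))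
    \<le> (t\<^sup>2 / 6) * expectation (\<lambda>x. min (6 * (X x)\<^sup>2) (\<bar>t\<bar> * \<bar>X x\<bar> ^ 3))"
    using i1 i2 mean by (intro char_approx3') auto
  also have "expectation (\<lambda>x. min (6 * (X x)\<^sup>2) (\<bar>t\<bar> * \<bar>X x\<bar> ^ 3)) \<le> expectation (\<lambda>x. \<bar>t\<bar> * \<bar>X x\<bar> ^ 3)"
  proof (rule integral_mono)
    show "integrable M (\<lambda>x. min (6 * (X x)\<^sup>2) (\<bar>t\<bar> * \<bar>X x\<bar> ^ 3))"
      by (rule Bochner_Integration.integrable_bound[of M "\<lambda>x. \<bar>t\<bar> * \<bar>X x\<bar> ^ 3"])
         (use int3 in \<open>auto intro!: AE_I2\<close>)
  qed (use int3 in auto)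
  also have "(t\<^sup>2 / 6) * expectation (\<lambda>x. \<bar>t\<bar> * \<bar>X x\<bar> ^ 3) = \<bar>t\<bar> ^ 3 * expectation (\<lambda>x. \<bar>X x\<bar> ^ 3) / 6"
    by (simp add: power3_eq_cube power2_eq_square)
  also have "\<dots> \<le> expectation (\<lambda>x. \<bar>X x\<bar> ^ 3) * \<bar>t\<bar> ^ 3"
  proof -
    have "0 \<le> \<bar>t\<bar> ^ 3 * expectation (\<lambda>x. \<bar>X x\<bar> ^ 3)" by (intro mult_nonneg_nonneg integral_nonneg_AE) auto
    then show ?thesis by (simp add: mult.commute)
  qed
  finally show ?thesis by (simp add: mult_left_mono)
qed

text \<open>For \<open>\<bar>t\<bar> \<le> 1\<close> the product of the two quadratics has the extra
  term \<open>t ^ 4 * (v * w) / 4\<close>, absorbed by the cubic one. For larger \<open>t\<close>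
  the trivial bound on both sides suffices and accounts for the summand \<open>2 + v + w\<close> of
  the constant.\<close>

lemma cubic_approx_mult:
  fixes a b :: complex
  assumes ab: "cmod a \<le> 1" "cmod b \<le> 1"
    and A: "cmod (a - of_real (1 - t\<^sup>2 * v / 2)) \<le> K * \<bar>t\<bar> ^ 3"
    and B: "cmod (b - of_real (1 - t\<^sup>2 * w / 2)) \<le> L * \<bar>t\<bar> ^ 3"
    and nn: "v \<ge> 0" "w \<ge> 0" "K \<ge> 0" "L \<ge> 0"
  shows "cmod (a * b - of_real (1 - t\<^sup>2 * (v + w) / 2)) \<le> (K + (1 + v) * L + v * w + 2 + v + w) * \<bar>t\<bar> ^ 3"
proof (cases "\<bar>t\<bar> \<le> 1")
  case True
  have t3: "0 \<le> \<bar>t\<bar> ^ 3" by simp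
  have t2: "t\<^sup>2 \<le> 1" using True by (simp add: abs_square_le_1)
  have "a * b - of_real (1 - t\<^sup>2 * (v + w) / 2) = (a - of_real (1 - t\<^sup>2 * v / 2)) * b
      + of_real (1 - t\<^sup>2 * v / 2) * (b - of_real (1 - t\<^sup>2 * w / 2)) + of_real (t ^ 4 * (v * w) / 4)"
    by (simp add: algebra_simps power2_eq_square power4_eq_xxxx)
  also have "cmod \<dots> \<le> cmod (a - of_real (1 - t\<^sup>2 * v / 2)) * cmod b
      + cmod (of_real (1 - t\<^sup>2 * v / 2)) * cmod (b - of_real (1 - t\<^sup>2 * w / 2)) + cmod (of_real (t ^ 4 * (v * w) / 4))"
    by (intro norm_triangle_le add_mono order_refl) (simp_all only: norm_mult order_refl)
  also have "\<dots> \<le> K * \<bar>t\<bar> ^ 3 * 1 + (1 + v) * (L * \<bar>t\<bar> ^ 3) + v * w * \<bar>t\<bar> ^ 3"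
  proof (intro add_mono mult_mono A B ab)
    have "\<bar>1 - t\<^sup>2 * v / 2\<bar> \<le> 1 + t\<^sup>2 * v / 2" using nn by (simp add: abs_if)
    also have "t\<^sup>2 * v / 2 \<le> v" using mult_right_mono[OF t2 nn(1)] nn(1) by simp
    finally show "cmod (of_real (1 - t\<^sup>2 * v / 2)) \<le> 1 + v" by (simp only: norm_of_real)
    have "t ^ 4 = \<bar>t\<bar> ^ 3 * \<bar>t\<bar>" by (simp add: power4_eq_xxxx power3_eq_cube)
    also have "\<dots> \<le> \<bar>t\<bar> ^ 3" using True mult_left_mono[OF True t3] by simp
    finally have "t ^ 4 * (v * w) \<le> \<bar>t\<bar> ^ 3 * (v * w)" using nn by (intro mult_right_mono) auto
    moreover have "0 \<le> t ^ 4 * (v * w)" using nn by (intro mult_nonneg_nonneg) auto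
    ultimately have "t ^ 4 * (v * w) / 4 \<le> \<bar>t\<bar> ^ 3 * (v * w)" by linarith
    then have "t ^ 4 * (v * w) / 4 \<le> v * w * \<bar>t\<bar> ^ 3" by (simp only: mult.commute)
    then show "cmod (of_real (t ^ 4 * (v * w) / 4)) \<le> v * w * \<bar>t\<bar> ^ 3"
      using nn by (simp only: norm_of_real abs_of_nonneg) simp
  qed (use nn t3 in auto)
  also have "\<dots> = (K + (1 + v) * L + v * w) * \<bar>t\<bar> ^ 3" by (simp add: algebra_simps)
  also have "\<dots> \<le> (K + (1 + v) * L + v * w + 2 + v + w) * \<bar>t\<bar> ^ 3"
    using nn by (intro mult_right_mono) auto
  finally show ?thesis .
next
  case False
  then have t: "1 \<le> \<bar>t\<bar>" by simp
  have "\<bar>t\<bar>\<^sup>2 \<le> \<bar>t\<bar> ^ 3" using t by (intro power_increasing) auto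
  then have t3: "1 \<le> \<bar>t\<bar> ^ 3" "t\<^sup>2 \<le> \<bar>t\<bar> ^ 3" using t by simp_all
  have "cmod (a * b - of_real (1 - t\<^sup>2 * (v + w) / 2)) \<le> cmod (a * b) + cmod (of_real (1 - t\<^sup>2 * (v + w) / 2))"
    by (rule norm_triangle_ineq4)
  also have "\<dots> \<le> 1 + (1 + t\<^sup>2 * (v + w) / 2)"
  proof (rule add_mono)
    show "cmod (a * b) \<le> 1" unfolding norm_mult using ab by (simp add: mult_le_one)
    show "cmod (of_real (1 - t\<^sup>2 * (v + w) / 2)) \<le> 1 + t\<^sup>2 * (v + w) / 2"
      unfolding norm_of_real using nn by (simp add: abs_if)
  qed
  also have "\<dots> \<le> 2 * \<bar>t\<bar> ^ 3 + (v + w) * \<bar>t\<bar> ^ 3"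
  proof -
    have "t\<^sup>2 * (v + w) \<le> \<bar>t\<bar> ^ 3 * (v + w)" using t3(2) nn by (intro mult_right_mono) auto
    moreover have "0 \<le> t\<^sup>2 * (v + w)" using nn by simp
    ultimately show ?thesis using t3(1) by (simp add: mult.commute)
  qed
  also have "\<dots> = (2 + v + w) * \<bar>t\<bar> ^ 3" by (simp add: algebra_simps)
  also have "\<dots> \<le> (K + (1 + v) * L + v * w + 2 + v + w) * \<bar>t\<bar> ^ 3"
    using nn by (intro mult_right_mono) auto
  finally show ?thesis .
qed

lemma char_distr_PiM_sum:
  assumes M: "prob_space M" and [measurable]: "F \<in> borel_measurable M"
  shows "char (distr (PiM {..<n::nat} (\<lambda>_. M)) borel (\<lambda>x. \<Sum>i<n. F (x i))) t = char (distr M borel F) t ^ n"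
proof -
  interpret M: prob_space M by fact
  interpret P: product_sigma_finite "\<lambda>_::nat. M" ..
  have "char (distr (PiM {..<n} (\<lambda>_. M)) borel (\<lambda>x. \<Sum>i<n. F (x i))) t = (CLINT x|PiM {..<n} (\<lambda>_. M). iexp (t * (\<Sum>i<n. F (x i))))"
    unfolding char_def by (subst integral_distr) auto
  also have "\<dots> = (CLINT x|PiM {..<n} (\<lambda>_. M). \<Prod>i<n. iexp (t * F (x i)))"
    by (intro Bochner_Integration.integral_cong refl) (simp add: exp_sum[symmetric] sum_distrib_left)
  also have "\<dots> = (\<Prod>i<n. CLINT y|M. iexp (t * F y))"
    by (intro P.product_integral_prod[where f="\<lambda>_ y. iexp (t * F y)"])
       (auto intro!: M.integrable_const_bound[of _ 1])
  also have "\<dots> = char (distr M borel F) t ^ n"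
    unfolding char_def by (subst integral_distr) auto
  finally show ?thesis .
qed

text \<open>The logarithm is compared with the power \<open>\<alpha> / 6\<close>, so that its cube
  costs \<open>\<alpha> / 2\<close>: against a density of order \<open>x powr (\<alpha> - 1)\<close>
  this leaves \<open>x powr (\<alpha> / 2 - 1)\<close>, still integrable at 0.\<close>

lemma abs_ln_cube_le_near_0:
  assumes "\<alpha> > 0" "0 < x" "x < (1::real)"
  shows "\<bar>ln x\<bar> ^ 3 \<le> (6 / \<alpha>) ^ 3 * x powr (- \<alpha> / 2)"
proof -
  have "ln (x powr (- \<alpha> / 6)) \<le> x powr (- \<alpha> / 6)" using assms by (intro ln_bound) auto
  then have "\<bar>ln x\<bar> \<le> (6 / \<alpha>) * x powr (- \<alpha> / 6)"
    using assms by (simp add: ln_powr field_simps)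
  then have "\<bar>ln x\<bar> ^ 3 \<le> ((6 / \<alpha>) * x powr (- \<alpha> / 6)) ^ 3" by (intro power_mono) auto
  also have "\<dots> = (6 / \<alpha>) ^ 3 * x powr (- \<alpha> / 2)"
    unfolding power_mult_distrib using assms by (simp add: powr_power)
  finally show ?thesis .
qed

text \<open>The exponent \<open>2 / 3\<close> is chosen so that the cube is
  \<open>x\<^sup>2\<close>, whose mean under the fading law is 1.\<close>

lemma abs_ln_cube_le_at_top:
  assumes "1 \<le> (x::real)"
  shows "\<bar>ln x\<bar> ^ 3 \<le> 27 / 8 * x\<^sup>2"
proof -
  have "ln (x powr (2 / 3)) \<le> x powr (2 / 3)" using assms by (intro ln_bound) auto
  then have "\<bar>ln x\<bar> \<le> 3 / 2 * x powr (2 / 3)" using assms by (simp add: ln_powr field_simps)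
  then have "\<bar>ln x\<bar> ^ 3 \<le> (3 / 2 * x powr (2 / 3)) ^ 3" by (intro power_mono) auto
  also have "\<dots> = 27 / 8 * x\<^sup>2"
  proof -
    have "(x powr (2 / 3)) ^ 3 = x\<^sup>2" using assms by (simp add: powr_power)
    then show ?thesis by (simp add: power_mult_distrib power_divide)
  qed
  finally show ?thesis .
qed

text \<open>Three regimes: below \<open>h1\<close> the power law of the density beats the logarithm,
  between \<open>h1\<close> and 1 the logarithm is bounded, and above 1 the second moment
  dominates.\<close>

lemma integrable_fading_ln_cube:
  assumes f: "regular_fading_pdf f"
  shows "integrable (fading_dist f) (\<lambda>x. \<bar>ln (x\<^sup>2) / 2\<bar> ^ 3)"
proof -
  from f obtain \<alpha> c h0 where [measurable]: "f \<in> borel_measurable borel" and fnn: "\<And>x. 0 \<le> f x" and fneg: "\<And>x. x < 0 \<Longrightarrow> f x = 0"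
    and f1: "(\<integral>\<^sup>+ x. ennreal (f x) \<partial>lborel) = 1" and f2: "(\<integral>\<^sup>+ x. ennreal (x\<^sup>2 * f x) \<partial>lborel) = 1"
    and ac: "\<alpha> > 0" "c > 0" "h0 > 0" and reg: "\<And>x. 0 < x \<Longrightarrow> x < h0 \<Longrightarrow> f x = c * x powr (\<alpha> - 1)"
    unfolding regular_fading_pdf_def by blast
  define h1 where "h1 = min h0 1"
  have h1: "0 < h1" "h1 \<le> h0" "h1 \<le> 1" using ac by (auto simp: h1_def)
  define K where "K = c * (6 / \<alpha>) ^ 3"
  define L where "L = \<bar>ln h1\<bar> ^ 3"
  have K: "K \<ge> 0" and L: "L \<ge> 0" using ac by (auto simp: K_def L_def)
  let ?p = "\<lambda>x. indicator {0..h1} x * x powr (\<alpha> / 2 - 1)"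
  have bound: "f x * \<bar>ln (x\<^sup>2) / 2\<bar> ^ 3 \<le> K * ?p x + L * f x + 27 / 8 * (x\<^sup>2 * f x)" for x
  proof (cases "x > 0")
    case True
    have ln: "ln (x\<^sup>2) / 2 = ln x" using True by (simp add: ln_realpow)
    show ?thesis
    proof (cases "x < h1")
      case x: True
      have "f x * \<bar>ln x\<bar> ^ 3 \<le> (c * x powr (\<alpha> - 1)) * ((6 / \<alpha>) ^ 3 * x powr (- \<alpha> / 2))"
        using abs_ln_cube_le_near_0[of \<alpha> x] True x h1 ac reg[of x] by (intro mult_mono) auto
      also have "\<dots> = K * ?p x"
        using True x by (simp add: K_def powr_add[symmetric] mult_ac)
      also have "\<dots> \<le> K * ?p x + L * f x + 27 / 8 * (x\<^sup>2 * f x)" using fnn L by simp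
      finally show ?thesis unfolding ln .
    next
      case x: False
      have "\<bar>ln x\<bar> ^ 3 \<le> L + 27 / 8 * x\<^sup>2"
      proof (cases "x \<le> 1")
        case True
        then have "\<bar>ln x\<bar> \<le> \<bar>ln h1\<bar>" using x h1 by simp
        then have "\<bar>ln x\<bar> ^ 3 \<le> L" unfolding L_def by (intro power_mono) auto
        moreover have "0 \<le> 27 / 8 * x\<^sup>2" by simp
        ultimately show ?thesis by linarith
      next
        case False
        then show ?thesis using abs_ln_cube_le_at_top[of x] L by simp
      qed
      then have "f x * \<bar>ln x\<bar> ^ 3 \<le> f x * (L + 27 / 8 * x\<^sup>2)" using fnn by (rule mult_left_mono)
      also have "\<dots> = L * f x + 27 / 8 * (x\<^sup>2 * f x)" by (simp add: algebra_simps)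
      also have "\<dots> \<le> K * ?p x + L * f x + 27 / 8 * (x\<^sup>2 * f x)" using K by simp
      finally show ?thesis unfolding ln .
    qed
  next
    case False
    have nn: "0 \<le> K * ?p x + L * f x + 27 / 8 * (x\<^sup>2 * f x)" using K L fnn by (intro add_nonneg_nonneg mult_nonneg_nonneg) auto
    show ?thesis
    proof (cases "x = 0")
      case True
      \<comment> \<open>The convention \<open>ln 0 = 0\<close> decides this point, whatever the
        value of \<open>f\<close> there.\<close>
      then have "f x * \<bar>ln (x\<^sup>2) / 2\<bar> ^ 3 = 0" by simp
      with nn show ?thesis by linarith
    next
      case x: False
      with False have "f x = 0" by (intro fneg) auto
      with nn show ?thesis by simp
    qed
  qed
  have "((\<lambda>x. x powr (\<alpha> / 2 - 1)) has_integral (h1 powr (\<alpha> / 2 - 1 + 1) / (\<alpha> / 2 - 1 + 1))) {0..h1}"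
    using ac h1 by (intro has_integral_powr_from_0) auto
  from nn_integral_has_integral_lebesgue[OF _ this]
  have p: "(\<integral>\<^sup>+x. ennreal (?p x) \<partial>lborel) < \<top>" by simp
  have "(\<integral>\<^sup>+x. ennreal (f x * \<bar>ln (x\<^sup>2) / 2\<bar> ^ 3) \<partial>lborel)
      \<le> (\<integral>\<^sup>+x. ennreal (K * ?p x) + ennreal (L * f x) + ennreal (27 / 8 * (x\<^sup>2 * f x)) \<partial>lborel)"
  proof (rule nn_integral_mono)
    fix x
    have "0 \<le> K * ?p x" "0 \<le> L * f x" "0 \<le> 27 / 8 * (x\<^sup>2 * f x)" using K L fnn by simp_all
    then have "ennreal (K * ?p x) + ennreal (L * f x) + ennreal (27 / 8 * (x\<^sup>2 * f x))
      = ennreal (K * ?p x + L * f x + 27 / 8 * (x\<^sup>2 * f x))"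
      by (simp only: ennreal_plus add_nonneg_nonneg simp_thms)
    with ennreal_leI[OF bound[of x]]
    show "ennreal (f x * \<bar>ln (x\<^sup>2) / 2\<bar> ^ 3) \<le> ennreal (K * ?p x) + ennreal (L * f x) + ennreal (27 / 8 * (x\<^sup>2 * f x))"
      by (simp only:)
  qed
  also have "\<dots> = ennreal K * (\<integral>\<^sup>+x. ennreal (?p x) \<partial>lborel) + ennreal L * (\<integral>\<^sup>+x. ennreal (f x) \<partial>lborel)
      + ennreal (27 / 8) * (\<integral>\<^sup>+x. ennreal (x\<^sup>2 * f x) \<partial>lborel)"
  proof -
    have m: "(\<integral>\<^sup>+x. ennreal (a * u x) \<partial>lborel) = ennreal a * (\<integral>\<^sup>+x. ennreal (u x) \<partial>lborel)"
      if "a \<ge> 0" "u \<in> borel_measurable borel" for a :: real and u :: "real \<Rightarrow> real"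
      unfolding ennreal_mult'[OF that(1)] using that(2) by (intro nn_integral_cmult) simp
    have "(\<integral>\<^sup>+x. ennreal (K * ?p x) + ennreal (L * f x) + ennreal (27 / 8 * (x\<^sup>2 * f x)) \<partial>lborel)
      = (\<integral>\<^sup>+x. ennreal (K * ?p x) \<partial>lborel) + (\<integral>\<^sup>+x. ennreal (L * f x) \<partial>lborel) + (\<integral>\<^sup>+x. ennreal (27 / 8 * (x\<^sup>2 * f x)) \<partial>lborel)"
      by (subst nn_integral_add, measurable, subst nn_integral_add) measurable
    also have "(\<integral>\<^sup>+x. ennreal (K * ?p x) \<partial>lborel) = ennreal K * (\<integral>\<^sup>+x. ennreal (?p x) \<partial>lborel)"
      by (rule m[OF K]) measurable
    also have "(\<integral>\<^sup>+x. ennreal (L * f x) \<partial>lborel) = ennreal L * (\<integral>\<^sup>+x. ennreal (f x) \<partial>lborel)"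
      by (rule m[OF L]) measurable
    also have "(\<integral>\<^sup>+x. ennreal (27 / 8 * (x\<^sup>2 * f x)) \<partial>lborel) = ennreal (27 / 8) * (\<integral>\<^sup>+x. ennreal (x\<^sup>2 * f x) \<partial>lborel)"
      by (rule m) (simp, measurable)
    finally show ?thesis .
  qed
  also have "\<dots> < \<top>" unfolding f1 f2 using p by (auto simp: ennreal_mult_less_top)
  finally have "integrable lborel (\<lambda>x. f x * \<bar>ln (x\<^sup>2) / 2\<bar> ^ 3)"
    using fnn by (intro integrableI_nonneg) auto
  then show ?thesis
    unfolding fading_dist_def using fnn by (subst integrable_density) auto
qed

text \<open>\<open>inf_dens \<sigma> h z\<close> is \<open>- ln (p z * h)\<close> for the noise density \<open>p\<close>; its mean is \<open>- delta_star\<close> and its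
  variance is \<open>fading_V\<close>.\<close>

definition inf_dens :: "real \<Rightarrow> real \<Rightarrow> real \<Rightarrow> real" where
  "inf_dens \<sigma> a b = b\<^sup>2 / (2 * \<sigma>\<^sup>2) + ln (2 * pi * \<sigma>\<^sup>2) / 2 - ln (a\<^sup>2) / 2"

definition inf_sum :: "real \<Rightarrow> nat \<Rightarrow> (nat \<Rightarrow> real) \<Rightarrow> (nat \<Rightarrow> real) \<Rightarrow> real" where
  "inf_sum \<sigma> n h z = (\<Sum>i<n. inf_dens \<sigma> (h i) (z i))"

lemma abs_diff_cube_le: "\<bar>a - b\<bar> ^ 3 \<le> 8 * (\<bar>a\<bar> ^ 3 + \<bar>b\<bar> ^ 3)" for a b :: real
proof -
  have "\<bar>a - b\<bar> ^ 3 \<le> (2 * max \<bar>a\<bar> \<bar>b\<bar>) ^ 3" by (intro power_mono) auto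
  also have "\<dots> = 8 * max (\<bar>a\<bar> ^ 3) (\<bar>b\<bar> ^ 3)"
    by (auto simp: power_mult_distrib max_def power_mono_iff)
  also have "\<dots> \<le> 8 * (\<bar>a\<bar> ^ 3 + \<bar>b\<bar> ^ 3)" by (simp add: max_def)
  finally show ?thesis .
qed

lemma fading_ln_moments:
  assumes f: "regular_fading_pdf f"
  defines "m \<equiv> (\<integral>x. ln (x\<^sup>2) / 2 \<partial>fading_dist f)"
  shows "integrable (fading_dist f) (\<lambda>x. ln (x\<^sup>2) / 2)"
    and "integrable (fading_dist f) (\<lambda>x. \<bar>m - ln (x\<^sup>2) / 2\<bar> ^ 3)"
    and "(\<integral>x. m - ln (x\<^sup>2) / 2 \<partial>fading_dist f) = 0"
    and "fading_V f = 1 / 2 + (\<integral>x. (m - ln (x\<^sup>2) / 2)\<^sup>2 \<partial>fading_dist f)"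
proof -
  interpret prob_space "fading_dist f" using f by (rule prob_space_fading_dist)
  note i3 = integrable_fading_ln_cube[OF f]
  have le: "y \<le> 1 + y ^ 3" if "y \<ge> 0" for y :: real
  proof (cases "y \<le> 1")
    case True
    moreover have "0 \<le> y ^ 3" using that by simp
    ultimately show ?thesis by linarith
  next
    case False
    then have "y ^ 1 \<le> y ^ 3" by (intro power_increasing) auto
    then show ?thesis by simp
  qed
  show i1: "integrable (fading_dist f) (\<lambda>x. ln (x\<^sup>2) / 2)"
  proof (rule Bochner_Integration.integrable_bound)
    show "integrable (fading_dist f) (\<lambda>x. 1 + \<bar>ln (x\<^sup>2) / 2\<bar> ^ 3)" using i3 by simp
    show "AE x in fading_dist f. norm (ln (x\<^sup>2) / 2) \<le> norm (1 + \<bar>ln (x\<^sup>2) / 2\<bar> ^ 3)"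
    proof (rule AE_I2)
      fix x :: real
      have "\<bar>ln (x\<^sup>2) / 2\<bar> \<le> 1 + \<bar>ln (x\<^sup>2) / 2\<bar> ^ 3" by (rule le) simp
      then show "norm (ln (x\<^sup>2) / 2) \<le> norm (1 + \<bar>ln (x\<^sup>2) / 2\<bar> ^ 3)"
        unfolding real_norm_def by linarith
    qed
  qed measurable
  show "integrable (fading_dist f) (\<lambda>x. \<bar>m - ln (x\<^sup>2) / 2\<bar> ^ 3)"
  proof (rule Bochner_Integration.integrable_bound)
    show "integrable (fading_dist f) (\<lambda>x. 8 * (\<bar>m\<bar> ^ 3 + \<bar>ln (x\<^sup>2) / 2\<bar> ^ 3))" using i3 by simp
    show "AE x in fading_dist f. norm (\<bar>m - ln (x\<^sup>2) / 2\<bar> ^ 3) \<le> norm (8 * (\<bar>m\<bar> ^ 3 + \<bar>ln (x\<^sup>2) / 2\<bar> ^ 3))"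
    proof (rule AE_I2)
      fix x :: real
      have "norm (\<bar>m - ln (x\<^sup>2) / 2\<bar> ^ 3) = \<bar>m - ln (x\<^sup>2) / 2\<bar> ^ 3" by simp
      with abs_diff_cube_le[of m "ln (x\<^sup>2) / 2"]
      show "norm (\<bar>m - ln (x\<^sup>2) / 2\<bar> ^ 3) \<le> norm (8 * (\<bar>m\<bar> ^ 3 + \<bar>ln (x\<^sup>2) / 2\<bar> ^ 3))"
        unfolding real_norm_def by linarith
    qed
  qed measurable
  show "(\<integral>x. m - ln (x\<^sup>2) / 2 \<partial>fading_dist f) = 0"
    using i1 by (subst Bochner_Integration.integral_diff) (simp_all add: m_def prob_space[simplified])
  show "fading_V f = 1 / 2 + (\<integral>x. (m - ln (x\<^sup>2) / 2)\<^sup>2 \<partial>fading_dist f)"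
    unfolding fading_V_def Let_def m_def[symmetric] by (simp add: power2_commute)
qed

text \<open>The quadratic noise term is half the square of a standard normal variable; its variance
  is the summand \<open>1 / 2\<close> of \<open>fading_V\<close>.\<close>

lemma gauss_square_moments:
  assumes s: "\<sigma> > 0"
  shows "(\<integral>x. x\<^sup>2 / (2 * \<sigma>\<^sup>2) - 1 / 2 \<partial>gauss \<sigma>) = 0"
    and "(\<integral>x. (x\<^sup>2 / (2 * \<sigma>\<^sup>2) - 1 / 2)\<^sup>2 \<partial>gauss \<sigma>) = 1 / 2"
    and "integrable (gauss \<sigma>) (\<lambda>x. \<bar>x\<^sup>2 / (2 * \<sigma>\<^sup>2) - 1 / 2\<bar> ^ 3)"
proof -
  interpret prob_space "gauss \<sigma>" using s by (rule prob_space_gauss)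
  have mom: "has_bochner_integral (gauss \<sigma>) (\<lambda>x. x ^ (2 * k)) (fact (2 * k) / ((2 / \<sigma>\<^sup>2)^k * fact k))" for k
  proof -
    have "has_bochner_integral lborel (\<lambda>x. normal_density 0 \<sigma> x *\<^sub>R x ^ (2 * k)) (fact (2 * k) / ((2 / \<sigma>\<^sup>2)^k * fact k))"
      using normal_moment_even[OF s, of 0 k] by simp
    then show ?thesis
      unfolding gauss_def by (intro has_bochner_integral_density) auto
  qed
  have m2: "has_bochner_integral (gauss \<sigma>) (\<lambda>x. x\<^sup>2) (\<sigma>\<^sup>2)"
    using mom[of 1] by simp
  have m4: "has_bochner_integral (gauss \<sigma>) (\<lambda>x. x ^ 4) (3 * \<sigma> ^ 4)"
    using mom[of 2] by (simp add: fact_numeral power_divide power_mult[symmetric])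
  have i6: "integrable (gauss \<sigma>) (\<lambda>x. x ^ 6)"
    using mom[of 3] by (simp add: has_bochner_integral_iff)
  have c: "has_bochner_integral (gauss \<sigma>) (\<lambda>x. c) c" for c :: real
    using prob_space by (simp add: has_bochner_integral_iff)
  have "has_bochner_integral (gauss \<sigma>) (\<lambda>x. x\<^sup>2 * (1 / (2 * \<sigma>\<^sup>2)) - 1 / 2) (\<sigma>\<^sup>2 * (1 / (2 * \<sigma>\<^sup>2)) - 1 / 2)"
    by (intro has_bochner_integral_diff has_bochner_integral_mult_left m2 c)
  then show "(\<integral>x. x\<^sup>2 / (2 * \<sigma>\<^sup>2) - 1 / 2 \<partial>gauss \<sigma>) = 0"
    using s by (simp add: has_bochner_integral_iff)
  have "has_bochner_integral (gauss \<sigma>) (\<lambda>x. x ^ 4 * (1 / (4 * \<sigma> ^ 4)) - x\<^sup>2 * (1 / (2 * \<sigma>\<^sup>2)) + 1 / 4)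
     (3 * \<sigma> ^ 4 * (1 / (4 * \<sigma> ^ 4)) - \<sigma>\<^sup>2 * (1 / (2 * \<sigma>\<^sup>2)) + 1 / 4)"
    by (intro has_bochner_integral_diff has_bochner_integral_add has_bochner_integral_mult_left m2 m4 c)
  also have "(\<lambda>x. x ^ 4 * (1 / (4 * \<sigma> ^ 4)) - x\<^sup>2 * (1 / (2 * \<sigma>\<^sup>2)) + 1 / 4) = (\<lambda>x. (x\<^sup>2 / (2 * \<sigma>\<^sup>2) - 1 / 2)\<^sup>2)"
  proof
    fix x :: real
    have "x ^ 4 * (1 / (4 * \<sigma> ^ 4)) = (x\<^sup>2 / (2 * \<sigma>\<^sup>2))\<^sup>2"
      by (simp add: power_divide power_mult_distrib power_mult[symmetric])
    then show "x ^ 4 * (1 / (4 * \<sigma> ^ 4)) - x\<^sup>2 * (1 / (2 * \<sigma>\<^sup>2)) + 1 / 4 = (x\<^sup>2 / (2 * \<sigma>\<^sup>2) - 1 / 2)\<^sup>2"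
      by (simp add: power2_diff power_divide)
  qed
  also have "3 * \<sigma> ^ 4 * (1 / (4 * \<sigma> ^ 4)) - \<sigma>\<^sup>2 * (1 / (2 * \<sigma>\<^sup>2)) + 1 / 4 = 1 / 2"
    using s by simp
  finally show "(\<integral>x. (x\<^sup>2 / (2 * \<sigma>\<^sup>2) - 1 / 2)\<^sup>2 \<partial>gauss \<sigma>) = 1 / 2"
    by (rule has_bochner_integral_integral_eq)
  show "integrable (gauss \<sigma>) (\<lambda>x. \<bar>x\<^sup>2 / (2 * \<sigma>\<^sup>2) - 1 / 2\<bar> ^ 3)"
  proof (rule Bochner_Integration.integrable_bound)
    show "integrable (gauss \<sigma>) (\<lambda>x. 8 * (x ^ 6 / (2 * \<sigma>\<^sup>2) ^ 3 + 1 / 8))" using i6 by simp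
    show "AE x in gauss \<sigma>. norm (\<bar>x\<^sup>2 / (2 * \<sigma>\<^sup>2) - 1 / 2\<bar> ^ 3) \<le> norm (8 * (x ^ 6 / (2 * \<sigma>\<^sup>2) ^ 3 + 1 / 8))"
    proof (rule AE_I2)
      fix x :: real
      have "\<bar>x\<^sup>2 / (2 * \<sigma>\<^sup>2)\<bar> ^ 3 = x ^ 6 / (2 * \<sigma>\<^sup>2) ^ 3"
        by (simp add: power_divide power_mult[symmetric])
      moreover have "\<bar>1 / 2 :: real\<bar> ^ 3 = 1 / 8" by (simp add: power3_eq_cube)
      ultimately have "\<bar>x\<^sup>2 / (2 * \<sigma>\<^sup>2) - 1 / 2\<bar> ^ 3 \<le> 8 * (x ^ 6 / (2 * \<sigma>\<^sup>2) ^ 3 + 1 / 8)"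
        using abs_diff_cube_le[of "x\<^sup>2 / (2 * \<sigma>\<^sup>2)" "1 / 2"] by (simp only:)
      also have "\<dots> \<le> norm (8 * (x ^ 6 / (2 * \<sigma>\<^sup>2) ^ 3 + 1 / 8))"
        unfolding real_norm_def by (rule abs_ge_self)
      finally show "norm (\<bar>x\<^sup>2 / (2 * \<sigma>\<^sup>2) - 1 / 2\<bar> ^ 3) \<le> norm (8 * (x ^ 6 / (2 * \<sigma>\<^sup>2) ^ 3 + 1 / 8))"
        by (simp only: real_norm_def power_abs abs_abs)
    qed
  qed measurable
qed

text \<open>Splitting the logarithm needs \<open>x \<noteq> 0\<close>, so it is done almost
  everywhere. The \<open>+ 1\<close> is \<open>ln (exp 1)\<close> and matches the mean
  \<open>1 / 2\<close> of the quadratic noise term in \<open>inf_dens\<close>.\<close>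

lemma delta_star_eq:
  assumes f: "regular_fading_pdf f" and s: "\<sigma> > 0"
  shows "delta_star f \<sigma> = (\<integral>x. ln (x\<^sup>2) / 2 \<partial>fading_dist f) - (ln (2 * pi * \<sigma>\<^sup>2) + 1) / 2"
proof -
  interpret prob_space "fading_dist f" using f by (rule prob_space_fading_dist)
  have pos: "AE x in fading_dist f. x \<noteq> 0"
    using f unfolding fading_dist_def regular_fading_pdf_def
    by (subst AE_density) (auto intro: AE_mp[OF AE_lborel_singleton[of 0]])
  have "delta_star f \<sigma> = (\<integral>x. ln (x\<^sup>2) / 2 - (ln (2 * pi * \<sigma>\<^sup>2) + 1) / 2 \<partial>fading_dist f)"
    unfolding delta_star_def
  proof (rule integral_cong_AE)
    show "AE x in fading_dist f. ln (x\<^sup>2 / (2 * pi * exp 1 * \<sigma>\<^sup>2)) / 2 = ln (x\<^sup>2) / 2 - (ln (2 * pi * \<sigma>\<^sup>2) + 1) / 2"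
      using pos
    proof eventually_elim
      case (elim x)
      have "ln (x\<^sup>2 / (2 * pi * exp 1 * \<sigma>\<^sup>2)) = ln (x\<^sup>2) - ln ((2 * pi * \<sigma>\<^sup>2) * exp 1)"
        using elim s by (subst ln_div) (auto simp: mult_ac)
      also have "ln ((2 * pi * \<sigma>\<^sup>2) * exp 1) = ln (2 * pi * \<sigma>\<^sup>2) + 1"
        using s by (subst ln_mult) auto
      finally show ?case by (simp only: diff_divide_distrib)
    qed
  qed measurable
  also have "\<dots> = (\<integral>x. ln (x\<^sup>2) / 2 \<partial>fading_dist f) - (ln (2 * pi * \<sigma>\<^sup>2) + 1) / 2"
    using fading_ln_moments(1)[OF f] by (subst Bochner_Integration.integral_diff) (simp_all add: prob_space[simplified])
  finally show ?thesis .
qed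

lemma inf_sum_measurable:
  assumes M: "sets M = sets (LB n)" and N: "sets N = sets (LB n)"
  shows "(\<lambda>p. inf_sum \<sigma> n (fst p) (snd p)) \<in> borel_measurable (M \<Otimes>\<^sub>M N)"
proof -
  note [measurable_cong] = M N
  show ?thesis unfolding inf_sum_def inf_dens_def by measurable
qed

abbreviation inf_cdf :: "(real \<Rightarrow> real) \<Rightarrow> real \<Rightarrow> nat \<Rightarrow> real \<Rightarrow> real" where
  "inf_cdf f \<sigma> n x \<equiv> measure (chan f \<sigma> n) {p \<in> space (chan f \<sigma> n). inf_sum \<sigma> n (fst p) (snd p) \<le> x}"

text \<open>Up to the constant \<open>delta_star\<close>, each summand is a centred function
  \<open>A\<close> of the fade plus a centred function \<open>B\<close> of the noise. Independence
  makes its characteristic function the product \<open>\<phi>\<close> and adds the variances to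
  \<open>fading_V\<close>, after which the normal approximation applies to powers of
  \<open>\<phi>\<close>.\<close>

lemma inf_sum_cdf_bounds:
  assumes f: "regular_fading_pdf f" and s: "\<sigma> > 0"
  obtains C where "C \<ge> 0"
    "\<And>n x. n \<ge> 2 \<Longrightarrow> inf_cdf f \<sigma> n x
      \<le> \<Phi> ((x + real n * delta_star f \<sigma> + C * ln (real n)) / sqrt (real n * fading_V f)) + C / sqrt (real n)"
    "\<And>n x. n \<ge> 2 \<Longrightarrow> \<Phi> ((x + real n * delta_star f \<sigma> - C * ln (real n)) / sqrt (real n * fading_V f)) - C / sqrt (real n)
      \<le> inf_cdf f \<sigma> n x"
proof -
  define m where "m = (\<integral>x. ln (x\<^sup>2) / 2 \<partial>fading_dist f)"
  define A where "A = (\<lambda>x::real. m - ln (x\<^sup>2) / 2)"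
  define B where "B = (\<lambda>x::real. x\<^sup>2 / (2 * \<sigma>\<^sup>2) - 1 / 2)"
  interpret F: prob_space "fading_dist f" using f by (rule prob_space_fading_dist)
  interpret N: prob_space "gauss \<sigma>" using s by (rule prob_space_gauss)
  have [measurable]: "A \<in> borel_measurable borel" "B \<in> borel_measurable borel"
    unfolding A_def B_def by measurable
  define vA where "vA = F.expectation (\<lambda>x. (A x)\<^sup>2)"
  define KA where "KA = F.expectation (\<lambda>x. \<bar>A x\<bar> ^ 3)"
  define KB where "KB = N.expectation (\<lambda>x. \<bar>B x\<bar> ^ 3)"
  have nn: "vA \<ge> 0" "KA \<ge> 0" "KB \<ge> 0"
    unfolding vA_def KA_def KB_def by (intro integral_nonneg_AE; simp)+
  note fm = fading_ln_moments[OF f, folded m_def, folded A_def]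
  note gm = gauss_square_moments[OF s, folded B_def]
  have V: "fading_V f = vA + 1 / 2" using fm(4) by (simp add: vA_def A_def)
  define \<phi> where "\<phi> t = char (distr (fading_dist f) borel A) t * char (distr (gauss \<sigma>) borel B) t" for t
  have rdA: "real_distribution (distr (fading_dist f) borel A)" by (rule F.real_distribution_distr) measurable
  have rdB: "real_distribution (distr (gauss \<sigma>) borel B)" by (rule N.real_distribution_distr) measurable
  note le1 = real_distribution.cmod_char_le_1[OF rdA] real_distribution.cmod_char_le_1[OF rdB]
  have appr: "cmod (\<phi> t - of_real (1 - t\<^sup>2 * fading_V f / 2)) \<le> (KA + (1 + vA) * KB + vA * (1 / 2) + 2 + vA + 1 / 2) * \<bar>t\<bar> ^ 3" for t
    unfolding \<phi>_def V
  proof (rule cubic_approx_mult[OF le1])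
    show "cmod (char (distr (fading_dist f) borel A) t - of_real (1 - t\<^sup>2 * vA / 2)) \<le> KA * \<bar>t\<bar> ^ 3"
      unfolding vA_def KA_def using fm by (intro F.char_approx_cubic) (auto simp: A_def)
    have "cmod (char (distr (gauss \<sigma>) borel B) t - of_real (1 - t\<^sup>2 * N.expectation (\<lambda>x. (B x)\<^sup>2) / 2)) \<le> KB * \<bar>t\<bar> ^ 3"
      unfolding KB_def using gm by (intro N.char_approx_cubic) (auto simp: B_def)
    moreover have "N.expectation (\<lambda>x. (B x)\<^sup>2) = 1 / 2" using gm(2) by (simp add: B_def)
    ultimately show "cmod (char (distr (gauss \<sigma>) borel B) t - of_real (1 - t\<^sup>2 * (1 / 2) / 2)) \<le> KB * \<bar>t\<bar> ^ 3"
      by (simp only:)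
  qed (use nn in auto)
  have \<phi>1: "cmod (\<phi> t) \<le> 1" for t
    unfolding \<phi>_def norm_mult using le1 by (simp add: mult_le_one)
  obtain C where C: "C \<ge> 0"
    and up: "\<And>n N x. n \<ge> 2 \<Longrightarrow> real_distribution N \<Longrightarrow> (\<And>t. char N t = \<phi> t ^ n) \<Longrightarrow>
        cdf N x \<le> \<Phi> ((x + C * ln (real n)) / sqrt (real n * fading_V f)) + C / sqrt (real n)"
    and lo: "\<And>n N x. n \<ge> 2 \<Longrightarrow> real_distribution N \<Longrightarrow> (\<And>t. char N t = \<phi> t ^ n) \<Longrightarrow>
        \<Phi> ((x - C * ln (real n)) / sqrt (real n * fading_V f)) - C / sqrt (real n) \<le> cdf N x"
    by (rule berry_esseen_log[OF _ _ appr \<phi>1]) (use nn V in auto)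
  \<comment> \<open>In \<open>chan\<close> all fades come before all noise samples, so the sum is
    split accordingly; the two \<open>n\<close>-th powers recombine to
    \<open>\<phi> t ^ n\<close>.\<close>
  define T where "T n p = (\<Sum>i<n. A (fst p i)) + (\<Sum>i<n. B (snd p i))" for n and p :: "(nat \<Rightarrow> real) \<times> (nat \<Rightarrow> real)"
  have T: "inf_sum \<sigma> n (fst p) (snd p) + real n * delta_star f \<sigma> = T n p" for n p
  proof -
    have "inf_dens \<sigma> a b = A a + B b - delta_star f \<sigma>" for a b
      unfolding inf_dens_def A_def B_def delta_star_eq[OF f s] m_def[symmetric] by (simp add: field_simps)
    then show ?thesis unfolding inf_sum_def T_def by (simp add: sum.distrib sum_subtractf)
  qed
  define L where "L n = distr (chan f \<sigma> n) borel (T n)" for n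
  have mA: "(\<lambda>x. \<Sum>i<n. A (x i)) \<in> borel_measurable (fading_vec f n)" for n
    by measurable
  have mB: "(\<lambda>x. \<Sum>i<n. B (x i)) \<in> borel_measurable (noise_vec \<sigma> n)" for n
    by measurable
  have mT[measurable]: "T n \<in> borel_measurable (chan f \<sigma> n)" for n
    unfolding T_def chan_def using mA[of n] mB[of n] by measurable
  have rdL: "real_distribution (L n)" for n
  proof -
    interpret prob_space "chan f \<sigma> n" using f s by (rule prob_space_chan)
    show ?thesis unfolding L_def by (rule real_distribution_distr) measurable
  qed
  have chL: "char (L n) t = \<phi> t ^ n" for n t
    unfolding L_def T_def chan_def
    by (subst char_distr_pair_add[OF prob_space_fading_vec[OF f] prob_space_noise_vec[OF s] mA mB])
       (simp add: fading_vec_def noise_vec_eq char_distr_PiM_sum F.prob_space_axioms N.prob_space_axioms \<phi>_def power_mult_distrib)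
  have cdfL: "cdf (L n) (x + real n * delta_star f \<sigma>) = inf_cdf f \<sigma> n x" for n x
    unfolding L_def cdf_def
    by (subst measure_distr) (auto simp: T[symmetric] intro!: arg_cong[where f="measure (chan f \<sigma> n)"])
  show ?thesis
    by (rule that[OF C]) (use up[OF _ rdL chL] lo[OF _ rdL chL] in \<open>simp_all only: cdfL[symmetric]\<close>)
qed

section \<open>Converse and achievability\<close>

lemma noise_vec_density:
  "\<sigma> > 0 \<Longrightarrow> noise_vec \<sigma> n = density (LB n) (\<lambda>z. ennreal (\<Prod>i<n. normal_density 0 \<sigma> (z i)))"
proof (rule sym)
  assume s: "\<sigma> > 0"
  interpret G: product_sigma_finite "\<lambda>_::nat. gauss \<sigma>"
    using prob_space_gauss[OF s] by (auto simp: product_sigma_finite_def prob_space_imp_sigma_finite)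
  show "density (LB n) (\<lambda>z. ennreal (\<Prod>i<n. normal_density 0 \<sigma> (z i))) = noise_vec \<sigma> n"
    unfolding noise_vec_eq
  proof (rule G.PiM_eqI)
    show "sets (density (LB n) (\<lambda>z. ennreal (\<Prod>i<n. normal_density 0 \<sigma> (z i)))) = sets (PiM {..<n} (\<lambda>_. gauss \<sigma>))"
      using sets_noise_vec[of \<sigma> n] by (simp add: noise_vec_eq)
    fix A :: "nat \<Rightarrow> real set" assume A: "\<And>i. i \<in> {..<n} \<Longrightarrow> A i \<in> sets (gauss \<sigma>)"
    then have [measurable]: "PiE {..<n} A \<in> sets (LB n)" by (intro sets_PiM_I_finite) auto
    have "emeasure (density (LB n) (\<lambda>z. ennreal (\<Prod>i<n. normal_density 0 \<sigma> (z i)))) (PiE {..<n} A)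
      = (\<integral>\<^sup>+z. ennreal (\<Prod>i<n. normal_density 0 \<sigma> (z i)) * indicator (PiE {..<n} A) z \<partial>LB n)"
      by (rule emeasure_density) measurable
    also have "\<dots> = (\<integral>\<^sup>+z. (\<Prod>i<n. ennreal (normal_density 0 \<sigma> (z i)) * indicator (A i) (z i)) \<partial>LB n)"
    proof (rule nn_integral_cong)
      fix z assume z: "z \<in> space (LB n)"
      have "indicator (PiE {..<n} A) z = (\<Prod>i<n. indicator (A i) (z i) :: ennreal)"
      proof (cases "z \<in> PiE {..<n} A")
        case False
        then obtain i where i: "i < n" "z i \<notin> A i" using z by (auto simp: space_PiM PiE_iff)
        then have "(\<Prod>i<n. indicator (A i) (z i) :: ennreal) = 0"
          by (intro prod_zero bexI[of _ i]) auto
        then show ?thesis using False by simp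
      qed (auto simp: PiE_iff intro!: prod.neutral[symmetric])
      then show "ennreal (\<Prod>i<n. normal_density 0 \<sigma> (z i)) * indicator (PiE {..<n} A) z = (\<Prod>i<n. ennreal (normal_density 0 \<sigma> (z i)) * indicator (A i) (z i))"
        by (simp add: prod.distrib prod_ennreal)
    qed
    also have "\<dots> = (\<Prod>i<n. \<integral>\<^sup>+x. ennreal (normal_density 0 \<sigma> x) * indicator (A i) x \<partial>lborel)"
      using A by (intro lborel_fam.product_nn_integral_prod) auto
    also have "\<dots> = (\<Prod>i\<in>{..<n}. emeasure (gauss \<sigma>) (A i))"
      using A by (intro prod.cong refl) (simp add: gauss_def emeasure_density)
    finally show "emeasure (density (LB n) (\<lambda>z. ennreal (\<Prod>i<n. normal_density 0 \<sigma> (z i)))) (PiE {..<n} A) = (\<Prod>i\<in>{..<n}. emeasure (gauss \<sigma>) (A i))" .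
  qed simp
qed

text \<open>The right side is the noise density pulled back to the transmitter side, where volume
  scales by the product of the fades. Positive fades are needed to replace
  \<open>ln (a\<^sup>2) / 2\<close> by \<open>ln a\<close>.\<close>

lemma exp_neg_inf_sum:
  assumes s: "\<sigma> > 0" and h: "\<And>i. i < n \<Longrightarrow> 0 < h i"
  shows "exp (- inf_sum \<sigma> n h z) = (\<Prod>i<n. normal_density 0 \<sigma> (z i)) * (\<Prod>i<n. h i)"
proof -
  have "exp (- inf_dens \<sigma> a b) = normal_density 0 \<sigma> b * a" if a: "a > 0" for a b
  proof -
    have "- inf_dens \<sigma> a b = - b\<^sup>2 / (2 * \<sigma>\<^sup>2) - ln (sqrt (2 * pi * \<sigma>\<^sup>2)) + ln a"
      unfolding inf_dens_def using a s by (simp add: ln_realpow ln_sqrt)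
    also have "exp \<dots> = exp (- b\<^sup>2 / (2 * \<sigma>\<^sup>2)) / exp (ln (sqrt (2 * pi * \<sigma>\<^sup>2))) * exp (ln a)"
      by (simp only: exp_add exp_diff)
    also have "\<dots> = normal_density 0 \<sigma> b * a"
      using a s by (simp add: normal_density_def)
    finally show ?thesis .
  qed
  then have "(\<Prod>i<n. exp (- inf_dens \<sigma> (h i) (z i))) = (\<Prod>i<n. normal_density 0 \<sigma> (z i) * h i)"
    using h by (intro prod.cong) auto
  then show ?thesis
    unfolding inf_sum_def by (simp add: exp_sum sum_negf[symmetric] prod.distrib)
qed

text \<open>Where the noise density is at most \<open>\<tau>\<close>, the Voronoi cell has Gaussian mass at most
  \<open>\<tau>\<close> times its volume, so no ball volumes are needed.\<close>

lemma one_minus_perr_le: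
  assumes f: "regular_fading_pdf f" and s: "\<sigma> > 0" and det: "gen_det n G \<noteq> 0" and n: "n > 0"
  shows "1 - perr f \<sigma> n G \<le> inf_cdf f \<sigma> n (ln \<bar>gen_det n G\<bar> + ln (real n) / 2) + 1 / sqrt (real n)"
proof -
  interpret F: prob_space "fading_vec f n" using f by (rule prob_space_fading_vec)
  interpret N: prob_space "noise_vec \<sigma> n" using s by (rule prob_space_noise_vec)
  interpret P: prob_space "chan f \<sigma> n" using f s by (rule prob_space_chan)
  define D where "D = \<bar>gen_det n G\<bar>"
  have D: "D > 0" using det by (simp add: D_def)
  \<comment> \<open>Solves \<open>exp (- t) * D = 1 / sqrt n\<close>, the mass conceded to the
    low-density part of the cell.\<close>
  define t where "t = ln D + ln (real n) / 2"
  have et: "exp t = D * sqrt (real n)"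
  proof -
    have "t = ln (D * sqrt (real n))" unfolding t_def using D n by (simp add: ln_mult ln_sqrt)
    then show ?thesis using D n by simp
  qed
  let ?E = "{p \<in> space (chan f \<sigma> n). err_event n G (fst p) (snd p)}"
  let ?L = "{p \<in> space (chan f \<sigma> n). inf_sum \<sigma> n (fst p) (snd p) \<le> t}"
  let ?B = "{p \<in> space (chan f \<sigma> n). \<not> err_event n G (fst p) (snd p) \<and> \<not> inf_sum \<sigma> n (fst p) (snd p) \<le> t}"
  have E: "?E \<in> P.events"
    unfolding chan_def by (rule sets_err_event[OF sets_fading_vec sets_noise_vec])
  have mS[measurable]: "(\<lambda>p. inf_sum \<sigma> n (fst p) (snd p)) \<in> borel_measurable (chan f \<sigma> n)"
    unfolding chan_def by (rule inf_sum_measurable[OF sets_fading_vec sets_noise_vec])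
  have L: "?L \<in> P.events" by measurable
  have B: "?B \<in> P.events"
  proof -
    have "?B = space (chan f \<sigma> n) - ?E - ?L" by auto
    also have "\<dots> \<in> P.events" using E L by (intro sets.Diff sets.top)
    finally show ?thesis .
  qed
  have B': "?B \<in> sets (fading_vec f n \<Otimes>\<^sub>M noise_vec \<sigma> n)" using B unfolding chan_def .
  \<comment> \<open>For fixed positive fades with product \<open>H\<close> the cell has volume at
    most \<open>H * D\<close>, and the noise density on this section is at most
    \<open>exp (- t) / H\<close>. The product \<open>H\<close> cancels, so the bound is uniform in
    \<open>h\<close>.\<close>
  have sec_le: "emeasure (noise_vec \<sigma> n) (Pair h -` ?B) \<le> ennreal (1 / sqrt (real n))"
    if h: "h \<in> space (fading_vec f n)" "\<forall>i<n. 0 < h i" for h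
  proof -
    define H where "H = (\<Prod>i<n. h i)"
    have H: "H > 0" unfolding H_def using h by (intro prod_pos) auto
    define W where "W = {z \<in> space (LB n). \<forall>k\<in>ZN n. (\<Sum>i<n. (z i)\<^sup>2) \<le> (\<Sum>i<n. (z i - (\<Sum>j<n. (h i * G i j) * real_of_int (k j)))\<^sup>2)}"
    have W[measurable]: "W \<in> sets (LB n)" unfolding W_def by (rule sets_voronoi_zero)
    have detB: "gen_det n (\<lambda>i j. h i * G i j) = H * gen_det n G" unfolding H_def by (rule gen_det_row_scale)
    have volW: "emeasure (LB n) W \<le> ennreal (H * D)"
      using emeasure_voronoi_zero_le[of n "\<lambda>i j. h i * G i j"] det H detB
      unfolding W_def[symmetric] by (simp add: abs_mult D_def)
    have mem: "z \<in> W" "(\<Prod>i<n. normal_density 0 \<sigma> (z i)) \<le> exp (- t) / H" if z: "z \<in> Pair h -` ?B" for z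
    proof -
      have zs: "z \<in> space (LB n)" using z by (auto simp: chan_def space_pair_measure space_noise_vec)
      have "\<not> err_event n G h z" using z by simp
      then show "z \<in> W"
        using zs unfolding err_event_def W_def lat_pt_def
        by (simp add: sum_distrib_left mult.assoc not_less)
      have "t < inf_sum \<sigma> n h z" using z by simp
      then have "exp (- inf_sum \<sigma> n h z) \<le> exp (- t)" by simp
      then show "(\<Prod>i<n. normal_density 0 \<sigma> (z i)) \<le> exp (- t) / H"
        using exp_neg_inf_sum[of \<sigma> n h z] s h H by (simp add: H_def[symmetric] field_simps)
    qed
    have sB: "Pair h -` ?B \<in> sets (LB n)"
      using sets_Pair1[OF B', of h] by (simp only: sets_noise_vec)
    have "emeasure (noise_vec \<sigma> n) (Pair h -` ?B)
       = (\<integral>\<^sup>+z. ennreal (\<Prod>i<n. normal_density 0 \<sigma> (z i)) * indicator (Pair h -` ?B) z \<partial>LB n)"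
      unfolding noise_vec_density[OF s] using sB by (intro emeasure_density) (auto simp: noise_vec_density[OF s])
    also have "\<dots> \<le> (\<integral>\<^sup>+z. ennreal (exp (- t) / H) * indicator W z \<partial>LB n)"
      using mem by (intro nn_integral_mono) (auto simp del: vimage_Collect_eq intro!: ennreal_leI split: split_indicator)
    also have "\<dots> = ennreal (exp (- t) / H) * emeasure (LB n) W"
      by (rule nn_integral_cmult_indicator) measurable
    also have "\<dots> \<le> ennreal (exp (- t) / H) * ennreal (H * D)"
      using volW by (rule mult_left_mono) simp
    also have "\<dots> = ennreal (1 / sqrt (real n))"
      using H D n by (subst ennreal_mult[symmetric]) (auto simp: exp_minus et field_simps)
    finally show ?thesis .
  qed
  have "emeasure (chan f \<sigma> n) ?B = (\<integral>\<^sup>+h. emeasure (noise_vec \<sigma> n) (Pair h -` ?B) \<partial>fading_vec f n)"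
    using N.emeasure_pair_measure_alt[OF B'] by (simp only: chan_def)
  also have "\<dots> \<le> (\<integral>\<^sup>+h. ennreal (1 / sqrt (real n)) \<partial>fading_vec f n)"
  proof (rule nn_integral_mono_AE)
    show "AE h in fading_vec f n. emeasure (noise_vec \<sigma> n) (Pair h -` ?B) \<le> ennreal (1 / sqrt (real n))"
      using AE_fading_vec_pos[OF f, of n] AE_space by eventually_elim (rule sec_le)
  qed
  also have "\<dots> = ennreal (1 / sqrt (real n))" by (simp add: F.emeasure_space_1)
  finally have mB: "P.prob ?B \<le> 1 / sqrt (real n)"
    unfolding P.emeasure_eq_measure by (subst (asm) ennreal_le_iff) auto
  have "1 - perr f \<sigma> n G = P.prob (space (chan f \<sigma> n) - ?E)"
    unfolding perr_def using P.prob_compl[OF E] by simp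
  also have "\<dots> \<le> P.prob (?L \<union> ?B)"
    using L B by (intro P.finite_measure_mono) auto
  also have "\<dots> \<le> P.prob ?L + P.prob ?B"
    using L B by (rule measure_Un_le)
  finally show ?thesis using mB unfolding t_def D_def by linarith
qed

text \<open>The vector \<open>x\<close> beats the origin exactly when \<open>z - h x\<close> lies in
  the open ball \<open>U\<close> with \<open>z\<close> on its boundary. The noise density is at
  least \<open>q z\<close> on \<open>U\<close> and has total mass 1, and undoing the fading divides
  the volume by \<open>H\<close>.\<close>

lemma emeasure_dominating_points_le:
  assumes s: "\<sigma> > 0" and h: "\<And>i. i < n \<Longrightarrow> 0 < h i"
  shows "emeasure (LB n) {x \<in> space (LB n). (\<Sum>i<n. (z i - h i * x i)\<^sup>2) < (\<Sum>i<n. (z i)\<^sup>2)} \<le> ennreal (exp (inf_sum \<sigma> n h z))"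
proof -
  interpret N: prob_space "noise_vec \<sigma> n" using s by (rule prob_space_noise_vec)
  define H where "H = (\<Prod>i<n. h i)"
  have H: "H > 0" unfolding H_def using h by (intro prod_pos) auto
  define q where "q w = (\<Prod>i<n. normal_density 0 \<sigma> (w i))" for w
  have q: "q w > 0" for w unfolding q_def using s by (intro prod_pos normal_density_pos) auto
  have [measurable]: "q \<in> borel_measurable (LB n)" unfolding q_def by measurable
  define U where "U = {w \<in> space (LB n). (\<Sum>i<n. (w i)\<^sup>2) < (\<Sum>i<n. (z i)\<^sup>2)}"
  have [measurable]: "U \<in> sets (LB n)" unfolding U_def by measurable
  have q_exp: "q w = (1 / sqrt (2 * pi * \<sigma>\<^sup>2)) ^ n * exp (- (\<Sum>i<n. (w i)\<^sup>2) / (2 * \<sigma>\<^sup>2))" for w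
    unfolding q_def normal_density_def by (simp add: prod_dividef exp_sum[symmetric] sum_negf sum_divide_distrib power_divide)
  have "ennreal (q z) * emeasure (LB n) U = (\<integral>\<^sup>+w. ennreal (q z) * indicator U w \<partial>LB n)"
    by (rule nn_integral_cmult_indicator[symmetric]) measurable
  also have "\<dots> \<le> (\<integral>\<^sup>+w. ennreal (q w) \<partial>LB n)"
  proof (rule nn_integral_mono)
    fix w
    have "q z \<le> q w" if "w \<in> U"
      using that s unfolding q_exp U_def
      by (intro mult_left_mono) (auto intro!: divide_right_mono)
    then show "ennreal (q z) * indicator U w \<le> ennreal (q w)"
      by (cases "w \<in> U") (auto intro: ennreal_leI)
  qed
  also have "\<dots> = emeasure (noise_vec \<sigma> n) (space (noise_vec \<sigma> n))"
    unfolding noise_vec_density[OF s] q_def[symmetric]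
    by (subst emeasure_density) (auto intro!: nn_integral_cong)
  also have "\<dots> = 1" by (rule N.emeasure_space_1)
  finally have vol: "ennreal (q z) * emeasure (LB n) U \<le> 1" .
  let ?G = "\<lambda>i j. if i = j then - h i else 0"
  have det: "\<bar>gen_det n ?G\<bar> = H"
  proof -
    have "gen_det n ?G = (\<Prod>i<n. - h i)" by (subst gen_det_upper_triangular) auto
    then have "\<bar>gen_det n ?G\<bar> = (\<Prod>i<n. \<bar>- h i\<bar>)" by (simp only: abs_prod)
    also have "\<dots> = H" unfolding H_def using h by (intro prod.cong) (auto simp: less_imp_le)
    finally show ?thesis .
  qed
  have "emeasure (LB n) {x \<in> space (LB n). (\<Sum>i<n. (z i - h i * x i)\<^sup>2) < (\<Sum>i<n. (z i)\<^sup>2)}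
     = (\<integral>\<^sup>+x. indicator {x \<in> space (LB n). (\<Sum>i<n. (z i - h i * x i)\<^sup>2) < (\<Sum>i<n. (z i)\<^sup>2)} x \<partial>LB n)"
    by (rule nn_integral_indicator[symmetric]) measurable
  also have "\<dots> = (\<integral>\<^sup>+x. indicator U (\<lambda>i\<in>{..<n}. (\<Sum>j<n. ?G i j * x j) + z i) \<partial>LB n)"
  proof (rule nn_integral_cong)
    fix x assume x: "x \<in> space (LB n)"
    have "(\<Sum>j<n. ?G i j * x j) + z i = z i - h i * x i" if "i < n" for i
      using that by (simp add: if_distrib[of "\<lambda>y. y * _"] cong: if_cong)
    then have "(\<lambda>i\<in>{..<n}. (\<Sum>j<n. ?G i j * x j) + z i) = (\<lambda>i\<in>{..<n}. z i - h i * x i)"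
      by (intro restrict_ext) simp
    moreover have "(\<lambda>i\<in>{..<n}. z i - h i * x i) \<in> U \<longleftrightarrow> (\<Sum>i<n. (z i - h i * x i)\<^sup>2) < (\<Sum>i<n. (z i)\<^sup>2)"
      by (simp add: U_def space_PiM restrict_PiE_iff)
    ultimately show "indicator {x \<in> space (LB n). (\<Sum>i<n. (z i - h i * x i)\<^sup>2) < (\<Sum>i<n. (z i)\<^sup>2)} x
      = (indicator U (\<lambda>i\<in>{..<n}. (\<Sum>j<n. ?G i j * x j) + z i) :: ennreal)"
      using x by (simp only: indicator_def mem_Collect_eq simp_thms)
  qed
  also have "\<dots> = ennreal (1 / \<bar>gen_det n ?G\<bar>) * (\<integral>\<^sup>+x. indicator U x \<partial>LB n)"
    using det H by (intro nn_integral_LB_affine) auto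
  also have "\<dots> = ennreal (1 / H) * emeasure (LB n) U" unfolding det by simp
  also have "\<dots> = ennreal (exp (inf_sum \<sigma> n h z)) * (ennreal (q z) * emeasure (LB n) U)"
  proof -
    have "exp (- inf_sum \<sigma> n h z) = q z * H"
      unfolding q_def H_def using s h by (rule exp_neg_inf_sum)
    then have "exp (inf_sum \<sigma> n h z) = inverse (q z * H)" by (metis exp_minus inverse_inverse_eq)
    then have "1 / H = exp (inf_sum \<sigma> n h z) * q z" using q[of z] H by (simp add: field_simps)
    then show ?thesis by (simp add: ennreal_mult less_imp_le[OF q] mult.assoc)
  qed
  also have "\<dots> \<le> ennreal (exp (inf_sum \<sigma> n h z)) * 1" using vol by (rule mult_left_mono) simp
  finally show ?thesis by simp
qed

text \<open>Fades bounded below and noise bounded above confine the competitors of the origin to a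
  bounded set, as the averaging over lattices requires. \<open>Suc K\<close> keeps the lower
  threshold positive.\<close>

definition trunc_set :: "(real \<Rightarrow> real) \<Rightarrow> real \<Rightarrow> nat \<Rightarrow> nat \<Rightarrow> ((nat \<Rightarrow> real) \<times> (nat \<Rightarrow> real)) set" where
  "trunc_set f \<sigma> n K = {p \<in> space (chan f \<sigma> n). (\<forall>i\<in>{..<n}. 1 / real (Suc K) \<le> fst p i) \<and> (\<Sum>i<n. (snd p i)\<^sup>2) \<le> real K}"

lemma chan_truncation:
  assumes f: "regular_fading_pdf f" and s: "\<sigma> > 0" and e: "e > 0"
  obtains K :: nat where
    "trunc_set f \<sigma> n K \<in> sets (chan f \<sigma> n)"
    "measure (chan f \<sigma> n) (space (chan f \<sigma> n) - trunc_set f \<sigma> n K) \<le> e"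
proof -
  interpret F: prob_space "fading_vec f n" using f by (rule prob_space_fading_vec)
  interpret N: prob_space "noise_vec \<sigma> n" using s by (rule prob_space_noise_vec)
  interpret P: prob_space "chan f \<sigma> n" using f s by (rule prob_space_chan)
  define A where "A K = trunc_set f \<sigma> n K" for K
  have A: "A K \<in> P.events" for K
    unfolding A_def trunc_set_def chan_def by measurable
  have inc: "incseq A"
  proof (rule incseq_SucI)
    fix K
    have "1 / real (Suc (Suc K)) \<le> 1 / real (Suc K)" by (intro divide_left_mono) auto
    then show "A K \<le> A (Suc K)" unfolding A_def trunc_set_def by (auto intro: order_trans)
  qed
  have "(\<lambda>K. P.prob (A K)) \<longlonglongrightarrow> P.prob (\<Union>K. A K)"
    using A inc by (intro P.finite_Lim_measure_incseq) auto
  moreover have "P.prob (\<Union>K. A K) = 1"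
  proof -
    let ?U = "{h \<in> space (fading_vec f n). \<forall>i\<in>{..<n}. 0 < h i}"
    have U: "?U \<in> F.events" by measurable
    have "AE h in fading_vec f n. h \<in> ?U"
      using AE_fading_vec_pos[OF f, of n] AE_space by eventually_elim simp
    then have "emeasure (fading_vec f n) ?U = 1" by (intro F.emeasure_eq_1_AE U)
    then have "emeasure (chan f \<sigma> n) (?U \<times> space (noise_vec \<sigma> n)) = 1"
      unfolding chan_def using U by (subst N.emeasure_pair_measure_Times) (auto simp: N.emeasure_space_1)
    then have 1: "P.prob (?U \<times> space (noise_vec \<sigma> n)) = 1" by (simp add: measure_def)
    have sub: "?U \<times> space (noise_vec \<sigma> n) \<subseteq> (\<Union>K. A K)"
    proof
      fix p assume p: "p \<in> ?U \<times> space (noise_vec \<sigma> n)"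
      then have pos: "\<forall>i\<in>{..<n}. 0 < fst p i" and sp: "p \<in> space (chan f \<sigma> n)"
        by (auto simp: chan_def space_pair_measure)
      \<comment> \<open>A single number above both the noise energy and every
        \<open>1 / fst p i\<close>, so one \<open>K\<close> meets both conditions.\<close>
      define B where "B = (\<Sum>i<n. (snd p i)\<^sup>2) + (\<Sum>i<n. 1 / fst p i)"
      obtain K :: nat where K: "B \<le> real K" using real_arch_simple by blast
      have nn: "0 \<le> (\<Sum>i<n. (snd p i)\<^sup>2)" "0 \<le> (\<Sum>i<n. 1 / fst p i)"
        using pos by (auto intro!: sum_nonneg simp: less_imp_le)
      have "1 / real (Suc K) \<le> fst p i" if i: "i < n" for i
      proof -
        have "1 / fst p i \<le> (\<Sum>i<n. 1 / fst p i)"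
          using i pos by (intro member_le_sum[of i "{..<n}" "\<lambda>i. 1 / fst p i"]) (auto simp: less_imp_le)
        then have "1 / fst p i \<le> real (Suc K)" using K nn unfolding B_def by linarith
        moreover have "0 < fst p i" using pos i by simp
        ultimately show ?thesis by (simp add: field_simps)
      qed
      moreover have "(\<Sum>i<n. (snd p i)\<^sup>2) \<le> real K" using K nn unfolding B_def by linarith
      ultimately have "p \<in> A K" using sp by (auto simp: A_def trunc_set_def)
      then show "p \<in> (\<Union>K. A K)" by blast
    qed
    have "P.prob (?U \<times> space (noise_vec \<sigma> n)) \<le> P.prob (\<Union>K. A K)"
      using A by (intro P.finite_measure_mono sub) auto
    with 1 P.prob_le_1[of "\<Union>K. A K"] show ?thesis by linarith
  qed
  ultimately have "(\<lambda>K. P.prob (A K)) \<longlonglongrightarrow> 1" by simp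
  then have "\<forall>\<^sub>F K in sequentially. 1 - e < P.prob (A K)"
    using e by (intro order_tendstoD) auto
  then obtain K where "1 - e < P.prob (A K)" by (auto simp: eventually_sequentially)
  then have "P.prob (space (chan f \<sigma> n) - A K) \<le> e" using P.prob_compl[OF A, of K] by simp
  with A[of K] show ?thesis by (intro that[of K]) (simp_all add: A_def)
qed

text \<open>One lattice has to serve all fades, so the function averaged is \<open>g x\<close>, the
  probability that \<open>x\<close> beats the origin while the channel is in the good set
  \<open>A \<inter> L\<close>. The competitors contribute at most
  \<open>4 / D * exp s0 = 4 / sqrt n\<close> and the truncation \<open>1 / sqrt n\<close>; channels
  outside \<open>L\<close> are simply counted as errors.\<close>

lemma ex_good_lattice:
  assumes f: "regular_fading_pdf f" and s: "\<sigma> > 0" and n: "n \<ge> 2" and D: "D > 0"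
  shows "\<exists>G. gen_det n G = D \<and> perr f \<sigma> n G \<le>
    1 - inf_cdf f \<sigma> n (ln D - ln (real n) / 2) + 5 / sqrt (real n)"
proof -
  interpret P: prob_space "chan f \<sigma> n" using f s by (rule prob_space_chan)
  interpret LP: pair_sigma_finite "LB n" "chan f \<sigma> n"
    using lborel_fam.sigma_finite[of "{..<n}"] P.sigma_finite_measure_axioms by (simp add: pair_sigma_finite_def)
  define s0 where "s0 = ln D - ln (real n) / 2"
  have n0: "real n > 0" using n by simp
  have es0: "exp s0 = D / sqrt (real n)"
  proof -
    have "s0 = ln (D / sqrt (real n))" unfolding s0_def using D n0 by (simp add: ln_div ln_sqrt)
    then show ?thesis using D n0 by simp
  qed
  have e: "1 / sqrt (real n) > 0" using n0 by simp
  obtain K :: nat where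
    Am: "trunc_set f \<sigma> n K \<in> P.events"
    and Ap: "P.prob (space (chan f \<sigma> n) - trunc_set f \<sigma> n K) \<le> 1 / sqrt (real n)"
    by (rule chan_truncation[OF f s e])
  define A where "A = trunc_set f \<sigma> n K"
  define L where "L = {p \<in> space (chan f \<sigma> n). inf_sum \<sigma> n (fst p) (snd p) \<le> s0}"
  have mS[measurable]: "(\<lambda>p. inf_sum \<sigma> n (fst p) (snd p)) \<in> borel_measurable (chan f \<sigma> n)"
    unfolding chan_def by (rule inf_sum_measurable[OF sets_fading_vec sets_noise_vec])
  have A[measurable]: "A \<in> P.events" unfolding A_def by (rule Am)
  have L[measurable]: "L \<in> P.events" unfolding L_def by measurable
  define dom where "dom x p \<longleftrightarrow> (\<Sum>i<n. (snd p i - fst p i * x i)\<^sup>2) < (\<Sum>i<n. (snd p i)\<^sup>2)"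
    for x :: "nat \<Rightarrow> real" and p :: "(nat \<Rightarrow> real) \<times> (nat \<Rightarrow> real)"
  define Q where "Q = {q \<in> space (LB n \<Otimes>\<^sub>M chan f \<sigma> n). snd q \<in> A \<inter> L \<and> dom (fst q) (snd q)}"
  have Q: "Q \<in> sets (LB n \<Otimes>\<^sub>M chan f \<sigma> n)"
  proof -
    have 1: "{q \<in> space (LB n \<Otimes>\<^sub>M chan f \<sigma> n). snd q \<in> A \<inter> L} \<in> sets (LB n \<Otimes>\<^sub>M chan f \<sigma> n)"
      by measurable
    have 2: "{q \<in> space (LB n \<Otimes>\<^sub>M chan f \<sigma> n). dom (fst q) (snd q)} \<in> sets (LB n \<Otimes>\<^sub>M chan f \<sigma> n)"
      unfolding dom_def chan_def by measurable
    have "Q = {q \<in> space (LB n \<Otimes>\<^sub>M chan f \<sigma> n). snd q \<in> A \<inter> L} \<inter> {q \<in> space (LB n \<Otimes>\<^sub>M chan f \<sigma> n). dom (fst q) (snd q)}"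
      unfolding Q_def by blast
    with 1 2 show ?thesis by (simp only: sets.Int)
  qed
  define g where "g x = emeasure (chan f \<sigma> n) (Pair x -` Q)" for x
  have g_meas: "g \<in> borel_measurable (LB n)"
    unfolding g_def by (rule P.measurable_emeasure_Pair[OF Q])
  have sec: "Pair x -` Q = {p \<in> A \<inter> L. dom x p}" if "x \<in> space (LB n)" for x
    using that sets.sets_into_space[OF A] by (auto simp: Q_def space_pair_measure)
  have hpos: "0 < fst p i" if "p \<in> A" "i < n" for p i
  proof -
    have "1 / real (Suc K) \<le> fst p i" using that by (simp add: A_def trunc_set_def)
    then show ?thesis by (rule less_le_trans[rotated]) simp
  qed
  have "(\<integral>\<^sup>+x. g x \<partial>LB n) = emeasure (LB n \<Otimes>\<^sub>M chan f \<sigma> n) Q"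
    unfolding g_def by (rule P.emeasure_pair_measure_alt[OF Q, symmetric])
  also have "\<dots> = (\<integral>\<^sup>+p. emeasure (LB n) ((\<lambda>x. (x, p)) -` Q) \<partial>chan f \<sigma> n)"
    by (rule LP.emeasure_pair_measure_alt2[OF Q])
  also have "\<dots> \<le> (\<integral>\<^sup>+p. ennreal (exp s0) \<partial>chan f \<sigma> n)"
  proof (rule nn_integral_mono)
    fix p assume p: "p \<in> space (chan f \<sigma> n)"
    show "emeasure (LB n) ((\<lambda>x. (x, p)) -` Q) \<le> ennreal (exp s0)"
    proof (cases "p \<in> A \<inter> L")
      case True
      then have "(\<lambda>x. (x, p)) -` Q = {x \<in> space (LB n). (\<Sum>i<n. (snd p i - fst p i * x i)\<^sup>2) < (\<Sum>i<n. (snd p i)\<^sup>2)}"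
        using p by (auto simp: Q_def dom_def space_pair_measure)
      also have "emeasure (LB n) \<dots> \<le> ennreal (exp (inf_sum \<sigma> n (fst p) (snd p)))"
        using hpos[of p] True by (intro emeasure_dominating_points_le s) auto
      also have "\<dots> \<le> ennreal (exp s0)" using True by (intro ennreal_leI) (simp add: L_def)
      finally show ?thesis .
    next
      case False
      then have "(\<lambda>x. (x, p)) -` Q = {}" by (auto simp: Q_def)
      then show ?thesis by simp
    qed
  qed
  also have "\<dots> = ennreal (exp s0)" by (simp add: P.emeasure_space_1)
  finally have intg: "(\<integral>\<^sup>+x. g x \<partial>LB n) \<le> ennreal (exp s0)" .
  \<comment> \<open>If \<open>x\<close> beats the origin on \<open>A\<close>, each faded coordinate
    is at most \<open>2 * sqrt K\<close> in absolute value, and dividing by the smallest admissible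
    fade gives the radius; the added 1 makes the exclusion strict.\<close>
  define R where "R = 2 * sqrt (real K) * real (Suc K) + 1"
  have supp: "g x = 0" if x: "x \<in> space (LB n)" and i: "i < n" and R: "R \<le> \<bar>x i\<bar>" for x i
  proof -
    have "\<not> dom x p" if p: "p \<in> A \<inter> L" for p
    proof
      assume "dom x p"
      have le: "(\<Sum>i<n. (snd p i)\<^sup>2) \<le> real K" and h: "1 / real (Suc K) \<le> fst p i"
        using p i by (auto simp: A_def trunc_set_def)
      have "(snd p i - fst p i * x i)\<^sup>2 \<le> (\<Sum>i<n. (snd p i - fst p i * x i)\<^sup>2)"
        using i by (intro member_le_sum[of i "{..<n}" "\<lambda>i. (snd p i - fst p i * x i)\<^sup>2"]) auto
      also have "\<dots> \<le> real K" using \<open>dom x p\<close> le unfolding dom_def by linarith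
      finally have 1: "\<bar>snd p i - fst p i * x i\<bar> \<le> sqrt (real K)"
        by (rule real_le_rsqrt[of "\<bar>snd p i - fst p i * x i\<bar>", unfolded power2_abs])
      have "(snd p i)\<^sup>2 \<le> (\<Sum>i<n. (snd p i)\<^sup>2)"
        using i by (intro member_le_sum[of i "{..<n}" "\<lambda>i. (snd p i)\<^sup>2"]) auto
      also note le
      finally have 2: "\<bar>snd p i\<bar> \<le> sqrt (real K)"
        by (rule real_le_rsqrt[of "\<bar>snd p i\<bar>", unfolded power2_abs])
      have "fst p i * \<bar>x i\<bar> = \<bar>fst p i * x i\<bar>" using hpos[of p i] p i by (simp add: abs_mult)
      also have "\<dots> \<le> 2 * sqrt (real K)" using 1 2 by linarith
      finally have 3: "fst p i * \<bar>x i\<bar> \<le> 2 * sqrt (real K)" .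
      have "1 / real (Suc K) * \<bar>x i\<bar> \<le> fst p i * \<bar>x i\<bar>" using h by (rule mult_right_mono) simp
      with 3 have "\<bar>x i\<bar> / real (Suc K) \<le> 2 * sqrt (real K)" by simp
      then have "\<bar>x i\<bar> \<le> 2 * sqrt (real K) * real (Suc K)" by (subst (asm) pos_divide_le_eq) auto
      with R show False unfolding R_def by linarith
    qed
    then have "Pair x -` Q = {}" unfolding sec[OF x] by blast
    then show ?thesis by (simp add: g_def)
  qed
  have "\<exists>G. gen_det n G = D \<and> (\<integral>\<^sup>+k. g (\<lambda>i\<in>{..<n}. \<Sum>j<n. G i j * real_of_int (k j)) \<partial>count_space (ZN n - {\<lambda>i\<in>{..<n}. 0})) \<le> ennreal (4 / D) * (\<integral>\<^sup>+x. g x \<partial>LB n)"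
    using supp by (rule Minkowski_Hlawka_up_to_constant[OF n g_meas _ D])
  then obtain G where det: "gen_det n G = D" and sumg:
    "(\<integral>\<^sup>+k. g (\<lambda>i\<in>{..<n}. \<Sum>j<n. G i j * real_of_int (k j)) \<partial>count_space (ZN n - {\<lambda>i\<in>{..<n}. 0})) \<le> ennreal (4 / D) * (\<integral>\<^sup>+x. g x \<partial>LB n)"
    by blast
  let ?I = "ZN n - {\<lambda>i\<in>{..<n}. 0}"
  let ?pt = "\<lambda>k :: nat \<Rightarrow> int. \<lambda>i\<in>{..<n}. \<Sum>j<n. G i j * real_of_int (k j)"
  have cI: "countable ?I" using countable_ZN by (rule countable_subset[rotated]) blast
  have ptsp: "?pt k \<in> space (LB n)" for k by (simp add: space_PiM)
  have domev: "Pair (?pt k) -` Q \<in> P.events" for k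
    by (rule sets_Pair1[OF Q])
  let ?E = "{p \<in> space (chan f \<sigma> n). err_event n G (fst p) (snd p)}"
  have E: "?E \<in> P.events"
    unfolding chan_def by (rule sets_err_event[OF sets_fading_vec sets_noise_vec])
  let ?U = "\<Union>k\<in>?I. Pair (?pt k) -` Q"
  have U: "?U \<in> P.events" using domev by (intro sets.countable_UN'' cI) auto
  have cover: "?E \<subseteq> (space (chan f \<sigma> n) - A) \<union> (space (chan f \<sigma> n) - L) \<union> ?U"
  proof
    fix p assume p: "p \<in> ?E"
    show "p \<in> (space (chan f \<sigma> n) - A) \<union> (space (chan f \<sigma> n) - L) \<union> ?U"
    proof (cases "p \<in> A \<inter> L")
      case True
      from p obtain k where k: "k \<in> ZN n" and lt: "(\<Sum>i<n. (snd p i - fst p i * lat_pt n G k i)\<^sup>2) < (\<Sum>i<n. (snd p i)\<^sup>2)"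
        by (auto simp: err_event_def)
      have "k \<noteq> (\<lambda>i\<in>{..<n}. 0)"
      proof
        assume "k = (\<lambda>i\<in>{..<n}. 0)"
        then have "lat_pt n G k i = 0" for i by (simp add: lat_pt_def)
        with lt show False by simp
      qed
      then have kI: "k \<in> ?I" using k by blast
      have "dom (?pt k) p" using lt unfolding dom_def lat_pt_def by simp
      with True have "p \<in> Pair (?pt k) -` Q" unfolding sec[OF ptsp] by blast
      with kI show ?thesis by blast
    qed (use p in blast)
  qed
  have "emeasure (chan f \<sigma> n) ?U = (\<integral>\<^sup>+p. indicator ?U p \<partial>chan f \<sigma> n)"
    using U by simp
  also have "\<dots> \<le> (\<integral>\<^sup>+p. (\<integral>\<^sup>+k. indicator (Pair (?pt k) -` Q) p \<partial>count_space ?I) \<partial>chan f \<sigma> n)"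
  proof (rule nn_integral_mono)
    fix p
    show "indicator ?U p \<le> (\<integral>\<^sup>+k. (indicator (Pair (?pt k) -` Q) p :: ennreal) \<partial>count_space ?I)"
    proof (cases "p \<in> ?U")
      case True
      then obtain k where k: "k \<in> ?I" "p \<in> Pair (?pt k) -` Q" by blast
      have "indicator ?U p = (1 :: ennreal)" using True by (rule indicator_simps(1))
      also have "\<dots> = emeasure (count_space ?I) {k}"
        using k(1) by (subst emeasure_count_space_finite) auto
      also have "\<dots> = (\<integral>\<^sup>+j. indicator {k} j \<partial>count_space ?I)"
        using k(1) by (intro nn_integral_indicator[symmetric]) auto
      also have "\<dots> \<le> (\<integral>\<^sup>+j. (indicator (Pair (?pt j) -` Q) p :: ennreal) \<partial>count_space ?I)"
        using k(2) by (intro nn_integral_mono) (auto simp del: vimage_eq split: split_indicator)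
      finally show ?thesis .
    next
      case False
      then have "indicator ?U p = (0 :: ennreal)" by (rule indicator_simps(2))
      then show ?thesis by (simp only: zero_le)
    qed
  qed
  also have "\<dots> = (\<integral>\<^sup>+k. (\<integral>\<^sup>+p. indicator (Pair (?pt k) -` Q) p \<partial>chan f \<sigma> n) \<partial>count_space ?I)"
    using domev by (intro nn_integral_count_space_nn_integral cI borel_measurable_indicator)
  also have "\<dots> = (\<integral>\<^sup>+k. g (?pt k) \<partial>count_space ?I)"
    unfolding g_def using domev by (intro nn_integral_cong nn_integral_indicator)
  also have "\<dots> \<le> ennreal (4 / D) * ennreal (exp s0)"
    using sumg mult_left_mono[OF intg, of "ennreal (4 / D)"] by (rule order_trans) simp
  also have "\<dots> = ennreal (4 / sqrt (real n))"
    unfolding es0 using D n0 by (subst ennreal_mult[symmetric]) auto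
  finally have Ule: "P.prob ?U \<le> 4 / sqrt (real n)"
    unfolding P.emeasure_eq_measure by (subst (asm) ennreal_le_iff) auto
  have "perr f \<sigma> n G \<le> P.prob ((space (chan f \<sigma> n) - A) \<union> (space (chan f \<sigma> n) - L) \<union> ?U)"
    unfolding perr_def using A L U by (intro P.finite_measure_mono cover) auto
  also have "\<dots> \<le> P.prob ((space (chan f \<sigma> n) - A) \<union> (space (chan f \<sigma> n) - L)) + P.prob ?U"
    using A L U by (intro measure_Un_le) auto
  also have "P.prob ((space (chan f \<sigma> n) - A) \<union> (space (chan f \<sigma> n) - L)) \<le> P.prob (space (chan f \<sigma> n) - A) + P.prob (space (chan f \<sigma> n) - L)"
    using A L by (intro measure_Un_le) auto
  also have "P.prob (space (chan f \<sigma> n) - A) + P.prob (space (chan f \<sigma> n) - L) + P.prob ?U \<le> 1 / sqrt (real n) + (1 - P.prob L) + 4 / sqrt (real n)"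
    using Ap Ule P.prob_compl[OF L] unfolding A_def by linarith
  also have "\<dots> = 1 - P.prob L + 5 / sqrt (real n)" by (simp add: field_simps)
  finally show ?thesis using det unfolding L_def s0_def by (intro exI[of _ G]) auto
qed

section \<open>Second-order asymptotics\<close>

lemma std_normal_eq_gauss: "std_normal_distribution = gauss 1"
  by (simp add: gauss_def)

lemma real_distribution_std_normal: "real_distribution std_normal_distribution"
  unfolding std_normal_eq_gauss by (rule real_distribution_gauss) simp

text \<open>On \<open>[- R, R]\<close> the density is smallest at the ends. The resulting lower
  bound on the slope of \<open>\<Phi>\<close> converts errors in probability into errors in the
  quantile.\<close>

lemma cdf_std_normal_diff_ge:
  assumes R: "- R \<le> a" "a \<le> b" "b \<le> R"
  shows "std_normal_density R * (b - a) \<le> \<Phi> b - \<Phi> a"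
proof (cases "a = b")
  case False
  then have ab: "a < b" using R by simp
  interpret real_distribution std_normal_distribution by (rule real_distribution_std_normal)
  have "ennreal (std_normal_density R * (b - a)) = ennreal (std_normal_density R) * emeasure lborel {a<..b}"
    using ab by (simp add: ennreal_mult)
  also have "\<dots> = (\<integral>\<^sup>+x. ennreal (std_normal_density R) * indicator {a<..b} x \<partial>lborel)"
    by (rule nn_integral_cmult_indicator[symmetric]) simp
  also have "\<dots> \<le> (\<integral>\<^sup>+x. ennreal (std_normal_density x) * indicator {a<..b} x \<partial>lborel)"
  proof (rule nn_integral_mono)
    fix x :: real
    have "std_normal_density R \<le> std_normal_density x" if "x \<in> {a<..b}"
    proof -
      have "\<bar>x\<bar> \<le> \<bar>R\<bar>" using that R by auto
      then have "x\<^sup>2 \<le> R\<^sup>2" by (simp add: abs_le_square_iff)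
      then show ?thesis unfolding std_normal_density_def by (intro mult_left_mono) auto
    qed
    then show "ennreal (std_normal_density R) * indicator {a<..b} x \<le> ennreal (std_normal_density x) * indicator {a<..b} x"
      by (cases "x \<in> {a<..b}") (auto intro: ennreal_leI)
  qed
  also have "\<dots> = emeasure std_normal_distribution {a<..b}"
    by (rule emeasure_density[symmetric]) auto
  also have "\<dots> = ennreal (prob {a<..b})" by (rule emeasure_eq_measure)
  finally have "std_normal_density R * (b - a) \<le> prob {a<..b}"
    by (subst (asm) ennreal_le_iff) auto
  then show ?thesis using cdf_diff_eq[OF ab] by simp
qed simp

lemma Qfun_eq: "Qfun x = 1 - \<Phi> x"
proof -
  interpret real_distribution std_normal_distribution by (rule real_distribution_std_normal)
  have "{x<..} = space std_normal_distribution - {..x}" by auto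
  then have "prob {x<..} = 1 - prob {..x}" using prob_compl[of "{..x}"] by simp
  then show ?thesis by (simp add: Qfun_def cdf_def)
qed

text \<open>Existence of the quantile is the intermediate value theorem; strict monotonicity gives
  the uniqueness that the definite description in \<open>Qinv\<close> demands.\<close>

lemma cdf_std_normal_Qinv:
  assumes e: "0 < \<epsilon>" "\<epsilon> < 1"
  shows "\<Phi> (Qinv \<epsilon>) = 1 - \<epsilon>"
proof -
  interpret real_distribution std_normal_distribution by (rule real_distribution_std_normal)
  have cont: "continuous_on UNIV \<Phi>"
    using measure_gauss_singleton[of 1] isCont_cdf by (auto simp: std_normal_eq_gauss intro!: continuous_at_imp_continuous_on)
  have "\<forall>\<^sub>F x in at_bot. \<Phi> x < 1 - \<epsilon>"
    using e by (intro order_tendstoD(2)[OF cdf_lim_at_bot]) auto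
  then obtain a where a: "\<Phi> a < 1 - \<epsilon>" using eventually_happens'[OF trivial_limit_at_bot_linorder] by blast
  have "\<forall>\<^sub>F x in at_top. 1 - \<epsilon> < \<Phi> x"
    using e by (intro order_tendstoD(1)[OF cdf_lim_at_top_prob]) auto
  then obtain b where b: "1 - \<epsilon> < \<Phi> b" using eventually_happens'[OF trivial_limit_at_top_linorder] by blast
  have "a \<le> b"
  proof (rule ccontr)
    assume "\<not> a \<le> b"
    then have "\<Phi> b \<le> \<Phi> a" by (intro cdf_nondecreasing) simp
    with a b show False by linarith
  qed
  then obtain q where q: "\<Phi> q = 1 - \<epsilon>"
    using IVT'[of \<Phi> a "1 - \<epsilon>" b] a b continuous_on_subset[OF cont] by auto
  have less: "\<Phi> x < \<Phi> y" if "x < y" for x y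
  proof -
    have "0 < std_normal_density (\<bar>x\<bar> + \<bar>y\<bar>) * (y - x)"
      using that by (intro mult_pos_pos normal_density_pos) auto
    also have "\<dots> \<le> \<Phi> y - \<Phi> x"
      using that by (intro cdf_std_normal_diff_ge) auto
    finally show ?thesis by simp
  qed
  have "Qinv \<epsilon> = q"
    unfolding Qinv_def
  proof (rule the_equality)
    show "Qfun q = \<epsilon>" by (simp add: Qfun_eq q)
    fix x assume "Qfun x = \<epsilon>"
    then have "\<Phi> x = \<Phi> q" by (simp add: Qfun_eq q)
    with less[of x q] less[of q x] show "x = q" by (cases x q rule: linorder_cases) auto
  qed
  with q show ?thesis by simp
qed

text \<open>Near \<open>q\<close> an error of order \<open>1 / sqrt n\<close> in probability moves
  the argument of \<open>\<Phi>\<close> by the same order, hence \<open>n\<close> times the log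
  density by O(1). The terms of order \<open>ln n\<close> come from the smoothing shift
  \<open>C * ln n\<close> and from the thresholds displaced by \<open>ln n / 2\<close>.\<close>

lemma nld_second_order_bounds:
  assumes f: "regular_fading_pdf f" and s: "\<sigma> > 0" and e: "0 < \<epsilon>" "\<epsilon> < 1"
  shows "\<exists>C. \<forall>\<^sub>F n in sequentially. \<forall>G. gen_det n G \<noteq> 0 \<and> perr f \<sigma> n G \<le> \<epsilon> \<longrightarrow>
    nld n G \<le> delta_star f \<sigma> - sqrt (fading_V f / real n) * Qinv \<epsilon> + C * (ln (real n) / real n)"
    and "\<exists>C. \<forall>\<^sub>F n in sequentially. \<exists>G. gen_det n G \<noteq> 0 \<and> perr f \<sigma> n G \<le> \<epsilon> \<and>
    nld n G \<ge> delta_star f \<sigma> - sqrt (fading_V f / real n) * Qinv \<epsilon> - C * (ln (real n) / real n)"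
proof -
  interpret SN: real_distribution std_normal_distribution by (rule real_distribution_std_normal)
  define \<delta> where "\<delta> = delta_star f \<sigma>"
  define V where "V = fading_V f"
  define q where "q = Qinv \<epsilon>"
  define P where "P n x = inf_cdf f \<sigma> n x" for n x
  have q: "\<Phi> q = 1 - \<epsilon>" unfolding q_def using e by (rule cdf_std_normal_Qinv)
  have V: "V > 0"
  proof -
    have "0 \<le> (\<integral>x. ((\<integral>x. ln (x\<^sup>2) / 2 \<partial>fading_dist f) - ln (x\<^sup>2) / 2)\<^sup>2 \<partial>fading_dist f)"
      by (intro integral_nonneg_AE) simp
    then show ?thesis unfolding V_def fading_ln_moments(4)[OF f] by linarith
  qed
  obtain C where C: "C \<ge> 0"
    and up: "\<And>n x. n \<ge> 2 \<Longrightarrow> P n x \<le> \<Phi> ((x + real n * \<delta> + C * ln (real n)) / sqrt (real n * V)) + C / sqrt (real n)"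
    and lo: "\<And>n x. n \<ge> 2 \<Longrightarrow> \<Phi> ((x + real n * \<delta> - C * ln (real n)) / sqrt (real n * V)) - C / sqrt (real n) \<le> P n x"
    unfolding P_def \<delta>_def V_def using inf_sum_cdf_bounds[OF f s] by blast
  define \<kappa> where "\<kappa> = std_normal_density (\<bar>q\<bar> + 1)"
  have \<kappa>: "\<kappa> > 0" unfolding \<kappa>_def by (intro normal_density_pos) simp
  have slope: "\<kappa> * (b - a) \<le> \<Phi> b - \<Phi> a" if "q - 1 \<le> a" "a \<le> b" "b \<le> q + 1" for a b
    unfolding \<kappa>_def using that by (intro cdf_std_normal_diff_ge) auto
  \<comment> \<open>\<open>C\<close> stems from the normal approximation, 1 from the low-density
    part of the cell, and 5 from the lattice construction. The factor 2 in \<open>c1\<close> makes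
    the contradiction in the converse strict.\<close>
  define c1 where "c1 = 2 * (C + 1) / \<kappa>"
  define c2 where "c2 = (C + 5) / \<kappa>"
  have c: "c1 > 0" "c2 > 0" using C \<kappa> by (auto simp: c1_def c2_def)
  \<comment> \<open>The second condition keeps the perturbed quantile within distance 1 of
    \<open>q\<close>, where the slope bound holds; \<open>n \<ge> 3\<close> gives
    \<open>ln n \<ge> 1\<close>, so constants are absorbed by the logarithm.\<close>
  have large: "\<forall>\<^sub>F n in sequentially. n \<ge> 3 \<and> c0 / sqrt (real n) \<le> 1" for c0 :: real
  proof -
    obtain N :: nat where N: "c0\<^sup>2 \<le> real N" using real_arch_simple by blast
    have "n \<ge> 3 \<and> c0 / sqrt (real n) \<le> 1" if n: "n \<ge> max 3 N" for n :: nat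
    proof -
      have "c0\<^sup>2 \<le> real n" using N n by simp
      then have "c0 \<le> sqrt (real n)" by (rule real_le_rsqrt)
      then show ?thesis using n by (simp add: divide_le_eq)
    qed
    then show ?thesis unfolding eventually_sequentially by blast
  qed
  have ln1: "1 \<le> ln (real n)" if "n \<ge> 3" for n :: nat
  proof -
    have "exp 1 \<le> real n" using that exp_le by linarith
    then show ?thesis using that by (subst ln_ge_iff) auto
  qed
  have sqrtV: "sqrt (real n * V) / real n = sqrt (V / real n)" "sqrt (real n * V) / sqrt (real n) = sqrt V" if "n \<ge> 3" for n :: nat
    using that by (simp_all add: real_sqrt_mult real_sqrt_divide real_div_sqrt field_simps)
  show "\<exists>C. \<forall>\<^sub>F n in sequentially. \<forall>G. gen_det n G \<noteq> 0 \<and> perr f \<sigma> n G \<le> \<epsilon> \<longrightarrow>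
    nld n G \<le> delta_star f \<sigma> - sqrt (fading_V f / real n) * Qinv \<epsilon> + C * (ln (real n) / real n)"
  proof (intro exI[of _ "C + 1 / 2 + c1 * sqrt V"] eventually_mono[OF large[of c1]] allI impI)
    fix n G assume n': "n \<ge> 3 \<and> c1 / sqrt (real n) \<le> 1" and G: "gen_det n G \<noteq> 0 \<and> perr f \<sigma> n G \<le> \<epsilon>"
    then have n: "n \<ge> 3" and c1n: "c1 / sqrt (real n) \<le> 1" by auto
    have n0: "real n > 0" using n by simp
    define D where "D = \<bar>gen_det n G\<bar>"
    define w where "w = (ln D + ln (real n) / 2 + real n * \<delta> + C * ln (real n)) / sqrt (real n * V)"
    have sq: "sqrt (real n * V) > 0" using n0 V by simp
    have "1 - \<epsilon> \<le> P n (ln D + ln (real n) / 2) + 1 / sqrt (real n)"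
      using one_minus_perr_le[OF f s, of n G] G n unfolding P_def D_def by simp
    also have "P n (ln D + ln (real n) / 2) \<le> \<Phi> w + C / sqrt (real n)"
      unfolding w_def using n by (intro up) simp
    finally have ge: "1 - \<epsilon> \<le> \<Phi> w + (C + 1) / sqrt (real n)" by (simp add: add_divide_distrib)
    have w: "q - c1 / sqrt (real n) \<le> w"
    proof (rule ccontr)
      assume "\<not> q - c1 / sqrt (real n) \<le> w"
      then have "\<Phi> w \<le> \<Phi> (q - c1 / sqrt (real n))" by (intro SN.cdf_nondecreasing) simp
      moreover have "\<kappa> * (c1 / sqrt (real n)) \<le> \<Phi> q - \<Phi> (q - c1 / sqrt (real n))"
        using slope[of "q - c1 / sqrt (real n)" q] c1n c n0 by simp
      moreover have "\<kappa> * (c1 / sqrt (real n)) = 2 * ((C + 1) / sqrt (real n))"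
        using \<kappa> by (simp add: c1_def)
      moreover have "(C + 1) / sqrt (real n) > 0" using C n0 by simp
      ultimately show False using ge q by linarith
    qed
    have "sqrt (real n * V) * (q - c1 / sqrt (real n)) \<le> sqrt (real n * V) * w"
      using w sq by (intro mult_left_mono) auto
    also have "\<dots> = ln D + ln (real n) / 2 + real n * \<delta> + C * ln (real n)"
      unfolding w_def times_divide_eq_right
      by (rule nonzero_mult_div_cancel_left) (use sq in linarith)
    also have "sqrt (real n * V) * (q - c1 / sqrt (real n)) = sqrt (real n * V) * q - c1 * (sqrt (real n * V) / sqrt (real n))"
      by (simp add: right_diff_distrib)
    also have "\<dots> = sqrt (real n * V) * q - c1 * sqrt V" unfolding sqrtV(2)[OF n] ..
    finally have "- ln D \<le> real n * \<delta> - sqrt (real n * V) * q + (C + 1 / 2) * ln (real n) + c1 * sqrt V"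
      by (simp add: algebra_simps)
    also have "c1 * sqrt V \<le> c1 * sqrt V * ln (real n)"
      using c V ln1[OF n] mult_left_mono[of 1 "ln (real n)" "c1 * sqrt V"] by simp
    finally have "- ln D \<le> real n * \<delta> - sqrt (real n * V) * q + (C + 1 / 2 + c1 * sqrt V) * ln (real n)"
      by (simp add: algebra_simps)
    then have "- ln D / real n \<le> (real n * \<delta> - sqrt (real n * V) * q + (C + 1 / 2 + c1 * sqrt V) * ln (real n)) / real n"
      using n0 by (intro divide_right_mono) auto
    also have "\<dots> = \<delta> - (sqrt (real n * V) / real n) * q + (C + 1 / 2 + c1 * sqrt V) * (ln (real n) / real n)"
      using n0 by (simp add: add_divide_distrib diff_divide_distrib)
    also have "\<dots> = \<delta> - sqrt (V / real n) * q + (C + 1 / 2 + c1 * sqrt V) * (ln (real n) / real n)"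
      unfolding sqrtV(1)[OF n] ..
    also have "- ln D / real n = nld n G"
      unfolding nld_def D_def using G by (simp add: ln_div)
    finally show "nld n G \<le> delta_star f \<sigma> - sqrt (fading_V f / real n) * Qinv \<epsilon> + (C + 1 / 2 + c1 * sqrt V) * (ln (real n) / real n)"
      unfolding \<delta>_def V_def q_def .
  qed
  show "\<exists>C. \<forall>\<^sub>F n in sequentially. \<exists>G. gen_det n G \<noteq> 0 \<and> perr f \<sigma> n G \<le> \<epsilon> \<and>
    nld n G \<ge> delta_star f \<sigma> - sqrt (fading_V f / real n) * Qinv \<epsilon> - C * (ln (real n) / real n)"
  proof (intro exI[of _ "C + 1 / 2 + c2 * sqrt V"] eventually_mono[OF large[of c2]])
    fix n :: nat assume n': "n \<ge> 3 \<and> c2 / sqrt (real n) \<le> 1"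
    then have n: "n \<ge> 3" and c2n: "c2 / sqrt (real n) \<le> 1" by auto
    have n0: "real n > 0" using n by simp
    have sq: "sqrt (real n * V) > 0" using n0 V by simp
    \<comment> \<open>The log covolume, solved for so that the normalised threshold in the lower
      normal bound is exactly \<open>q + c2 / sqrt n\<close>.\<close>
    define l where "l = sqrt (real n * V) * (q + c2 / sqrt (real n)) - real n * \<delta> + (C + 1 / 2) * ln (real n)"
    have w: "(l - ln (real n) / 2 + real n * \<delta> - C * ln (real n)) / sqrt (real n * V) = q + c2 / sqrt (real n)"
    proof -
      have "l - ln (real n) / 2 + real n * \<delta> - C * ln (real n) = sqrt (real n * V) * (q + c2 / sqrt (real n))"
        unfolding l_def by (simp add: algebra_simps)
      then show ?thesis by (simp only:) (rule nonzero_mult_div_cancel_left, use sq in linarith)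
    qed
    obtain G where det: "gen_det n G = exp l" and err: "perr f \<sigma> n G \<le> 1 - P n (ln (exp l) - ln (real n) / 2) + 5 / sqrt (real n)"
      using ex_good_lattice[OF f s, of n "exp l"] n unfolding P_def by auto
    have "\<Phi> (q + c2 / sqrt (real n)) - C / sqrt (real n) \<le> P n (l - ln (real n) / 2)"
      using lo[of n "l - ln (real n) / 2"] n unfolding w by simp
    moreover have "\<kappa> * (c2 / sqrt (real n)) \<le> \<Phi> (q + c2 / sqrt (real n)) - \<Phi> q"
      using slope[of q "q + c2 / sqrt (real n)"] c2n c n0 by simp
    moreover have "\<kappa> * (c2 / sqrt (real n)) = C / sqrt (real n) + 5 / sqrt (real n)"
      using \<kappa> by (simp add: c2_def add_divide_distrib[symmetric])
    ultimately have err': "perr f \<sigma> n G \<le> \<epsilon>" using err q by simp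
    have "nld n G = - l / real n" unfolding nld_def det by (simp add: ln_div)
    also have "\<dots> = \<delta> - (sqrt (real n * V) / real n) * q - (c2 * (sqrt (real n * V) / sqrt (real n)) + (C + 1 / 2) * ln (real n)) / real n"
      unfolding l_def using n0 by (simp add: field_simps)
    also have "\<dots> = \<delta> - sqrt (V / real n) * q - (c2 * sqrt V + (C + 1 / 2) * ln (real n)) / real n"
      unfolding sqrtV[OF n] ..
    finally have nld: "nld n G = \<delta> - sqrt (V / real n) * q - (c2 * sqrt V + (C + 1 / 2) * ln (real n)) / real n" .
    have "c2 * sqrt V \<le> c2 * sqrt V * ln (real n)"
      using c V ln1[OF n] mult_left_mono[of 1 "ln (real n)" "c2 * sqrt V"] by simp
    then have "c2 * sqrt V + (C + 1 / 2) * ln (real n) \<le> (C + 1 / 2 + c2 * sqrt V) * ln (real n)"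
      by (simp add: algebra_simps)
    then have "(c2 * sqrt V + (C + 1 / 2) * ln (real n)) / real n \<le> (C + 1 / 2 + c2 * sqrt V) * ln (real n) / real n"
      using n0 by (intro divide_right_mono) auto
    then have "nld n G \<ge> \<delta> - sqrt (V / real n) * q - (C + 1 / 2 + c2 * sqrt V) * (ln (real n) / real n)"
      unfolding nld by simp
    then show "\<exists>G. gen_det n G \<noteq> 0 \<and> perr f \<sigma> n G \<le> \<epsilon> \<and>
      nld n G \<ge> delta_star f \<sigma> - sqrt (fading_V f / real n) * Qinv \<epsilon> - (C + 1 / 2 + c2 * sqrt V) * (ln (real n) / real n)"
      using det err' unfolding \<delta>_def V_def q_def by (intro exI[of _ G]) auto
  qed
qed

theorem theorem4p6:
  fixes f :: "real \<Rightarrow> real" and \<sigma> \<epsilon> :: real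
  assumes "regular_fading_pdf f" and "\<sigma> > 0" and "0 < \<epsilon>" and "\<epsilon> < 1"
  shows "((\<lambda>n::nat. delta_star_avg f \<sigma> n \<epsilon>
            - (delta_star f \<sigma> - sqrt (fading_V f / real n) * Qinv \<epsilon>))
           \<in> O(\<lambda>n. ln (real n) / real n)) \<and>
         ((\<lambda>n::nat. delta_star_max f \<sigma> n \<epsilon>
            - (delta_star f \<sigma> - sqrt (fading_V f / real n) * Qinv \<epsilon>))
           \<in> O(\<lambda>n. ln (real n) / real n))"
proof -
  \<comment> \<open>Both suprema range over this set once the two error probabilities are identified
    for invertible generators.\<close>
  define S where "S n = {nld n G | G. gen_det n G \<noteq> 0 \<and> perr f \<sigma> n G \<le> \<epsilon>}" for n
  define t where "t n = delta_star f \<sigma> - sqrt (fading_V f / real n) * Qinv \<epsilon>" for n :: nat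
  have avg: "delta_star_avg f \<sigma> n \<epsilon> = Sup (S n)" for n
    unfolding delta_star_avg_def S_def
    using lattice_avg_err_eq[OF assms(1,2)] by (intro arg_cong[where f=Sup]) auto
  have max: "delta_star_max f \<sigma> n \<epsilon> = Sup (S n)" for n
    unfolding delta_star_max_def S_def lattice_max_err_eq[OF assms(1,2)] ..
  obtain C1 where up: "\<forall>\<^sub>F n in sequentially. \<forall>G. gen_det n G \<noteq> 0 \<and> perr f \<sigma> n G \<le> \<epsilon> \<longrightarrow>
      nld n G \<le> t n + C1 * (ln (real n) / real n)"
    using nld_second_order_bounds(1)[OF assms] unfolding t_def by blast
  obtain C2 where lo: "\<forall>\<^sub>F n in sequentially. \<exists>G. gen_det n G \<noteq> 0 \<and> perr f \<sigma> n G \<le> \<epsilon> \<and>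
      nld n G \<ge> t n - C2 * (ln (real n) / real n)"
    using nld_second_order_bounds(2)[OF assms] unfolding t_def by blast
  have "\<forall>\<^sub>F n in sequentially. norm (Sup (S n) - t n) \<le> max \<bar>C1\<bar> \<bar>C2\<bar> * norm (ln (real n) / real n)"
    using up lo eventually_gt_at_top[of 0]
  proof eventually_elim
    case (elim n)
    define r where "r = ln (real n) / real n"
    have r: "r \<ge> 0" using elim(3) by (simp add: r_def)
    obtain G where G: "nld n G \<in> S n" "t n - C2 * r \<le> nld n G"
      using elim(2) unfolding S_def r_def by blast
    have ub: "x \<le> t n + C1 * r" if "x \<in> S n" for x
      using elim(1) that unfolding S_def r_def by blast
    \<comment> \<open>A real \<open>Sup\<close> is informative only for a nonempty set bounded
      above: the converse supplies the bound, the constructed lattice the element.\<close>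
    then have "bdd_above (S n)" by (rule bdd_aboveI)
    with G have "t n - C2 * r \<le> Sup (S n)" by (meson cSup_upper order_trans)
    moreover have "Sup (S n) \<le> t n + C1 * r"
      using G(1) ub by (intro cSup_least) auto
    moreover have "C1 * r \<le> max \<bar>C1\<bar> \<bar>C2\<bar> * r" "C2 * r \<le> max \<bar>C1\<bar> \<bar>C2\<bar> * r"
      using r by (auto intro!: mult_right_mono)
    ultimately have "\<bar>Sup (S n) - t n\<bar> \<le> max \<bar>C1\<bar> \<bar>C2\<bar> * r" by linarith
    then show ?case using r unfolding r_def by (simp only: real_norm_def abs_of_nonneg)
  qed
  then have "(\<lambda>n. Sup (S n) - t n) \<in> O(\<lambda>n. ln (real n) / real n)"
    by (rule bigoI)
  then show ?thesis unfolding avg max t_def by blast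
qed

end
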